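(* Let $N=23$ and $d=8$. There are real numbers $f_0,\dots,f_8$ with $f_k>0$ for $k\ge1$, and real symmetric positive definite matrices $F_0,\dots,F_8$ of orders $9,8,\dots,1$ respectively, such that, with $f=\sum_{k=0}^{8}f_kG_k$ and $F(u,v,t)=\sum_{k=0}^{8}\langle F_k,S_k(u,v,t)\rangle$, $$\omega(u)+\omega(v)+\omega(t)-f(u)-f(v)-f(t)-F(u,v,t)-\frac{F(1,u,u)+F(1,v,v)+F(1,t,t)}{N-2}\ \ge\ 0$$ for every $(u,v,t)\in[-1,\frac12]^3$ with $1+2uvt-u^2-v^2-t^2\ge0$, and such that $$B:=\frac N2\bigl(Nf_0-f(1)\bigr)-\frac{N\,F(1,1,1)}{6(N-2)}=0.0929000002\ldots\ >\ 8-A_*=0.0928555702\ldots.$$ Consequently every contact configuration of $23$ directions $w_1,\dots,w_{23}$ satisfies $\sum_{i<j}\omega(\langle w_i,w_j\rangle)\ge 8-A_*$ with $0.0000444$ to spare, and every such configuration with bounded cell has $$\mathrm{vol}(V_c)\ \ge\ \mathrm{vol}\bigl(V_c\cap B(\sqrt{3/2})\bigr)=A_*+\sum_{i<j}\omega(\langle w_i,w_j\rangle)\ \ge\ A_*+B\ >\ 8 .$$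
   Context: A contact configuration is a finite set $W\subset S^3\subset\mathbb{R}^4$ of unit vectors with $\langle w,w'\rangle\le\frac12$ for all distinct $w,w'\in W$; its cell is $V_c=\{x\in\mathbb{R}^4:\langle x,w\rangle\le1\ \forall w\in W\}$. $B(\rho)$ (with an argument) is the ball of radius $\rho$ about the origin in $\mathbb{R}^4$, while $B$ alone is the number in the claim. On $S^3$ with surface measure (total mass $2\pi^2$) a cap of radius $r$ has measure $C(r)=\pi(2r-\sin 2r)$, and $\Lambda(r,\gamma)$ is the measure of the intersection of two caps of radius $r$ with centres at angle $\gamma$. Put $r_*=\arcsin(1/\sqrt3)$, $$A_*=\tfrac14\Bigl[2\pi^2+\int_0^{r_*}(2\pi^2-23C(r))\,d(\sec^4r)\Bigr],\qquad \omega(u)=\tfrac14\int_0^{r_*}\Lambda(r,\arccos u)\,d(\sec^4r)$$ (the weight, as a function of the inner product $u\in[-1,\frac12]$). $G_k$ is the polynomial with $G_k(\cos\theta)=\sin((k+1)\theta)/((k+1)\sin\theta)$, $T_i$ is the Chebyshev polynomial of the first kind, and $P_k$ the Legendre polynomial. For $0\le k\le d$, $Y_k(u,v,t)$ is the square matrix of order $d-k+1$ with entries $$Y_k(u,v,t)_{ij}=T_i(u)\,T_j(v)\,\bigl((1-u^2)(1-v^2)\bigr)^{k/2}P_k\Bigl(\frac{t-uv}{\sqrt{(1-u^2)(1-v^2)}}\Bigr),\quad 0\le i,j\le d-k$$ (a polynomial in $u,v,t$), and $S_k$ is the average of $Y_k$ over the six permutations of $(u,v,t)$. $\langle X,Y\rangle=\mathrm{tr}(X^{\mathsf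 T}Y)$ for matrices. *)

theory Defs
  imports "HOL-Analysis.Analysis" "Jordan_Normal_Form.Matrix"
begin

section \<open>Contact configurations and the surface measure of the unit sphere\<close>

definition contact_configuration :: "(real^4) set \<Rightarrow> bool" where
  "contact_configuration W \<longleftrightarrow>
     finite W \<and> W \<subseteq> sphere 0 1 \<and> (\<forall>w\<in>W. \<forall>w'\<in>W. w \<noteq> w' \<longrightarrow> inner w w' \<le> 1/2)"

definition cell :: "(real^4) set \<Rightarrow> (real^4) set" where
  "cell W = {x. \<forall>w\<in>W. inner x w \<le> 1}"

text \<open>The surface measure of a set \<open>A\<close> of unit vectors is 4 times the volume of the cone
  consisting of the nonzero points \<open>x\<close> of the unit ball with \<open>x / norm x\<close> in \<open>A\<close>.\<close>

definition sphere_measure :: "(real^4) measure" where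
  "sphere_measure = scale_measure 4 (distr (restrict_space lborel (cball 0 1)) borel sgn)"

lemma emeasure_sphere_measure:
  assumes "A \<in> sets borel"
  shows "emeasure sphere_measure A = 4 * emeasure lborel {x \<in> cball 0 1. sgn x \<in> A}"
proof -
  have sgn: "sgn \<in> borel_measurable (borel :: (real^4) measure)"
    unfolding sgn_div_norm by measurable
  have "(sgn :: real^4 \<Rightarrow> _) \<in> measurable (restrict_space lborel (cball 0 1)) borel"
    using sgn by (intro measurable_restrict_space1) simp
  moreover have "sgn -` A \<inter> cball 0 1 = {x \<in> cball 0 1. sgn x \<in> A}" by auto
  ultimately show ?thesis
    using assms unfolding sphere_measure_def
    by (simp add: emeasure_distr space_restrict_space del: mem_cball_0)
      (subst emeasure_restrict_space, auto)
qed

lemma sphere_measure_total: "measure sphere_measure UNIV = 2 * pi^2"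
proof -
  have vol: "unit_ball_vol 4 = pi^2 / 2"
    using unit_ball_vol_even[of 2] by (simp add: fact_numeral)
  have "{x \<in> cball 0 1. sgn x \<in> UNIV} = cball (0 :: real^4) 1" by auto
  then have "emeasure sphere_measure UNIV = 4 * ennreal (pi^2 / 2)"
    by (subst emeasure_sphere_measure) (simp_all add: emeasure_cball vol del: mem_cball_0)
  also have "\<dots> = ennreal (2 * pi^2)"
    by (simp flip: ennreal_numeral ennreal_mult)
  finally show ?thesis by (simp add: measure_def)
qed

definition cap :: "real \<Rightarrow> real^4 \<Rightarrow> (real^4) set" where
  "cap r p = {x \<in> sphere 0 1. arccos (inner x p) \<le> r}"

definition cap_area :: "real \<Rightarrow> real" where
  "cap_area r = pi * (2 * r - sin (2 * r))"

text \<open>By rotation invariance the choice of the two centres at angle \<open>\<gamma>\<close> is immaterial.\<close>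

definition lens_area :: "real \<Rightarrow> real \<Rightarrow> real" where
  "lens_area r \<gamma> =
     measure sphere_measure
       (cap r (axis 1 1) \<inter> cap r (cos \<gamma> *\<^sub>R axis 1 1 + sin \<gamma> *\<^sub>R axis 2 1))"

definition r_star :: real where
  "r_star = arcsin (1 / sqrt 3)"

text \<open>Since \<open>sec\<close> is smooth on \<open>[0, r_star]\<close>, integration against \<open>d(sec\<^sup>4 r)\<close> is integration
  against the derivative of \<open>sec\<^sup>4\<close>.\<close>

definition integral_dsec4 :: "(real \<Rightarrow> real) \<Rightarrow> real" where
  "integral_dsec4 g = integral {0..r_star} (\<lambda>r. g r * deriv (\<lambda>s. (1 / cos s)^4) r)"

definition A_star :: real where
  "A_star = 1/4 * (2 * pi^2 + integral_dsec4 (\<lambda>r. 2 * pi^2 - 23 * cap_area r))"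

definition \<omega> :: "real \<Rightarrow> real" where
  "\<omega> u = 1/4 * integral_dsec4 (\<lambda>r. lens_area r (arccos u))"

definition weight_sum :: "nat \<Rightarrow> (nat \<Rightarrow> real^4) \<Rightarrow> real" where
  "weight_sum N w = (\<Sum>j\<in>{1..N}. \<Sum>i\<in>{1..<j}. \<omega> (inner (w i) (w j)))"


section \<open>Orthogonal polynomials\<close>

fun chebyshev_T :: "nat \<Rightarrow> real poly" where
  "chebyshev_T 0 = 1"
| "chebyshev_T (Suc 0) = [:0, 1:]"
| "chebyshev_T (Suc (Suc n)) = [:0, 2:] * chebyshev_T (Suc n) - chebyshev_T n"

fun chebyshev_U :: "nat \<Rightarrow> real poly" where
  "chebyshev_U 0 = 1"
| "chebyshev_U (Suc 0) = [:0, 2:]"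
| "chebyshev_U (Suc (Suc n)) = [:0, 2:] * chebyshev_U (Suc n) - chebyshev_U n"

definition G_poly :: "nat \<Rightarrow> real poly" where
  "G_poly k = Polynomial.smult (1 / real (k + 1)) (chebyshev_U k)"

lemma poly_chebyshev_T_cos: "poly (chebyshev_T n) (cos \<theta>) = cos (real n * \<theta>)"
proof (induction n rule: chebyshev_T.induct)
  case (3 n)
  have "cos (real (Suc (Suc n)) * \<theta>) = cos (real (Suc n) * \<theta> + \<theta>)"
    and "cos (real n * \<theta>) = cos (real (Suc n) * \<theta> - \<theta>)"
    by (simp_all add: algebra_simps)
  then show ?case
    by (simp add: 3 cos_add cos_diff del: of_nat_Suc)
qed auto

lemma poly_G_poly_cos:
  assumes "sin \<theta> \<noteq> 0"
  shows "poly (G_poly k) (cos \<theta>) = sin (real (k + 1) * \<theta>) / (real (k + 1) * sin \<theta>)"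
proof -
  have "poly (chebyshev_U k) (cos \<theta>) * sin \<theta> = sin (real (k + 1) * \<theta>)"
  proof (induction k rule: chebyshev_U.induct)
    case 2
    then show ?case by (simp add: sin_double)
  next
    case (3 n)
    have *: "sin (real (Suc (Suc n) + 1) * \<theta>) = sin (real (Suc n + 1) * \<theta> + \<theta>)"
      and "sin (real (n + 1) * \<theta>) = sin (real (Suc n + 1) * \<theta> - \<theta>)"
      by (simp_all add: algebra_simps)
    have "poly (chebyshev_U (Suc (Suc n))) (cos \<theta>) * sin \<theta>
        = 2 * cos \<theta> * (poly (chebyshev_U (Suc n)) (cos \<theta>) * sin \<theta>)
          - poly (chebyshev_U n) (cos \<theta>) * sin \<theta>"
      by (simp add: algebra_simps)
    also have "\<dots> = 2 * cos \<theta> * sin (real (Suc n + 1) * \<theta>) - sin (real (Suc n + 1) * \<theta> - \<theta>)"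
      using 3 \<open>sin (real (n + 1) * \<theta>) = _\<close> by simp
    also have "\<dots> = sin (real (Suc (Suc n) + 1) * \<theta>)"
      by (subst *) (simp only: sin_add sin_diff, simp add: algebra_simps)
    finally show ?case .
  qed simp
  with assms show ?thesis
    by (simp add: G_poly_def divide_simps)
qed

fun legendre :: "nat \<Rightarrow> real poly" where
  "legendre 0 = 1"
| "legendre (Suc 0) = [:0, 1:]"
| "legendre (Suc (Suc n)) =
     Polynomial.smult (1 / real (n + 2))
       (Polynomial.smult (real (2 * n + 3)) ([:0, 1:] * legendre (Suc n)) - Polynomial.smult (real (n + 1)) (legendre n))"

lemma degree_legendre_le: "degree (legendre n) \<le> n"
proof (induction n rule: legendre.induct)
  case (3 n)
  have "degree (pCons 0 (legendre (Suc n))) \<le> Suc (Suc n)"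
    by (rule order.trans[OF degree_pCons_le]) (simp add: 3)
  then have "degree (Polynomial.smult (real (2 * n + 3)) ([:0, 1:] * legendre (Suc n))
               - Polynomial.smult (real (n + 1)) (legendre n)) \<le> Suc (Suc n)"
    using 3 by (intro degree_diff_le order.trans[OF degree_smult_le]) auto
  then show ?case
    by (simp only: legendre.simps order.trans[OF degree_smult_le])
qed auto

lemma coeff_legendre_parity: "odd (n + m) \<Longrightarrow> coeff (legendre n) m = 0"
proof (induction n arbitrary: m rule: legendre.induct)
  case 1
  then show ?case by (cases m) auto
next
  case 2
  then show ?case by (cases m) (auto simp: coeff_pCons odd_pos split: nat.splits)
next
  case (3 n)
  then show ?case by (cases m) (auto simp: coeff_pCons)
qed


section \<open>The matrices of the three-point bound\<close>

text \<open>\<open>((1 - u\<^sup>2)(1 - v\<^sup>2))\<^bsup>k/2\<^esup> P\<^sub>k((t - uv) / sqrt ((1 - u\<^sup>2)(1 - v\<^sup>2)))\<close> written out as a polynomial,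
  so that it also has its intended value where \<open>u\<close> or \<open>v\<close> is \<open>1\<close> or \<open>-1\<close>. The terms with
  \<open>k - m\<close> odd vanish because \<open>P\<^sub>k\<close> has the parity of \<open>k\<close>.\<close>

definition homog_legendre :: "nat \<Rightarrow> real \<Rightarrow> real \<Rightarrow> real \<Rightarrow> real" where
  "homog_legendre k u v t =
     (\<Sum>m\<le>k. coeff (legendre k) m * (t - u * v)^m * ((1 - u^2) * (1 - v^2))^((k - m) div 2))"

lemma homog_legendre_eq:
  assumes "(1 - u^2) * (1 - v^2) > 0"
  shows "homog_legendre k u v t =
    ((1 - u^2) * (1 - v^2)) powr (real k / 2)
      * poly (legendre k) ((t - u * v) / sqrt ((1 - u^2) * (1 - v^2)))"
proof -
  define q where "q = (1 - u^2) * (1 - v^2)"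
  define s where "s = sqrt q"
  have q: "q > 0" using assms by (simp add: q_def)
  then have s: "s > 0" "s^2 = q" by (simp_all add: s_def)
  have powr: "q powr (real k / 2) = s^k"
    using q s(1) powr_powr[of q "1/2" "real k"] by (simp add: s_def powr_half_sqrt powr_realpow)
  have "poly (legendre k) ((t - u * v) / s)
      = (\<Sum>m\<le>k. coeff (legendre k) m * ((t - u * v) / s)^m)"
    unfolding poly_altdef using degree_legendre_le[of k]
    by (intro sum.mono_neutral_left) (auto simp: coeff_eq_0)
  then have "s^k * poly (legendre k) ((t - u * v) / s)
      = (\<Sum>m\<le>k. coeff (legendre k) m * (t - u * v)^m * (s^k / s^m))"
    by (simp add: sum_distrib_left power_divide mult_ac)
  also have "\<dots> = (\<Sum>m\<le>k. coeff (legendre k) m * (t - u * v)^m * q^((k - m) div 2))"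
  proof (intro sum.cong refl)
    fix m assume "m \<in> {..k}"
    then have m: "m \<le> k" by simp
    show "coeff (legendre k) m * (t - u * v)^m * (s^k / s^m)
        = coeff (legendre k) m * (t - u * v)^m * q^((k - m) div 2)"
    proof (cases "even (k + m)")
      case True
      with m have "even (k - m)" by simp
      then have "q^((k - m) div 2) = s^(k - m)"
        by (simp add: s(2)[symmetric] flip: power_mult)
      also have "\<dots> = s^k / s^m" using m s(1) by (simp add: power_diff)
      finally show ?thesis by simp
    next
      case False
      then show ?thesis by (simp add: coeff_legendre_parity)
    qed
  qed
  finally show ?thesis
    by (simp add: homog_legendre_def powr flip: q_def s_def)
qed

definition Y_mat :: "nat \<Rightarrow> nat \<Rightarrow> real \<Rightarrow> real \<Rightarrow> real \<Rightarrow> real mat" where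
  "Y_mat d k u v t = mat (d - k + 1) (d - k + 1)
     (\<lambda>(i, j). poly (chebyshev_T i) u * poly (chebyshev_T j) v * homog_legendre k u v t)"

definition S_mat :: "nat \<Rightarrow> nat \<Rightarrow> real \<Rightarrow> real \<Rightarrow> real \<Rightarrow> real mat" where
  "S_mat d k u v t = (1/6) \<cdot>\<^sub>m
     (Y_mat d k u v t + Y_mat d k u t v + Y_mat d k v u t + Y_mat d k v t u + Y_mat d k t u v + Y_mat d k t v u)"

definition trace_mat :: "real mat \<Rightarrow> real" where
  "trace_mat A = (\<Sum>i<dim_row A. A $$ (i, i))"

definition inner_mat :: "real mat \<Rightarrow> real mat \<Rightarrow> real" where
  "inner_mat X Z = trace_mat (transpose_mat X * Z)"

definition sym_pos_def :: "nat \<Rightarrow> real mat \<Rightarrow> bool" where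
  "sym_pos_def n A \<longleftrightarrow> A \<in> carrier_mat n n \<and> transpose_mat A = A \<and>
     (\<forall>x\<in>carrier_vec n. x \<noteq> 0\<^sub>v n \<longrightarrow> scalar_prod x (A *\<^sub>v x) > 0)"

definition two_point :: "nat \<Rightarrow> (nat \<Rightarrow> real) \<Rightarrow> real \<Rightarrow> real" where
  "two_point d f u = poly (\<Sum>k\<le>d. Polynomial.smult (f k) (G_poly k)) u"

definition three_point :: "nat \<Rightarrow> (nat \<Rightarrow> real mat) \<Rightarrow> real \<Rightarrow> real \<Rightarrow> real \<Rightarrow> real" where
  "three_point d F u v t = (\<Sum>k\<le>d. inner_mat (F k) (S_mat d k u v t))"

definition bound_B :: "nat \<Rightarrow> nat \<Rightarrow> (nat \<Rightarrow> real) \<Rightarrow> (nat \<Rightarrow> real mat) \<Rightarrow> real" where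
  "bound_B N d f F =
     real N / 2 * (real N * f 0 - two_point d f 1)
       - real N * three_point d F 1 1 1 / (6 * (real N - 2))"

end

theory Submission
  imports Defs "HOL-Real_Asymp.Real_Asymp"
begin

text \<open>Outside its cell, the ball of radius \<open>sqrt (3/2)\<close> is covered by the caps \<open>{x. inner x w > 1}\<close>.
  Two of them meet in a lens whose volume is the weight of the pair, and three never meet; so
  inclusion-exclusion gives the volume of the truncated cell as \<open>A_star\<close> plus the sum of the weights.
  Slicing a lens by the slope of the plane through the axis makes its volume elementary for inner
  products at least \<open>1/3\<close>, which yields \<open>A_star\<close> in closed form and a polynomial lower bound for the
  weight near \<open>1/2\<close>; elsewhere the weight is only used to be nonnegative.

  The kernels belonging to \<open>f\<close> and \<open>F\<close> are positive definite on the sphere: addition theorems expand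
  the polynomials \<open>U\<^sub>k\<close> into Legendre kernels one dimension lower, and these into the kernels
  \<open>Re (z ^ m * cnj w ^ m)\<close> of the circle. Summing the triple inequality over a configuration then
  bounds the sum of the weights from below.

  The triple inequality is decoupled by a univariate polynomial \<open>h\<close>: on the cube
  \<open>F(u,v,t) \<le> h(u) + h(v) + h(t)\<close>, and \<open>f + F(1,u,u)/21 + h \<le> \<omega>\<close> on the interval. Up to a residual
  dominated by its constant term, the first difference is a sum of squares plus a sum of squares
  times the product of the \<open>(1 + x) (1 - 2 x)\<close>; the second inequality follows from the signs of
  Bernstein coefficients. All data are integers, so that both certificates are checked by exact
  rewriting.\<close>

section \<open>Polynomials as coefficient lists\<close>

text \<open>The number 8 is the volume of the regular 24-cell circumscribed about the unit ball, and
  \<open>sqrt (3/2)\<close> is the distance of its edge midpoints: the least norm at which three of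
  the hyperplanes \<open>inner x w = 1\<close> can meet when the normals have inner products at most
  1/2. Thus it is the largest radius for which inclusion-exclusion stops at pairs. For this radius
  two caps overlap only if the inner product exceeds 1/3, so all weight sits on a short interval,
  and on the rest of the range \<open>f + F(1,u,u)/21 + h\<close> has to be nonpositive.

  The margin is only about 0.00004, so the bound for the weight has to be sharp near 1/2. A direct
  certificate of the triple inequality would involve a transcendental weight in three variables;
  after decoupling by \<open>h\<close> the weight occurs in one variable only, and the
  three-variable part is polynomial.

  The integer data need not solve any equation exactly. Definiteness is built into their shape
  (triangular factors, squares), and the equation between the two sides is relaxed to an inequality
  for the residual, so that only integer arithmetic remains to be checked.\<close>

text \<open>The constant term comes first. A polynomial in \<open>u\<close>, \<open>v\<close>, \<open>t\<close> is a list in \<open>u\<close> of lists in \<open>v\<close>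
  of lists in \<open>t\<close>.\<close>

fun hor :: "('a \<Rightarrow> real) \<Rightarrow> 'a list \<Rightarrow> real \<Rightarrow> real" where
  "hor f [] x = 0"
| "hor f (a # p) x = f a + x * hor f p x"

fun ladd :: "('a \<Rightarrow> 'a \<Rightarrow> 'a) \<Rightarrow> 'a list \<Rightarrow> 'a list \<Rightarrow> 'a list" where
  "ladd g [] q = q"
| "ladd g (a # p) [] = a # p"
| "ladd g (a # p) (b # q) = g a b # ladd g p q"

fun lmul :: "('a \<Rightarrow> 'a \<Rightarrow> 'a) \<Rightarrow> ('a \<Rightarrow> 'a \<Rightarrow> 'a) \<Rightarrow> 'a \<Rightarrow> 'a list \<Rightarrow> 'a list \<Rightarrow> 'a list" where
  "lmul g m z [] q = []"
| "lmul g m z (a # p) q = ladd g (map (m a) q) (z # lmul g m z p q)"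

text \<open>Transposition of a ragged coefficient matrix: the first row becomes the column of
  constant terms, and the other rows follow shifted by one place. On polynomials this exchanges two
  variables.\<close>

fun ltr :: "('a \<Rightarrow> 'a \<Rightarrow> 'a) \<Rightarrow> 'a \<Rightarrow> 'a list list \<Rightarrow> 'a list list" where
  "ltr g z [] = []"
| "ltr g z (r # p) = ladd (ladd g) (map (\<lambda>x. [x]) r) (map ((#) z) (ltr g z p))"

lemma hor_ladd:
  assumes "\<And>a b. f (g a b) = f a + f b"
  shows "hor f (ladd g p q) x = hor f p x + hor f q x"
proof (induction p arbitrary: q)
  case (Cons a p)
  then show ?case by (cases q) (auto simp: assms algebra_simps)
qed auto

lemma hor_map_scale:
  assumes "\<And>a. f (h a) = c * f a"
  shows "hor f (map h p) x = c * hor f p x"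
  by (induction p) (auto simp: assms algebra_simps)

lemma hor_lmul:
  assumes "\<And>a b. f (g a b) = f a + f b" "\<And>a b. f (m a b) = f a * f b" "f z = 0"
  shows "hor f (lmul g m z p q) x = hor f p x * hor f q x"
  by (induction p)
    (auto simp: hor_ladd[of f, OF assms(1)] hor_map_scale[of f "m _", OF assms(2)] assms(3) algebra_simps)

lemma hor_replicate: "f z = 0 \<Longrightarrow> hor f (replicate n z @ p) x = x ^ n * hor f p x"
  by (induction n) auto

lemma hor_ltr:
  assumes "\<And>a b. f (g a b) = f a + f b" "f z = 0"
  shows "hor (\<lambda>s. hor f s u) (ltr g z p) v = hor (\<lambda>r. hor f r v) p u"
proof (induction p)
  case (Cons r p)
  have "hor (\<lambda>s. hor f s u) (map (\<lambda>x. [x]) r) v = hor f r v"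
    by (induction r) auto
  moreover have "hor (\<lambda>s. hor f s u) (map ((#) z) q) v = u * hor (\<lambda>s. hor f s u) q v" for q
    by (induction q) (auto simp: assms algebra_simps)
  moreover have "hor (\<lambda>s. hor f s u) (ladd (ladd g) p' q) v
      = hor (\<lambda>s. hor f s u) p' v + hor (\<lambda>s. hor f s u) q v" for p' q
    by (intro hor_ladd) (auto simp: hor_ladd assms)
  ultimately show ?case
    using Cons by simp
qed auto

section \<open>Arithmetic of integer polynomials in one, two and three variables\<close>

abbreviation ev1 :: "int list \<Rightarrow> real \<Rightarrow> real" where
  "ev1 p t \<equiv> hor real_of_int p t"

abbreviation ev2 :: "int list list \<Rightarrow> real \<Rightarrow> real \<Rightarrow> real" where
  "ev2 p v t \<equiv> hor (\<lambda>q. ev1 q t) p v"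

abbreviation ev3 :: "int list list list \<Rightarrow> real \<Rightarrow> real \<Rightarrow> real \<Rightarrow> real" where
  "ev3 p u v t \<equiv> hor (\<lambda>q. ev2 q v t) p u"

definition add1 :: "int list \<Rightarrow> int list \<Rightarrow> int list" where "add1 = ladd (+)"
definition add2 :: "int list list \<Rightarrow> int list list \<Rightarrow> int list list" where "add2 = ladd add1"
definition add3 :: "int list list list \<Rightarrow> int list list list \<Rightarrow> int list list list" where "add3 = ladd add2"
definition scl1 :: "int \<Rightarrow> int list \<Rightarrow> int list" where "scl1 c = map ((*) c)"
definition scl2 :: "int \<Rightarrow> int list list \<Rightarrow> int list list" where "scl2 c = map (scl1 c)"
definition scl3 :: "int \<Rightarrow> int list list list \<Rightarrow> int list list list" where "scl3 c = map (scl2 c)"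
definition mul1 :: "int list \<Rightarrow> int list \<Rightarrow> int list" where "mul1 = lmul (+) (*) 0"
definition mul2 :: "int list list \<Rightarrow> int list list \<Rightarrow> int list list" where "mul2 = lmul add1 mul1 []"
definition mul3 :: "int list list list \<Rightarrow> int list list list \<Rightarrow> int list list list" where
  "mul3 = lmul add2 mul2 []"

lemma ev_add [simp]:
  "ev1 (add1 p q) t = ev1 p t + ev1 q t"
  "ev2 (add2 p' q') v t = ev2 p' v t + ev2 q' v t"
  "ev3 (add3 p'' q'') u v t = ev3 p'' u v t + ev3 q'' u v t"
proof -
  show 1: "ev1 (add1 p q) t = ev1 p t + ev1 q t" for p q
    unfolding add1_def by (rule hor_ladd) simp
  show 2: "ev2 (add2 p q) v t = ev2 p v t + ev2 q v t" for p q
    unfolding add2_def by (rule hor_ladd) (simp add: 1)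
  show "ev3 (add3 p'' q'') u v t = ev3 p'' u v t + ev3 q'' u v t"
    unfolding add3_def by (rule hor_ladd) (simp add: 2)
qed

lemma ev_scl [simp]:
  "ev1 (scl1 c p) t = c * ev1 p t"
  "ev2 (scl2 c p') v t = c * ev2 p' v t"
  "ev3 (scl3 c p'') u v t = c * ev3 p'' u v t"
proof -
  show 1: "ev1 (scl1 c p) t = c * ev1 p t" for p
    unfolding scl1_def by (rule hor_map_scale) simp
  show 2: "ev2 (scl2 c p) v t = c * ev2 p v t" for p
    unfolding scl2_def by (rule hor_map_scale) (simp add: 1)
  show "ev3 (scl3 c p'') u v t = c * ev3 p'' u v t"
    unfolding scl3_def by (rule hor_map_scale) (simp add: 2)
qed

lemma ev_mul [simp]:
  "ev1 (mul1 p q) t = ev1 p t * ev1 q t"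
  "ev2 (mul2 p' q') v t = ev2 p' v t * ev2 q' v t"
  "ev3 (mul3 p'' q'') u v t = ev3 p'' u v t * ev3 q'' u v t"
proof -
  show 1: "ev1 (mul1 p q) t = ev1 p t * ev1 q t" for p q
    unfolding mul1_def by (rule hor_lmul) simp_all
  show 2: "ev2 (mul2 p q) v t = ev2 p v t * ev2 q v t" for p q
    unfolding mul2_def by (rule hor_lmul) (simp_all add: 1)
  show "ev3 (mul3 p'' q'') u v t = ev3 p'' u v t * ev3 q'' u v t"
    unfolding mul3_def by (rule hor_lmul) (simp_all add: 2)
qed

section \<open>Sums of squares\<close>

definition shift3 :: "nat \<Rightarrow> nat \<Rightarrow> nat \<Rightarrow> int list list list \<Rightarrow> int list list list" where
  "shift3 i j k p = replicate i [] @ map (\<lambda>q. replicate j [] @ map ((@) (replicate k 0)) q) p"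

lemma ev3_shift3 [simp]: "ev3 (shift3 i j k p) u v t = u ^ i * v ^ j * t ^ k * ev3 p u v t"
proof -
  have "ev2 (map ((@) (replicate k 0)) q) v t = t ^ k * ev2 q v t" for q
    by (rule hor_map_scale) (simp add: hor_replicate)
  then have "ev3 (map (\<lambda>q. replicate j [] @ map ((@) (replicate k 0)) q) p) u v t
      = (v ^ j * t ^ k) * ev3 p u v t"
    by (intro hor_map_scale) (simp add: hor_replicate)
  then show ?thesis
    by (simp add: shift3_def hor_replicate)
qed

text \<open>The basis forms of the certificate have at most six monomials, so multiplying by one of
  them takes a few shifts of coefficient lists instead of a general product.\<close>

type_synonym sparse = "(int \<times> nat \<times> nat \<times> nat) list"

fun sev :: "sparse \<Rightarrow> real \<Rightarrow> real \<Rightarrow> real \<Rightarrow> real" where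
  "sev [] u v t = 0"
| "sev ((c, i, j, k) # b) u v t = c * (u ^ i * v ^ j * t ^ k) + sev b u v t"

fun smul :: "sparse \<Rightarrow> int list list list \<Rightarrow> int list list list" where
  "smul [] p = []"
| "smul ((c, i, j, k) # b) p = add3 (shift3 i j k (scl3 c p)) (smul b p)"

fun lincomb :: "int list \<Rightarrow> sparse list \<Rightarrow> int list list list" where
  "lincomb [] bs = []"
| "lincomb (x # xs) [] = []"
| "lincomb (x # xs) (b # bs) = add3 (smul b [[[x]]]) (lincomb xs bs)"

text \<open>\<open>square l\<close> stores the upper triangle of the symmetric matrix of \<open>(\<Sum>i. l ! i * b ! i)\<^sup>2\<close>,
  off-diagonal entries doubled. Summing the triangles first saves one multiplication of polynomials
  for each square.\<close>

fun square :: "int list \<Rightarrow> int list list" where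
  "square [] = []"
| "square (x # xs) = (x * x # scl1 (2 * x) xs) # square xs"

fun gram :: "int list list \<Rightarrow> int list list" where
  "gram [] = []"
| "gram (l # ls) = add2 (square l) (gram ls)"

fun gram_poly :: "int list list \<Rightarrow> sparse list \<Rightarrow> int list list list" where
  "gram_poly [] bs = []"
| "gram_poly (g # gs) [] = []"
| "gram_poly (g # gs) (b # bs) = add3 (smul b (lincomb g (b # bs))) (gram_poly gs bs)"

lemma ev3_smul [simp]: "ev3 (smul b p) u v t = sev b u v t * ev3 p u v t"
  by (induction b p rule: smul.induct) (auto simp: algebra_simps)

lemma ev3_lincomb_add1:
  "ev3 (lincomb (add1 xs ys) bs) u v t = ev3 (lincomb xs bs) u v t + ev3 (lincomb ys bs) u v t"
  unfolding add1_def
proof (induction "(+) :: int \<Rightarrow> _" xs ys arbitrary: bs rule: ladd.induct)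
  case (3 a p b q)
  then show ?case by (cases bs) (auto simp: algebra_simps)
qed auto

lemma ev3_lincomb_scl1: "ev3 (lincomb (scl1 c xs) bs) u v t = c * ev3 (lincomb xs bs) u v t"
  by (induction xs bs rule: lincomb.induct) (auto simp: scl1_def algebra_simps)

lemma ev3_gram_poly_add2:
  "ev3 (gram_poly (add2 g h) bs) u v t = ev3 (gram_poly g bs) u v t + ev3 (gram_poly h bs) u v t"
  unfolding add2_def
proof (induction add1 g h arbitrary: bs rule: ladd.induct)
  case (3 a p b q)
  then show ?case by (cases bs) (auto simp: ev3_lincomb_add1 algebra_simps simp del: lincomb.simps)
qed auto

lemma ev3_gram_poly_square: "ev3 (gram_poly (square l) bs) u v t = (ev3 (lincomb l bs) u v t)\<^sup>2"
  by (induction l bs rule: lincomb.induct)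
    (auto simp: ev3_lincomb_scl1 power2_eq_square algebra_simps)

lemma ev3_gram_poly_nonneg: "ev3 (gram_poly (gram ls) bs) u v t \<ge> 0"
  by (induction ls) (auto simp: ev3_gram_poly_add2 ev3_gram_poly_square)

section \<open>Symmetrization and coefficient bounds\<close>

definition swap_uv :: "int list list list \<Rightarrow> int list list list" where "swap_uv = ltr add1 []"
definition swap_vt :: "int list list list \<Rightarrow> int list list list" where "swap_vt = map (ltr (+) 0)"

lemma ev3_swap_uv: "ev3 (swap_uv p) u v t = ev3 p v u t"
  unfolding swap_uv_def by (rule hor_ltr) simp_all

lemma ev3_swap_vt: "ev3 (swap_vt p) u v t = ev3 p u t v"
proof -
  have "ev2 (ltr (+) 0 q) v t = ev2 q t v" for q
    by (rule hor_ltr) simp_all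
  then show ?thesis
    unfolding swap_vt_def by (induction p) auto
qed

definition sym_sum :: "(real \<Rightarrow> real \<Rightarrow> real \<Rightarrow> real) \<Rightarrow> real \<Rightarrow> real \<Rightarrow> real \<Rightarrow> real" where
  "sym_sum g u v t = g u v t + g u t v + g v u t + g v t u + g t u v + g t v u"

text \<open>Two separate functions, so that rewriting evaluates \<open>symA p\<close> before \<open>symB\<close> duplicates it.\<close>

fun symA :: "int list list list \<Rightarrow> int list list list" where
  "symA p = add3 p (swap_vt p)"
fun symB :: "int list list list \<Rightarrow> int list list list" where
  "symB p = add3 p (add3 (swap_uv p) (swap_vt (swap_uv p)))"

lemma ev3_sym: "ev3 (symB (symA p)) u v t = sym_sum (ev3 p) u v t"
  by (simp add: ev3_swap_uv ev3_swap_vt sym_sum_def algebra_simps)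

fun norm1 :: "int list \<Rightarrow> int" where
  "norm1 [] = 0" | "norm1 (a # p) = \<bar>a\<bar> + norm1 p"
fun norm2 :: "int list list \<Rightarrow> int" where
  "norm2 [] = 0" | "norm2 (a # p) = norm1 a + norm2 p"
fun norm3 :: "int list list list \<Rightarrow> int" where
  "norm3 [] = 0" | "norm3 (a # p) = norm2 a + norm3 p"

lemma abs_hor_step:
  fixes a b x m n :: real
  assumes "\<bar>x\<bar> \<le> 1" "\<bar>a\<bar> \<le> m" "\<bar>b\<bar> \<le> n"
  shows "\<bar>a + x * b\<bar> \<le> m + n"
proof -
  have "\<bar>x * b\<bar> \<le> 1 * \<bar>b\<bar>"
    unfolding abs_mult using assms(1) by (intro mult_right_mono) auto
  with assms show ?thesis by linarith
qed

lemma abs_ev1_le: "\<bar>t\<bar> \<le> 1 \<Longrightarrow> \<bar>ev1 p t\<bar> \<le> norm1 p"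
  by (induction p) (auto intro!: abs_hor_step)
lemma abs_ev2_le: "\<bar>v\<bar> \<le> 1 \<Longrightarrow> \<bar>t\<bar> \<le> 1 \<Longrightarrow> \<bar>ev2 p v t\<bar> \<le> norm2 p"
  by (induction p) (auto intro!: abs_hor_step abs_ev1_le)
lemma abs_ev3_le: "\<bar>u\<bar> \<le> 1 \<Longrightarrow> \<bar>v\<bar> \<le> 1 \<Longrightarrow> \<bar>t\<bar> \<le> 1 \<Longrightarrow> \<bar>ev3 p u v t\<bar> \<le> norm3 p"
  by (induction p) (auto intro!: abs_hor_step abs_ev2_le)

fun dom3 :: "int list list list \<Rightarrow> bool" where
  "dom3 (((a # p) # q) # r) \<longleftrightarrow> norm1 p + norm2 q + norm3 r \<le> a"
| "dom3 _ \<longleftrightarrow> False"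

lemma dom3_nonneg:
  assumes "dom3 p" "\<bar>u\<bar> \<le> 1" "\<bar>v\<bar> \<le> 1" "\<bar>t\<bar> \<le> 1"
  shows "ev3 p u v t \<ge> 0"
proof -
  obtain a p1 p2 p3 where p: "p = ((a # p1) # p2) # p3"
    using assms(1) by (cases p rule: dom3.cases) auto
  \<comment> \<open>The Horner chain with its constant term replaced by 0, so that the three bounds
    add up to the norm of all the other coefficients.\<close>
  have "\<bar>(0 + t * ev1 p1 t) + v * ev2 p2 v t\<bar> \<le> (0 + real_of_int (norm1 p1)) + real_of_int (norm2 p2)"
    by (rule abs_hor_step[OF assms(3) abs_hor_step[OF assms(4) _ abs_ev1_le[OF assms(4)]] abs_ev2_le[OF assms(3,4)]]) simp
  from abs_hor_step[OF assms(2) this abs_ev3_le[OF assms(2-4), of p3]]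
  have "\<bar>((0 + t * ev1 p1 t) + v * ev2 p2 v t) + u * ev3 p3 u v t\<bar>
      \<le> ((0 + real_of_int (norm1 p1)) + real_of_int (norm2 p2)) + real_of_int (norm3 p3)" .
  moreover have "real_of_int (norm1 p1 + norm2 p2 + norm3 p3) \<le> a"
    using assms(1) unfolding p of_int_le_iff by simp
  ultimately show ?thesis
    unfolding p by simp
qed

section \<open>Kernel polynomials\<close>

text \<open>Passage from Chebyshev to monomial coefficients: \<open>a\<close> and \<open>b\<close>
  carry two consecutive Chebyshev polynomials, and the recurrence supplies the next one.\<close>

fun cheb_comb :: "int list \<Rightarrow> int list \<Rightarrow> int list \<Rightarrow> int list" where
  "cheb_comb [] a b = []"
| "cheb_comb (x # xs) a b = add1 (scl1 x a) (cheb_comb xs b (add1 (0 # scl1 2 b) (scl1 (-1) a)))"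

text \<open>The homogenized Legendre polynomial times \<open>k!\<close>, which keeps the
  coefficients integral. Multiplying the Legendre recurrence by \<open>(n + 1)!\<close> turns its
  last factor into \<open>(n + 1)^2\<close>. The two literal polynomials are multiples of
  \<open>t - u * v\<close> and \<open>(1 - u^2) * (1 - v^2)\<close>.\<close>

fun leg_poly :: "nat \<Rightarrow> int list list list" where
  "leg_poly 0 = [[[1]]]"
| "leg_poly (Suc 0) = [[[0, 1]], [[], [-1]]]"
| "leg_poly (Suc (Suc n)) =
     add3 (mul3 [[[0, 2 * int n + 3]], [[], [- (2 * int n + 3)]]] (leg_poly (Suc n)))
          (scl3 (- ((int n + 1)\<^sup>2)) (mul3 [[[1], [], [-1]], [], [[-1], [], [1]]] (leg_poly n)))"

fun tensor :: "int list \<Rightarrow> int list list list" where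
  "tensor r = map (\<lambda>x. map (\<lambda>y. [x * y]) r) r"

fun tensor_sum :: "int list list \<Rightarrow> int list list list" where
  "tensor_sum [] = []"
| "tensor_sum (r # rs) = add3 (tensor (cheb_comb r [1] [0, 1])) (tensor_sum rs)"

fun kernel_poly :: "nat \<Rightarrow> int list list list \<Rightarrow> int list list list" where
  "kernel_poly k [] = []"
| "kernel_poly k (rs # rss) = add3 (mul3 (tensor_sum rs) (leg_poly k)) (kernel_poly (Suc k) rss)"

lemma ev3_tensor [simp]: "ev3 (tensor r) u v t = ev1 r u * ev1 r v"
proof -
  have "ev2 (map (\<lambda>y. [x * y]) r) v t = x * ev1 r v" for x
    by (induction r) (auto simp: algebra_simps)
  then have "ev3 (map (\<lambda>x. map (\<lambda>y. [x * y]) r) q) u v t = ev1 q u * ev1 r v" for q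
    by (induction q) (auto simp: algebra_simps)
  then show ?thesis by simp
qed

lemma homog_legendre_rec:
  "homog_legendre (Suc (Suc n)) u v t =
     (real (2 * n + 3) * ((t - u * v) * homog_legendre (Suc n) u v t)
      - real (n + 1) * ((1 - u\<^sup>2) * (1 - v\<^sup>2) * homog_legendre n u v t)) / real (n + 2)"
proof -
  define x where "x = t - u * v"
  define q where "q = (1 - u\<^sup>2) * (1 - v\<^sup>2)"
  define c where "c k m = coeff (legendre k) m" for k m
  define e where "e m = q ^ ((Suc (Suc n) - m) div 2)" for m
  have H: "homog_legendre k u v t = (\<Sum>m\<le>k. c k m * x ^ m * q ^ ((k - m) div 2))" for k
    by (simp add: homog_legendre_def x_def q_def c_def)
  \<comment> \<open>The coefficients of \<open>x\<close> times the polynomial of degree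
    \<open>Suc n\<close>. Their index shift leaves the exponent of \<open>q\<close> unchanged,
    whereas the polynomial of degree \<open>n\<close> gains exactly one factor
    \<open>q\<close>.\<close>
  define c' where "c' m = (case m of 0 \<Rightarrow> 0 | Suc m' \<Rightarrow> c (Suc n) m')" for m
  have c: "c (Suc (Suc n)) m = (real (2 * n + 3) * c' m - real (n + 1) * c n m) / real (n + 2)" for m
    by (simp add: c_def c'_def coeff_pCons split: nat.split)
  have 1: "(\<Sum>m\<le>Suc (Suc n). c' m * x ^ m * e m) = x * homog_legendre (Suc n) u v t"
    unfolding sum.atMost_Suc_shift[of _ "Suc n"] H
    by (simp add: c'_def e_def sum_distrib_left mult_ac del: sum.atMost_Suc)
  have "c n (Suc n) = 0" "c n (Suc (Suc n)) = 0"
    using degree_legendre_le[of n] by (simp_all add: c_def coeff_eq_0)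
  then have "(\<Sum>m\<le>Suc (Suc n). c n m * x ^ m * e m) = (\<Sum>m\<le>n. c n m * x ^ m * e m)"
    by simp
  also have "\<dots> = q * homog_legendre n u v t"
    unfolding H sum_distrib_left by (intro sum.cong) (auto simp: e_def Suc_diff_le)
  finally have 2: "(\<Sum>m\<le>Suc (Suc n). c n m * x ^ m * e m) = q * homog_legendre n u v t" .
  have "homog_legendre (Suc (Suc n)) u v t
      = (\<Sum>m\<le>Suc (Suc n). (real (2 * n + 3) * (c' m * x ^ m * e m)
          - real (n + 1) * (c n m * x ^ m * e m)) / real (n + 2))"
    unfolding H c by (intro sum.cong) (simp_all add: e_def algebra_simps diff_divide_distrib add_divide_distrib)
  also have "\<dots> = (real (2 * n + 3) * (\<Sum>m\<le>Suc (Suc n). c' m * x ^ m * e m)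
          - real (n + 1) * (\<Sum>m\<le>Suc (Suc n). c n m * x ^ m * e m)) / real (n + 2)"
    by (simp only: sum_divide_distrib[symmetric] sum_subtractf sum_distrib_left)
  finally show ?thesis
    unfolding 1 2 by (simp only: x_def q_def)
qed

lemma homog_legendre_0 [simp]: "homog_legendre 0 u v t = 1"
  by (simp add: homog_legendre_def)

lemma homog_legendre_1 [simp]: "homog_legendre (Suc 0) u v t = t - u * v"
  by (simp add: homog_legendre_def)

lemma homog_legendre_diag: "homog_legendre k u u 1 = (1 - u\<^sup>2) ^ k"
proof (induction k rule: legendre.induct)
  case (3 n)
  define X where "X = 1 - u\<^sup>2"
  have "real (2 * n + 3) * (X * (X * X ^ n)) - real (n + 1) * (X * X * X ^ n)
      = real (n + 2) * (X * (X * X ^ n))"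
    by (simp add: algebra_simps)
  moreover have "1 - u * u = X"
    by (simp add: X_def power2_eq_square)
  ultimately show ?case
    unfolding homog_legendre_rec 3 X_def[symmetric] by simp
qed (auto simp: power2_eq_square)

lemma homog_legendre_one: "k > 0 \<Longrightarrow> homog_legendre k 1 u u = 0"
  by (induction k rule: legendre.induct) (auto simp: homog_legendre_rec)

lemma homog_legendre_swap: "homog_legendre k u v t = homog_legendre k v u t"
  by (simp add: homog_legendre_def mult_ac)

lemma ev3_leg_poly: "ev3 (leg_poly k) u v t = fact k * homog_legendre k u v t"
proof (induction k rule: leg_poly.induct)
  case (3 n)
  show ?case
    unfolding homog_legendre_rec
    by (simp add: 3 field_simps power2_eq_square)
qed auto

section \<open>Rows of Chebyshev coefficients and the kernels they span\<close>

definition cheb_sum :: "int list \<Rightarrow> real \<Rightarrow> real" where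
  "cheb_sum r u = (\<Sum>i<length r. of_int (r ! i) * poly (chebyshev_T i) u)"

lemma ev1_cheb_comb:
  assumes "\<And>u. ev1 a u = poly (chebyshev_T n) u" "\<And>u. ev1 b u = poly (chebyshev_T (Suc n)) u"
  shows "ev1 (cheb_comb r a b) u = (\<Sum>i<length r. of_int (r ! i) * poly (chebyshev_T (n + i)) u)"
  using assms
proof (induction r arbitrary: a b n)
  case (Cons x r)
  have "ev1 (cheb_comb r b (add1 (0 # scl1 2 b) (scl1 (-1) a))) u
      = (\<Sum>i<length r. of_int (r ! i) * poly (chebyshev_T (Suc n + i)) u)"
    by (rule Cons.IH) (simp_all add: Cons.prems algebra_simps)
  then show ?case
    by (simp add: Cons.prems lessThan_Suc_eq_insert_0 sum.insert_if sum.reindex del: sum.lessThan_Suc)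
qed auto

lemma ev1_cheb_comb_eq: "ev1 (cheb_comb r [1] [0, 1]) u = cheb_sum r u"
  unfolding cheb_sum_def by (subst ev1_cheb_comb[where n = 0]) auto

definition kernel_sum :: "int list list \<Rightarrow> real \<Rightarrow> real \<Rightarrow> real" where
  "kernel_sum rs u v = (\<Sum>r\<leftarrow>rs. cheb_sum r u * cheb_sum r v)"

lemma ev3_tensor_sum: "ev3 (tensor_sum rs) u v t = kernel_sum rs u v"
  by (induction rs) (auto simp: kernel_sum_def ev1_cheb_comb_eq simp del: tensor.simps)

lemma ev3_kernel_poly:
  "ev3 (kernel_poly k rss) u v t =
     (\<Sum>i<length rss. fact (k + i) * kernel_sum (rss ! i) u v * homog_legendre (k + i) u v t)"
proof (induction rss arbitrary: k)
  case (Cons rs rss)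
  show ?case
    by (simp add: Cons ev3_tensor_sum ev3_leg_poly lessThan_Suc_eq_insert_0 sum.reindex del: sum.lessThan_Suc)
qed auto

section \<open>The matrices\<close>

definition coef :: "int list \<Rightarrow> nat \<Rightarrow> real" where
  "coef r i = (if i < length r then of_int (r ! i) else 0)"

definition gram_mat :: "nat \<Rightarrow> int list list \<Rightarrow> real mat" where
  "gram_mat n rs = mat n n (\<lambda>(i, j). \<Sum>r\<leftarrow>rs. coef r i * coef r j)"

lemma cheb_sum_coef:
  assumes "length r \<le> n"
  shows "cheb_sum r u = (\<Sum>i<n. coef r i * poly (chebyshev_T i) u)"
proof -
  have "(\<Sum>i<n. coef r i * poly (chebyshev_T i) u) = (\<Sum>i<length r. coef r i * poly (chebyshev_T i) u)"
    using assms by (intro sum.mono_neutral_right) (auto simp: coef_def)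
  then show ?thesis
    by (simp add: cheb_sum_def coef_def)
qed

lemma inner_mat_eq:
  assumes "A \<in> carrier_mat n n" "Z \<in> carrier_mat n n"
  shows "inner_mat A Z = (\<Sum>i<n. \<Sum>j<n. A $$ (j, i) * Z $$ (j, i))"
  using assms
  by (auto simp: inner_mat_def trace_mat_def scalar_prod_def atLeast0LessThan intro!: sum.cong)

lemma inner_gram_Y:
  assumes "\<forall>r\<in>set rs. length r \<le> d - k + 1"
  shows "inner_mat (gram_mat (d - k + 1) rs) (Y_mat d k u v t) = kernel_sum rs u v * homog_legendre k u v t"
proof -
  define n where "n = d - k + 1"
  define h where "h = homog_legendre k u v t"
  have "inner_mat (gram_mat n rs) (Y_mat d k u v t)
      = (\<Sum>i<n. \<Sum>j<n. (\<Sum>r\<leftarrow>rs. coef r j * coef r i)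
          * (poly (chebyshev_T j) u * poly (chebyshev_T i) v * h))"
    by (subst inner_mat_eq[where n = n]) (auto simp: gram_mat_def Y_mat_def n_def h_def simp del: sum.lessThan_Suc)
  also have "\<dots> = (\<Sum>r\<leftarrow>rs. \<Sum>i<n. \<Sum>j<n. coef r j * coef r i
          * (poly (chebyshev_T j) u * poly (chebyshev_T i) v * h))"
    by (induction rs) (simp_all add: sum.distrib distrib_right)
  also have "\<dots> = (\<Sum>r\<leftarrow>rs. (\<Sum>j<n. coef r j * poly (chebyshev_T j) u)
          * (\<Sum>i<n. coef r i * poly (chebyshev_T i) v) * h)"
  proof (rule arg_cong[where f = sum_list], rule map_cong[OF refl])
    fix r
    have "(\<Sum>i<n. \<Sum>j<n. coef r j * coef r i * (poly (chebyshev_T j) u * poly (chebyshev_T i) v * h))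
      = (\<Sum>j<n. \<Sum>i<n. (coef r j * poly (chebyshev_T j) u) * (coef r i * poly (chebyshev_T i) v) * h)"
      by (subst sum.swap) (simp add: mult_ac)
    then show "(\<Sum>i<n. \<Sum>j<n. coef r j * coef r i * (poly (chebyshev_T j) u * poly (chebyshev_T i) v * h))
      = (\<Sum>j<n. coef r j * poly (chebyshev_T j) u) * (\<Sum>i<n. coef r i * poly (chebyshev_T i) v) * h"
      unfolding sum_product by (simp only: sum_distrib_right)
  qed
  also have "\<dots> = (\<Sum>r\<leftarrow>rs. cheb_sum r u * cheb_sum r v * h)"
    using assms unfolding n_def[symmetric]
    by (intro arg_cong[where f = sum_list] map_cong refl) (auto simp: cheb_sum_coef)
  finally show ?thesis
    by (simp add: kernel_sum_def sum_list_mult_const n_def h_def)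
qed

lemma inner_mat_add:
  assumes "A \<in> carrier_mat n n" "Y \<in> carrier_mat n n" "Z \<in> carrier_mat n n"
  shows "inner_mat A (Y + Z) = inner_mat A Y + inner_mat A Z"
  using assms by (simp add: inner_mat_eq[where n = n] sum.distrib distrib_left)

lemma inner_mat_smult:
  assumes "A \<in> carrier_mat n n" "Z \<in> carrier_mat n n"
  shows "inner_mat (a \<cdot>\<^sub>m A) (b \<cdot>\<^sub>m Z) = a * b * inner_mat A Z"
proof -
  have "inner_mat (a \<cdot>\<^sub>m A) (b \<cdot>\<^sub>m Z) = (\<Sum>i<n. \<Sum>j<n. a * b * (A $$ (j, i) * Z $$ (j, i)))"
    using assms by (subst inner_mat_eq[where n = n]) (auto simp: mult_ac)
  then show ?thesis
    using assms by (simp add: inner_mat_eq[where n = n] sum_distrib_left)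
qed

lemma Y_mat_carrier [simp]: "Y_mat d k u v t \<in> carrier_mat (d - k + 1) (d - k + 1)"
  by (simp add: Y_mat_def)

lemma inner_gram_S:
  assumes "\<forall>r\<in>set rs. length r \<le> d - k + 1"
  shows "inner_mat (c \<cdot>\<^sub>m gram_mat (d - k + 1) rs) (S_mat d k u v t) =
    c / 6 * sym_sum (\<lambda>u v t. kernel_sum rs u v * homog_legendre k u v t) u v t"
proof -
  let ?n = "d - k + 1"
  have [simp]: "gram_mat ?n rs \<in> carrier_mat ?n ?n"
    by (simp add: gram_mat_def)
  show ?thesis
    unfolding S_mat_def sym_sum_def
    by (simp add: inner_mat_smult[where n = ?n] inner_mat_add[where n = ?n] inner_gram_Y[OF assms] del: One_nat_def add_Suc_right)
qed

text \<open>The quadratic form is a sum of squares, one for each row. If \<open>i\<close> is the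
  first position where \<open>x\<close> is nonzero, row \<open>i\<close> ends at position
  \<open>i\<close> and therefore sees only its nonzero diagonal entry times
  \<open>x $ i\<close>.\<close>

lemma sym_pos_def_gram:
  assumes "length rs = n" "\<forall>l<n. length (rs ! l) = Suc l \<and> last (rs ! l) \<noteq> 0" "c > 0"
  shows "sym_pos_def n (c \<cdot>\<^sub>m gram_mat n rs)"
  unfolding sym_pos_def_def
proof (intro conjI ballI impI)
  let ?A = "c \<cdot>\<^sub>m gram_mat n rs"
  show "?A \<in> carrier_mat n n"
    by (simp add: gram_mat_def)
  show "transpose_mat ?A = ?A"
    by (rule eq_matI) (auto simp: gram_mat_def mult_ac)
  fix x :: "real vec" assume x: "x \<in> carrier_vec n" and x0: "x \<noteq> 0\<^sub>v n"
  define y where "y r = (\<Sum>i<n. coef r i * x $ i)" for r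
  have "x \<bullet> (?A *\<^sub>v x) = (\<Sum>i<n. \<Sum>j<n. x $ i * (c * (\<Sum>r\<leftarrow>rs. coef r i * coef r j)) * x $ j)"
    using x by (simp add: scalar_prod_def gram_mat_def atLeast0LessThan sum_distrib_left mult_ac)
  moreover have "x $ i * (c * (\<Sum>r\<leftarrow>rs. coef r i * coef r j)) * x $ j
      = c * (\<Sum>r\<leftarrow>rs. (coef r i * x $ i) * (coef r j * x $ j))" for i j
    by (induction rs) (simp_all add: algebra_simps)
  then have "(\<Sum>i<n. \<Sum>j<n. x $ i * (c * (\<Sum>r\<leftarrow>rs. coef r i * coef r j)) * x $ j)
      = c * (\<Sum>i<n. \<Sum>j<n. \<Sum>r\<leftarrow>rs. (coef r i * x $ i) * (coef r j * x $ j))"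
    by (simp only: sum_distrib_left)
  moreover have "(\<Sum>i<n. \<Sum>j<n. \<Sum>r\<leftarrow>rs. (coef r i * x $ i) * (coef r j * x $ j)) = (\<Sum>r\<leftarrow>rs. y r * y r)"
    by (induction rs) (simp_all add: sum.distrib y_def sum_product)
  ultimately have eq: "x \<bullet> (?A *\<^sub>v x) = c * (\<Sum>r\<leftarrow>rs. y r * y r)"
    by (simp only:)
  have "\<exists>i. i < n \<and> x $ i \<noteq> 0"
    using x x0 by (metis carrier_vecD eq_vecI index_zero_vec)
  then obtain i where i': "i < n \<and> x $ i \<noteq> 0" "\<forall>j<i. \<not> (j < n \<and> x $ j \<noteq> 0)"
    unfolding exists_least_iff[of "\<lambda>i. i < n \<and> x $ i \<noteq> 0"] by blast
  then have i: "i < n" "x $ i \<noteq> 0" "\<And>j. j < i \<Longrightarrow> x $ j = 0"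
    by (meson less_trans)+
  have len: "length (rs ! i) = Suc i" "last (rs ! i) \<noteq> 0"
    using assms(2) i(1) by auto
  then have lst: "last (rs ! i) = rs ! i ! i"
    by (subst last_conv_nth) auto
  have "y (rs ! i) = (\<Sum>j\<in>{i}. coef (rs ! i) j * x $ j)"
    unfolding y_def using i len by (intro sum.mono_neutral_right) (auto simp: coef_def less_Suc_eq)
  also have "\<dots> \<noteq> 0"
    using i len lst by (auto simp: coef_def)
  finally have "0 < y (rs ! i) * y (rs ! i)"
    by (simp add: zero_less_mult_iff) linarith
  also have "\<dots> \<le> (\<Sum>r\<leftarrow>rs. y r * y r)"
    using i(1) assms(1) by (intro member_le_sum_list) auto
  finally show "x \<bullet> (?A *\<^sub>v x) > 0"
    unfolding eq using assms(3) by simp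
qed

section \<open>The certificate for triples\<close>

text \<open>Up to a factor, \<open>F\<^sub>k\<close> is \<open>L\<^sup>T L\<close> for the lower triangular matrix \<open>L\<close> whose rows are in
  \<open>kernel_coeffs ! k\<close>; its diagonal has no zero, hence \<open>F\<^sub>k\<close> is positive definite.\<close>

definition h_coeffs :: "int list" where
  "h_coeffs =
    [-9599, -25960, -22176, 199107, 245172, -337579, -208298, 48253, 23861]"

definition kernel_coeffs :: "int list list list" where
  "kernel_coeffs =
    [[[1], [0, 207], [109, -52, 218], [27, 225, 54, 308], [-12, 268, -23, 102, 97], [-12119,
    84004, -23733, 29645, 5882, 10912], [59249, 350714, 128354, 207583, 56292, 43154, 9266],
    [10438, 3033, 38071, 33703, 41943, 18088, 14109, 7409], [6067, 186202, 37901, 118754,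
    36100, 59773, 23172, 11176, 5614]], [[200], [-119, 353], [93527, -44632, 92069], [-55272,
    53915, 9286, 85833], [147460, 51971, 263204, 47458, 66819], [269747, 536849, 424528,
    249037, 126189, 45261], [116811, 423046, 177207, 221736, 101356, 59699, 27638], [258215,
    351322, 396753, 214581, 189108, 96755, 42075, 18124]], [[81], [17, 294], [204, -59, 189],
    [1009, -14, 952, 222], [36280, 71040, 140537, 79119, 30294], [139276, 124940, 166945,
    90206, 26817, 14319], [257688, 503322, 363633, 271757, 147722, 71851, 22962]], [[120],
    [-12, 83], [33, -66, 30], [-12962, -28367, 6877, 15595], [16329, -1896, 41763, 22015,
    11508], [148566, 231393, 203319, 122212, 68038, 23873]], [[17], [27, 56], [-34, -116, 11],
    [-13643, -13040, 4849, 9947], [35243, 66101, 53091, 29600, 16127]], [[2], [0, 2], [3605,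
    -3147, 6983], [2120, 19505, 3187, 9078]], [[1], [0, 1], [2306, -518, 3107]], [[1], [21,
    645]], [[1]]]"

definition triv_coeffs :: "int list list" where
  "triv_coeffs =
    [[-480774, 2059318, 18187408, 4705872, 8168883, 820604, -58182321, -52131585, 40531522,
    186706107, -6766088, -48877815, -12176637, 4720101, 98704138, -140255181, 87786605,
    28615664, 44731039, -11347784, -28498828, 37574601, 36417307, -9125241, 27750824, 57023257,
    -6608849, -43139684], [-565174, -87823, 7844644, 13571110, 365292, -7595320, -72533466,
    -1571921, 76193170, 0, 10567496, -10242790, -37110100, -7416204, 150617613, -80440411,
    -60330725, 59449804, 19799913, 10575900, 1805720, 4635259, -14089513, 20636981, 26741024,
    -68773063, 3251118, -46033091], [191949, 772094, 1449217, 8768476, -970614, -846741,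
    7046042, 4026567, -14113993, 0, -2454520, -7134965, -5843227, 1221899, 0, 61339149,
    39307411, -30861097, -48793012, -1266108, -6784468, -13225485, 732706, 13644845, -34215990,
    20368515, -24567291, 40118995], [-203, 3305, 247041, 1840840, 57328, 965068, 1086409,
    1219396, -4655840, 0, -320120, -1293269, 4051265, -1395686, 0, 0, 8070405, -30399173,
    11260299, -496244, -4247964, -7631799, -5452151, 8050854, -4069122, 11317505, -989161,
    35297094]]"

definition std_coeffs :: "int list list" where
  "std_coeffs =
    [[-5189253, 7969604, 5930509, -5118517, 37842860, -26251401, 33261985, -58788121, 10855108,
    -9407330, 46006361, -21597486, -65439907, -92669048, 132942413, 235770764, -38000008,
    51253999, -21290895, -3913026, 485355, -1948394, 6841454, 1129630, -20663663, 24643914,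
    1923027, -12920643, 58866834, -13813383, -87401214, 47568623, 81221497, 29337771],
    [1860528, 977047, 634170, 15787884, 7647970, -1611240, -117402, 18304498, -6344567,
    5805892, -5440427, 39905498, 13232053, -40318000, -932682, 0, -11721271, -45946327,
    211584127, -21998770, -5108613, -10349343, -12025047, 12817334, 157152, -16608424,
    10940872, -26458567, 28834472, 44204805, 37041923, -5151064, 43604831, -82322294], [242340,
    -3169944, -3271878, -609135, -2899089, -11997512, -10855816, 11493298, 3368066, -9424052,
    -27938912, -11197534, -34083038, -5232382, -60499628, 0, 83502312, -56868339, 0, -9844931,
    6522027, -14256233, -22124258, -5048322, -24525935, -15837017, 21599065, 42151159,
    -30848381, 9125359, 64309119, -31015812, 5060634, -44880272], [250214, 540018, 77356,
    8408070, 345731, -4366962, -5909520, 13700690, -208450, 133088, 4903691, 12375515,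
    17467817, -8903050, -5113969, 0, 0, 10367777, 0, 40883098, -282710, -21632750, -2571752,
    2542583, -13716333, -31839648, 10619683, 37932720, 33338743, 68240828, 21841130, 15716056,
    -26305474, -31553968], [323757, -1297313, 117848, -1099252, -4825659, -1231345, 6258359,
    -2929197, -530436, -2949834, -12102665, -9312036, 15765460, 22776498, -8024685, 0, 0,
    -23258685, 0, -8140287, -262551, 687737, -2244919, -9061581, 20076243, 40298434, -15451372,
    -24916476, -320134, 0, -16560396, 9904493, -7113541, 39531973]]"

definition box_coeffs :: "int list list" where
  "box_coeffs =
    [[3017668, 25859035, 83431220, 186299924, 33755894, 30220216, 1655715, -28524926, 22442677,
    13241358], [720853, -1092983, -10508531, 0, -3826939, 3990113, -48786041, 25494028,
    13671167, 59059753]]"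

text \<open>Both sides of the inequality are symmetric in \<open>(u, v, t)\<close>. The Gram matrices are therefore block
  diagonalized: one block for the invariant forms, and one for a single component of the standard
  representation, as its other component contributes the same amount after symmetrization.\<close>

fun orbit_sum :: "nat \<times> nat \<times> nat \<Rightarrow> sparse" where
  "orbit_sum (a, b, c) =
     map (Pair 1) (remdups [(a, b, c), (a, c, b), (b, a, c), (b, c, a), (c, a, b), (c, b, a)])"

fun std_forms :: "nat \<times> nat \<times> nat \<Rightarrow> sparse list" where
  "std_forms (a, b, c) =
     (if b < a \<and> c < b then
        [[(1, a, b, c), (1, a, c, b), (-1, b, a, c), (-1, b, c, a)],
         [(1, b, a, c), (1, b, c, a), (-1, c, a, b), (-1, c, b, a)]]
      else if a = b \<and> b = c then []
      else if b = c then [[(2, a, b, b), (-1, b, a, b), (-1, b, b, a)]]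
      else [[(2, c, a, a), (-1, a, c, a), (-1, a, a, c)]])"

text \<open>One representative \<open>a \<ge> b \<ge> c\<close> for each orbit of monomials. The
  kernel has degree at most 8 in each variable and 16 in total, so the bounds 4 and 8 suffice for
  forms that are to be squared. The box factor has degree 2 in each variable, which leaves exponents
  up to 3 for the forms multiplied by it.\<close>

definition exponents :: "nat \<Rightarrow> nat \<Rightarrow> (nat \<times> nat \<times> nat) list" where
  "exponents m n =
     filter (\<lambda>(a, b, c). a + b + c \<le> n)
       (concat (map (\<lambda>a. concat (map (\<lambda>b. map (\<lambda>c. (a, b, c)) [0..<Suc b]) [0..<Suc a])) [0..<Suc m]))"

definition triv_forms :: "nat \<Rightarrow> nat \<Rightarrow> sparse list" where
  "triv_forms m n = map orbit_sum (exponents m n)"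

definition std_basis :: "sparse list" where
  "std_basis = concat (map std_forms (exponents 4 8))"

definition box_mul :: "int list list list \<Rightarrow> int list list list" where
  "box_mul p = mul3 [[[1]], [[-1]], [[-2]]] (mul3 [[[1], [-1], [-2]]] (mul3 [[[1, -1, -2]]] p))"

text \<open>The kernel is scaled by \<open>1 / (6000 * 2 ^ 28)\<close> and \<open>h_coeffs\<close>
  by \<open>1 / (1000 * 2 ^ 12)\<close>, and each value of \<open>h\<close> occurs twice among the
  six permutations. The quotient \<open>6000 * 2 ^ 28 / (2 * 1000 * 2 ^ 12)\<close> is
  \<open>3 * 2 ^ 16\<close>.\<close>

definition target_poly :: "int list list list" where
  "target_poly = add3 (scl3 (3 * 2 ^ 16) (map (\<lambda>x. [[x]]) h_coeffs)) (scl3 (-1) (kernel_poly 0 kernel_coeffs))"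

definition sos_poly :: "int list list list" where
  "sos_poly = add3
     (scl3 8 (add3 (gram_poly (gram triv_coeffs) (triv_forms 4 8)) (gram_poly (gram std_coeffs) std_basis)))
     (box_mul (gram_poly (gram box_coeffs) (triv_forms 3 4)))"

definition residual_poly :: "int list list list" where
  "residual_poly = symB (symA (add3 (scl3 (2 ^ 21) target_poly) (scl3 (-1) sos_poly)))"

lemma dom3_residual: "dom3 residual_poly"
  by code_simp

text \<open>The factor \<open>fact k\<close> is the one carried by \<open>leg_poly k\<close>, so
  that \<open>kernel_poly\<close> describes all these matrices with one common denominator.\<close>

definition kernel_mat :: "nat \<Rightarrow> real mat" where
  "kernel_mat k = (fact k / (1000 * 2 ^ 28)) \<cdot>\<^sub>m gram_mat (9 - k) (kernel_coeffs ! k)"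

lemma length_kernel_coeffs: "map (map length) kernel_coeffs = map (\<lambda>k. map Suc [0..<9 - k]) [0..<9]"
  by code_simp

lemma last_kernel_coeffs: "list_all (list_all (\<lambda>r. last r \<noteq> 0)) kernel_coeffs"
  by code_simp

lemma kernel_coeffs_shape:
  "length kernel_coeffs = 9"
  "k < 9 \<Longrightarrow> length (kernel_coeffs ! k) = 9 - k"
  "k < 9 \<Longrightarrow> l < 9 - k \<Longrightarrow> length (kernel_coeffs ! k ! l) = Suc l"
  "k < 9 \<Longrightarrow> l < 9 - k \<Longrightarrow> last (kernel_coeffs ! k ! l) \<noteq> 0"
proof -
  show len: "length kernel_coeffs = 9"
    using arg_cong[OF length_kernel_coeffs, of length] by simp
  show len': "length (kernel_coeffs ! k) = 9 - k" if "k < 9" for k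
    using arg_cong[OF length_kernel_coeffs, of "\<lambda>xs. length (xs ! k)"] that len by simp
  show "length (kernel_coeffs ! k ! l) = Suc l" if "k < 9" "l < 9 - k"
    using arg_cong[OF length_kernel_coeffs, of "\<lambda>xs. xs ! k ! l"] that len len'[of k] by simp
  show "last (kernel_coeffs ! k ! l) \<noteq> 0" if "k < 9" "l < 9 - k"
    using last_kernel_coeffs that len len' by (simp add: list_all_length)
qed

lemma sym_pos_def_kernel_mat:
  assumes "k \<le> 8"
  shows "sym_pos_def (8 - k + 1) (kernel_mat k)"
proof -
  have "sym_pos_def (9 - k) (kernel_mat k)"
    unfolding kernel_mat_def
    by (rule sym_pos_def_gram) (use kernel_coeffs_shape(2-4)[of k] assms in auto)
  moreover have "9 - k = 8 - k + 1"
    using assms by simp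
  ultimately show ?thesis
    by simp
qed

definition kernel_fun :: "real \<Rightarrow> real \<Rightarrow> real \<Rightarrow> real" where
  "kernel_fun u v t = (\<Sum>k<9. fact k * kernel_sum (kernel_coeffs ! k) u v * homog_legendre k u v t)"

lemma ev3_kernel: "ev3 (kernel_poly 0 kernel_coeffs) u v t = kernel_fun u v t"
  by (simp add: ev3_kernel_poly kernel_fun_def kernel_coeffs_shape(1))

lemma sym_sum_sum: "sym_sum (\<lambda>u v t. \<Sum>k\<in>A. g k u v t) u v t = (\<Sum>k\<in>A. sym_sum (g k) u v t)"
  by (simp add: sym_sum_def sum.distrib)

lemma three_point_kernel:
  "three_point 8 kernel_mat u v t = sym_sum kernel_fun u v t / (6000 * 2 ^ 28)"
proof -
  have "three_point 8 kernel_mat u v t = (\<Sum>k\<le>8. fact k / (1000 * 2 ^ 28) / 6 *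
      sym_sum (\<lambda>u v t. kernel_sum (kernel_coeffs ! k) u v * homog_legendre k u v t) u v t)"
    unfolding three_point_def
  proof (intro sum.cong refl)
    fix k :: nat assume "k \<in> {..8}"
    then have k: "k < 9" "9 - k = 8 - k + 1" by auto
    have "\<forall>r\<in>set (kernel_coeffs ! k). length r \<le> 8 - k + 1"
      using kernel_coeffs_shape(2-4)[of k] k by (auto simp: in_set_conv_nth)
    from inner_gram_S[OF this] show "inner_mat (kernel_mat k) (S_mat 8 k u v t) = fact k / (1000 * 2 ^ 28) / 6 *
      sym_sum (\<lambda>u v t. kernel_sum (kernel_coeffs ! k) u v * homog_legendre k u v t) u v t"
      unfolding kernel_mat_def k(2) .
  qed
  also have "\<dots> = (\<Sum>k<9. sym_sum (\<lambda>u v t. fact k * kernel_sum (kernel_coeffs ! k) u v * homog_legendre k u v t) u v t / (6000 * 2 ^ 28))"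
    by (intro sum.cong) (auto simp: sym_sum_def field_simps)
  finally show ?thesis
    unfolding kernel_fun_def sym_sum_sum by (simp add: sum_divide_distrib)
qed

definition h_fun :: "real \<Rightarrow> real" where
  "h_fun u = ev1 h_coeffs u / (1000 * 2 ^ 12)"

lemma box_mul_nonneg:
  assumes "ev3 p u v t \<ge> 0" "u \<in> {-1..1/2}" "v \<in> {-1..1/2}" "t \<in> {-1..1/2}"
  shows "ev3 (box_mul p) u v t \<ge> 0"
proof -
  have *: "0 \<le> 1 + x * (- 1 + x * - 2)" if "x \<in> {-1..1/2}" for x :: real
  proof -
    have "1 + x * (- 1 + x * - 2) = (1 + x) * (1 - 2 * x)" by (simp add: algebra_simps)
    with that show ?thesis by simp
  qed
  show ?thesis
    unfolding box_mul_def using *[OF assms(2)] *[OF assms(3)] *[OF assms(4)] assms(1) by simp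
qed

lemma ev3_sos_nonneg:
  assumes "u \<in> {-1..1/2}" "v \<in> {-1..1/2}" "t \<in> {-1..1/2}"
  shows "ev3 sos_poly u v t \<ge> 0"
  unfolding sos_poly_def
  using assms by (auto intro!: add_nonneg_nonneg box_mul_nonneg ev3_gram_poly_nonneg)

lemma three_point_le_h:
  assumes uvt: "u \<in> {-1..1/2}" "v \<in> {-1..1/2}" "t \<in> {-1..1/2}"
  shows "three_point 8 kernel_mat u v t \<le> h_fun u + h_fun v + h_fun t"
proof -
  have "0 \<le> ev3 residual_poly u v t"
    using dom3_residual uvt by (intro dom3_nonneg) auto
  then have "0 \<le> 2 ^ 21 * sym_sum (ev3 target_poly) u v t - sym_sum (ev3 sos_poly) u v t"
    unfolding residual_poly_def ev3_sym by (simp add: sym_sum_def algebra_simps)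
  moreover have "0 \<le> sym_sum (ev3 sos_poly) u v t"
    unfolding sym_sum_def using uvt by (intro add_nonneg_nonneg ev3_sos_nonneg) auto
  ultimately have "0 \<le> sym_sum (ev3 target_poly) u v t"
    by simp
  moreover have "ev3 (map (\<lambda>x. [[x]]) p) u v t = ev1 p u" for p u v t
    by (induction p) auto
  then have "ev3 target_poly u v t = 3 * 2 ^ 16 * ev1 h_coeffs u - kernel_fun u v t" for u v t
    by (simp add: target_poly_def ev3_kernel)
  ultimately show ?thesis
    unfolding three_point_kernel h_fun_def by (simp add: sym_sum_def field_simps)
qed

section \<open>Positive definite kernels\<close>

text \<open>The points \<open>p i\<close> may coincide, which is what makes the notion stable under
  composition with maps that are not injective, such as a normalized projection.\<close>

definition pd_on :: "'a set \<Rightarrow> ('a \<Rightarrow> 'a \<Rightarrow> real) \<Rightarrow> bool" where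
  "pd_on S K \<longleftrightarrow> (\<forall>(I :: nat set) p c. finite I \<longrightarrow> p ` I \<subseteq> S \<longrightarrow>
     0 \<le> (\<Sum>i\<in>I. \<Sum>j\<in>I. c i * c j * K (p i) (p j)))"

lemma pd_onD:
  "pd_on S K \<Longrightarrow> finite I \<Longrightarrow> p ` I \<subseteq> S \<Longrightarrow> 0 \<le> (\<Sum>i\<in>I. \<Sum>j\<in>I. c i * c j * K (p i) (p j))"
  for I :: "nat set"
  unfolding pd_on_def by blast

lemma pd_on_cong:
  assumes "\<And>x y. x \<in> S \<Longrightarrow> y \<in> S \<Longrightarrow> K x y = K' x y"
  shows "pd_on S K \<longleftrightarrow> pd_on S K'"
proof -
  have "(\<Sum>i\<in>I. \<Sum>j\<in>I. c i * c j * K (p i) (p j)) = (\<Sum>i\<in>I. \<Sum>j\<in>I. c i * c j * K' (p i) (p j))"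
    if "p ` I \<subseteq> S" for I :: "nat set" and p c
    using that by (intro sum.cong refl) (simp add: assms image_subset_iff)
  then show ?thesis
    unfolding pd_on_def by auto
qed

lemma pd_on_compose: "pd_on T K \<Longrightarrow> f ` S \<subseteq> T \<Longrightarrow> pd_on S (\<lambda>x y. K (f x) (f y))"
  unfolding pd_on_def
proof (intro allI impI)
  fix I :: "nat set" and p c
  assume K: "\<forall>(I :: nat set) p c. finite I \<longrightarrow> p ` I \<subseteq> T \<longrightarrow> 0 \<le> (\<Sum>i\<in>I. \<Sum>j\<in>I. c i * c j * K (p i) (p j))"
    and f: "f ` S \<subseteq> T" and I: "finite I" "p ` I \<subseteq> S"
  have "(f \<circ> p) ` I \<subseteq> T"
    using f I(2) by auto
  from K[rule_format, OF I(1) this, of c]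
  show "0 \<le> (\<Sum>i\<in>I. \<Sum>j\<in>I. c i * c j * K (f (p i)) (f (p j)))" by simp
qed

lemma pd_on_conj: "pd_on S K \<Longrightarrow> pd_on S (\<lambda>x y. g x * g y * K x y)"
  unfolding pd_on_def
proof (intro allI impI)
  fix I :: "nat set" and p c
  assume K: "\<forall>(I :: nat set) p c. finite I \<longrightarrow> p ` I \<subseteq> S \<longrightarrow> 0 \<le> (\<Sum>i\<in>I. \<Sum>j\<in>I. c i * c j * K (p i) (p j))"
    and I: "finite I" "p ` I \<subseteq> S"
  from K[rule_format, OF I, of "\<lambda>i. c i * g (p i)"]
  show "0 \<le> (\<Sum>i\<in>I. \<Sum>j\<in>I. c i * c j * (g (p i) * g (p j) * K (p i) (p j)))"
    by (simp add: mult_ac)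
qed

lemma pd_on_rank1: "pd_on S (\<lambda>x y. g x * g y)"
proof -
  have "0 \<le> (\<Sum>i\<in>I. \<Sum>j\<in>I. c i * c j * (g (p i) * g (p j)))" for I :: "nat set" and p c
  proof -
    have "(\<Sum>i\<in>I. \<Sum>j\<in>I. c i * c j * (g (p i) * g (p j))) = (\<Sum>i\<in>I. c i * g (p i))\<^sup>2"
      unfolding power2_eq_square sum_product by (simp add: mult_ac)
    then show ?thesis by simp
  qed
  then show ?thesis
    unfolding pd_on_def by blast
qed

lemma pd_on_sum:
  assumes "\<And>m. m \<in> M \<Longrightarrow> pd_on S (K m)"
  shows "pd_on S (\<lambda>x y. \<Sum>m\<in>M. K m x y)"
  unfolding pd_on_def
proof (intro allI impI)
  fix I :: "nat set" and p c
  assume I: "finite I" "p ` I \<subseteq> S"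
  have "(\<Sum>i\<in>I. \<Sum>j\<in>I. c i * c j * (\<Sum>m\<in>M. K m (p i) (p j)))
      = (\<Sum>m\<in>M. \<Sum>i\<in>I. \<Sum>j\<in>I. c i * c j * K m (p i) (p j))"
    by (simp add: sum_distrib_left sum.swap[of _ M])
  also have "\<dots> \<ge> 0"
    by (rule sum_nonneg, rule pd_onD[OF assms I])
  finally show "0 \<le> (\<Sum>i\<in>I. \<Sum>j\<in>I. c i * c j * (\<Sum>m\<in>M. K m (p i) (p j)))" .
qed

lemma pd_on_add: "pd_on S K \<Longrightarrow> pd_on S L \<Longrightarrow> pd_on S (\<lambda>x y. K x y + L x y)"
  using pd_on_sum[of "UNIV :: bool set" S "\<lambda>b. if b then K else L"] by (simp add: UNIV_bool add.commute)

lemma pd_on_scale: "pd_on S K \<Longrightarrow> 0 \<le> a \<Longrightarrow> pd_on S (\<lambda>x y. a * K x y)"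
  using pd_on_conj[of S K "\<lambda>_. sqrt a"] by simp

section \<open>Addition theorems\<close>

fun leg1 :: "nat \<Rightarrow> int list" where
  "leg1 0 = [1]"
| "leg1 (Suc 0) = [0, 1]"
| "leg1 (Suc (Suc n)) = add1 (mul1 [0, 2 * int n + 3] (leg1 (Suc n))) (scl1 (- ((int n + 1)\<^sup>2)) (leg1 n))"

fun chebU1 :: "nat \<Rightarrow> int list" where
  "chebU1 0 = [1]"
| "chebU1 (Suc 0) = [0, 2]"
| "chebU1 (Suc (Suc n)) = add1 (mul1 [0, 2] (chebU1 (Suc n))) (scl1 (-1) (chebU1 n))"

text \<open>The analogue of \<open>leg_poly\<close> for the circle: the Chebyshev polynomial of the
  first kind in \<open>t - u * v\<close>, homogenized by
  \<open>(1 - u^2) * (1 - v^2)\<close>.\<close>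

fun cheb3 :: "nat \<Rightarrow> int list list list" where
  "cheb3 0 = [[[1]]]"
| "cheb3 (Suc 0) = [[[0, 1]], [[], [-1]]]"
| "cheb3 (Suc (Suc n)) =
     add3 (mul3 [[[0, 2]], [[], [-2]]] (cheb3 (Suc n)))
          (scl3 (-1) (mul3 [[[1], [], [-1]], [], [[-1], [], [1]]] (cheb3 n)))"

text \<open>The list \<open>d # ws\<close> certifies the addition theorem
  \<open>d * p(t) = (\<Sum>i. ws ! i * p\<^sup>(\<^sup>i\<^sup>)(u) * p\<^sup>(\<^sup>i\<^sup>)(v) * K\<^sub>i(u, v, t))\<close>, with derivatives of \<open>p\<close>.\<close>

fun deriv_aux :: "nat \<Rightarrow> int list \<Rightarrow> int list" where
  "deriv_aux n [] = []"
| "deriv_aux n (a # p) = (int n * a) # deriv_aux (Suc n) p"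

fun addition_sum :: "(nat \<Rightarrow> int list list list) \<Rightarrow> nat \<Rightarrow> int list \<Rightarrow> int list \<Rightarrow> int list list list" where
  "addition_sum K m p [] = []"
| "addition_sum K m p (w # ws) =
     add3 (scl3 w (mul3 (tensor p) (K m))) (addition_sum K (Suc m) (deriv_aux 1 (tl p)) ws)"

fun addition_check :: "(nat \<Rightarrow> int list list list) \<Rightarrow> int list \<Rightarrow> int list \<Rightarrow> bool" where
  "addition_check K p [] \<longleftrightarrow> False"
| "addition_check K p (d # ws) \<longleftrightarrow> d > 0 \<and> list_all (\<lambda>w. w \<ge> 0) ws \<and>
     norm3 (add3 (addition_sum K 0 p ws) [[scl1 (- d) p]]) = 0"

text \<open>The classical addition theorem for \<open>P_k\<close> in terms of derivatives, cleared
  of denominators: relative to the term of index 0, term \<open>m > 0\<close> has weight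
  \<open>2 (k - m)! / (k + m)!\<close>.\<close>

definition leg_weights :: "int list list" where
  "leg_weights = [[1, 1], [1, 1, 1], [24, 12, 4, 1], [720, 360, 60, 6, 1], [161280, 20160, 2016,
    112, 8, 1], [14515200, 1814400, 120960, 4320, 180, 10, 1], [3832012800, 239500800, 11404800,
    285120, 7920, 264, 12, 1], [697426329600, 43589145600, 1556755200, 28828800, 576576, 13104, 364,
    14, 1], [1339058552832000, 10461394944000, 290594304000, 4151347200, 62899200, 1048320, 20160,
    480, 16, 1]]"

text \<open>Dividing \<open>leg1 k\<close> by its content keeps the numbers of the following check small.\<close>

definition leg_content :: "int list" where
  "leg_content = [1, 1, 1, 3, 3, 15, 45, 315, 315]"

definition leg_prim :: "nat \<Rightarrow> int list" where
  "leg_prim k = map (\<lambda>x. x div leg_content ! k) (leg1 k)"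

text \<open>The Gegenbauer addition theorem for parameter 1: term \<open>m\<close> has weight
  \<open>(2 m + 1) (k - m)! / ((k + m + 1)! m!)\<close>, where the last \<open>m!\<close>
  compensates for the factor in \<open>leg_poly m\<close>.\<close>

definition chebU_weights :: "int list list" where
  "chebU_weights = [[1, 1], [2, 1, 1], [48, 16, 6, 1], [4320, 1080, 216, 15, 1], [967680, 193536,
    24192, 960, 28, 1], [435456000, 72576000, 6220800, 162000, 2800, 45, 1], [344881152000,
    49268736000, 3079296000, 57024000, 665280, 6480, 66, 1], [439378587648000, 54922323456000,
    2615348736000, 36324288000, 308206080, 2063880, 12936, 91, 1], [843606888284160000,
    93734098698240000, 3515028701184000, 38041436160000, 246564864000, 1219276800, 5322240, 23296,
    120, 1]]"

lemma leg_check: "list_all (\<lambda>k. scl1 (leg_content ! k) (leg_prim k) = leg1 k \<and> addition_check cheb3 (leg_prim k) (leg_weights ! k)) [0..<9]"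
  by code_simp

lemma chebU_check: "list_all (\<lambda>k. addition_check leg_poly (chebU1 k) (chebU_weights ! k)) [0..<9]"
  by code_simp

lemma ev3_addition_sum:
  "ev3 (addition_sum K m p ws) u v t =
     (\<Sum>i<length ws. ws ! i * (ev1 (((\<lambda>p. deriv_aux 1 (tl p)) ^^ i) p) u *
        ev1 (((\<lambda>p. deriv_aux 1 (tl p)) ^^ i) p) v * ev3 (K (m + i)) u v t))"
proof (induction ws arbitrary: m p)
  case (Cons w ws)
  show ?case
    by (simp add: Cons lessThan_Suc_eq_insert_0 sum.reindex funpow_Suc_right
        del: funpow.simps(2) sum.lessThan_Suc tensor.simps)
qed auto

text \<open>Every term of the expansion is a nonnegative multiple of a positive definite kernel
  \<open>K m\<close>, conjugated with the value of a derivative of \<open>p\<close> at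
  \<open>g x\<close>.\<close>

lemma pd_on_addition:
  assumes check: "addition_check K p ws"
    and pd: "\<And>m. Suc m < length ws \<Longrightarrow> pd_on S (\<lambda>x y. ev3 (K m) (g x) (g y) (q x y))"
    and g: "\<And>x. x \<in> S \<Longrightarrow> \<bar>g x\<bar> \<le> 1" and q: "\<And>x y. x \<in> S \<Longrightarrow> y \<in> S \<Longrightarrow> \<bar>q x y\<bar> \<le> 1"
  shows "pd_on S (\<lambda>x y. ev1 p (q x y))"
proof -
  from check obtain d ws' where ws: "ws = d # ws'"
    by (cases ws) auto
  let ?D = "\<lambda>p. deriv_aux 1 (tl p)"
  have d: "d > 0" and nn: "i < length ws' \<Longrightarrow> ws' ! i \<ge> 0" for i
    using check by (auto simp: ws list_all_length)
  have eq: "ev1 p t = (\<Sum>i<length ws'. ws' ! i / d * (ev1 ((?D ^^ i) p) u * ev1 ((?D ^^ i) p) v * ev3 (K i) u v t))"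
    if "\<bar>u\<bar> \<le> 1" "\<bar>v\<bar> \<le> 1" "\<bar>t\<bar> \<le> 1" for u v t
  proof -
    \<comment> \<open>Cancellation leaves lists of zeros rather than the empty list, so the
      certificate tests the coefficient norm; norm 0 makes both sides agree on the cube.\<close>
    have "\<bar>ev3 (add3 (addition_sum K 0 p ws') [[scl1 (- d) p]]) u v t\<bar> \<le> 0"
      using abs_ev3_le[OF that, of "add3 (addition_sum K 0 p ws') [[scl1 (- d) p]]"] check
      by (simp add: ws)
    then have "d * ev1 p t = ev3 (addition_sum K 0 p ws') u v t"
      by simp
    then have "ev1 p t = ev3 (addition_sum K 0 p ws') u v t / d"
      using d by (simp add: field_simps)
    then show ?thesis
      by (simp add: ev3_addition_sum sum_divide_distrib)
  qed
  have "pd_on S (\<lambda>x y. \<Sum>i<length ws'. ws' ! i / d *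
      (ev1 ((?D ^^ i) p) (g x) * ev1 ((?D ^^ i) p) (g y) * ev3 (K i) (g x) (g y) (q x y)))"
    using nn d by (intro pd_on_sum pd_on_scale pd_on_conj pd) (auto simp: ws)
  then show ?thesis
    by (rule iffD2[OF pd_on_cong, rotated], intro eq) (auto intro: g q)
qed

text \<open>For \<open>a = z * cnj w\<close> the relation \<open>a^2 = 2 Re a * a - |a|^2\<close>
  gives the real parts of the powers of \<open>a\<close> the recurrence that defines
  \<open>cheb3\<close>.\<close>

lemma ev3_cheb3:
  fixes z w :: complex
  assumes "t - u * v = Re (z * cnj w)" "1 - u\<^sup>2 = (cmod z)\<^sup>2" "1 - v\<^sup>2 = (cmod w)\<^sup>2"
  shows "ev3 (cheb3 m) u v t = Re (z ^ m * cnj w ^ m)"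
proof (induction m rule: cheb3.induct)
  case (3 n)
  define a where "a = z * cnj w"
  have nrm: "(1 - u\<^sup>2) * (1 - v\<^sup>2) = (Re a)\<^sup>2 + (Im a)\<^sup>2"
    unfolding a_def assms(2,3) cmod_power2 by (simp add: power2_eq_square algebra_simps)
  have re: "Re (a ^ Suc (Suc n)) = 2 * Re a * Re (a ^ Suc n) - ((Re a)\<^sup>2 + (Im a)\<^sup>2) * Re (a ^ n)"
    by (simp add: algebra_simps power2_eq_square)
  have "ev3 (cheb3 (Suc (Suc n))) u v t
      = 2 * (t - u * v) * ev3 (cheb3 (Suc n)) u v t - (1 - u\<^sup>2) * (1 - v\<^sup>2) * ev3 (cheb3 n) u v t"
    by (simp add: algebra_simps power2_eq_square)
  also have "\<dots> = 2 * Re a * Re (a ^ Suc n) - ((Re a)\<^sup>2 + (Im a)\<^sup>2) * Re (a ^ n)"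
    unfolding 3 nrm assms(1) by (simp only: a_def power_mult_distrib)
  finally show ?case
    unfolding re[symmetric] by (simp only: a_def power_mult_distrib)
qed (use assms in auto)

lemma ev1_leg1: "ev1 (leg1 k) t = fact k * poly (legendre k) t"
proof (induction k rule: leg1.induct)
  case (3 n)
  then show ?case
    by (simp add: field_simps power2_eq_square)
qed auto

lemma ev1_chebU1: "ev1 (chebU1 k) t = poly (chebyshev_U k) t"
  by (induction k rule: chebU1.induct) (auto simp: algebra_simps)

section \<open>Positive definite zonal kernels on the 2-sphere and the 3-sphere\<close>

lemma pd_on_legendre:
  assumes "k \<le> 8"
  shows "pd_on (sphere (0 :: real \<times> complex) 1) (\<lambda>x y. poly (legendre k) (inner x y))"
proof -
  let ?S = "sphere (0 :: real \<times> complex) 1"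
  have check: "scl1 (leg_content ! k) (leg_prim k) = leg1 k" "addition_check cheb3 (leg_prim k) (leg_weights ! k)"
    using leg_check assms by (auto simp: list_all_iff)
  have sq: "1 - (fst x)\<^sup>2 = (cmod (snd x))\<^sup>2" if "x \<in> ?S" for x
    using that by (simp add: norm_prod_def real_sqrt_eq_1_iff)
  have fst: "\<bar>fst x\<bar> \<le> 1" if "x \<in> ?S" for x
    using norm_fst_le[of "fst x" "snd x"] that by simp
  have inner: "\<bar>inner x y\<bar> \<le> 1" if "x \<in> ?S" "y \<in> ?S" for x y
    using Cauchy_Schwarz_ineq2[of x y] that by simp
  have "pd_on ?S (\<lambda>x y. ev3 (cheb3 m) (fst x) (fst y) (inner x y))" for m
  proof -
    have "ev3 (cheb3 m) (fst x) (fst y) (inner x y)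
       = Re (snd x ^ m) * Re (snd y ^ m) + Im (snd x ^ m) * Im (snd y ^ m)"
      if "x \<in> ?S" "y \<in> ?S" for x y
    proof -
      have "ev3 (cheb3 m) (fst x) (fst y) (inner x y) = Re (snd x ^ m * cnj (snd y) ^ m)"
        by (rule ev3_cheb3) (use that in \<open>auto simp: sq inner_prod_def inner_complex_def simp del: mem_sphere_0\<close>)
      then show ?thesis
        by (simp flip: complex_cnj_power)
    qed
    then show ?thesis
      by (subst pd_on_cong) (auto intro!: pd_on_add pd_on_rank1)
  qed
  from pd_on_addition[OF check(2) this fst inner]
  have "pd_on ?S (\<lambda>x y. ev1 (leg_prim k) (inner x y))" .
  moreover have "list_all (\<lambda>x. 0 \<le> x) leg_content \<and> length leg_content = 9"
    by (simp add: leg_content_def)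
  then have "0 \<le> leg_content ! k"
    using assms by (auto simp: list_all_length)
  ultimately have "pd_on ?S (\<lambda>x y. leg_content ! k / fact k * ev1 (leg_prim k) (inner x y))"
    by (intro pd_on_scale) auto
  moreover have "ev1 (leg1 k) t = leg_content ! k * ev1 (leg_prim k) t" for t
    using arg_cong[OF check(1), of "\<lambda>p. ev1 p t"] by simp
  then have "poly (legendre k) t = leg_content ! k / fact k * ev1 (leg_prim k) t" for t
    by (simp add: ev1_leg1 field_simps)
  ultimately show ?thesis
    by simp
qed

lemma inner_vec4: "inner x y = x $ 1 * y $ 1 + x $ 2 * y $ 2 + x $ 3 * y $ 3 + x $ 4 * y $ 4"
  for x y :: "real^4"
  by (simp add: inner_vec_def sum_4)

text \<open>Dropping the first coordinate and normalizing maps the 3-sphere to the 2-sphere. The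
  argument of the Legendre polynomial is the cosine between the images, and the homogenizing factor
  is a product of powers of the two lengths, hence a conjugation.\<close>

lemma pd_on_homog_legendre_axis:
  assumes "k \<le> 8"
  shows "pd_on (sphere (0 :: real^4) 1) (\<lambda>x y. homog_legendre k (x $ 1) (y $ 1) (inner x y))"
proof -
  let ?S = "sphere (0 :: real^4) 1"
  define a :: "real^4 \<Rightarrow> real \<times> complex" where "a x = (x $ 2, Complex (x $ 3) (x $ 4))" for x
  \<comment> \<open>At the two poles the direction is undefined and an arbitrary unit vector is
    taken: for \<open>k > 0\<close> the power of the length vanishes there, and for
    \<open>k = 0\<close> the kernel is constant.\<close>
  define b :: "real^4 \<Rightarrow> real \<times> complex" where "b x = (if a x = 0 then (1, 0) else a x /\<^sub>R norm (a x))" for x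
  have inner_a: "inner (a x) (a y) = inner x y - x $ 1 * y $ 1" for x y
    by (simp add: a_def inner_vec4 inner_complex_def)
  have norm_a: "(norm (a x))\<^sup>2 = 1 - (x $ 1)\<^sup>2" if "x \<in> ?S" for x
    using that unfolding power2_norm_eq_inner inner_a by (simp add: norm_eq_1 power2_eq_square)
  have b: "b ` ?S \<subseteq> sphere 0 1"
    by (auto simp: b_def norm_Pair)
  have "homog_legendre k (x $ 1) (y $ 1) (inner x y)
      = norm (a x) ^ k * norm (a y) ^ k * poly (legendre k) (inner (b x) (b y))"
    if xy: "x \<in> ?S" "y \<in> ?S" for x y
  proof (cases "k = 0")
    case False
    show ?thesis
    proof (cases "a x = 0 \<or> a y = 0")
      case True
      then have q: "(1 - (x $ 1)\<^sup>2) * (1 - (y $ 1)\<^sup>2) = 0"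
        using norm_a xy by (metis mult_eq_0_iff norm_zero power_zero_numeral)
      have "inner (a x) (a y) = 0"
        using True by auto
      then have t: "inner x y - x $ 1 * y $ 1 = 0"
        by (simp add: inner_a)
      have "homog_legendre j (x $ 1) (y $ 1) (inner x y) = 0" if "j > 0" for j
        using that by (induction j rule: legendre.induct) (auto simp: homog_legendre_rec q t)
      with True False show ?thesis by auto
    next
      case nz: False
      define n where "n = norm (a x) * norm (a y)"
      have pos: "norm (a x) > 0" "norm (a y) > 0" "n > 0"
        using nz by (auto simp: n_def)
      have n2: "(1 - (x $ 1)\<^sup>2) * (1 - (y $ 1)\<^sup>2) = n\<^sup>2"
        by (simp only: n_def power_mult_distrib norm_a[OF xy(1)] norm_a[OF xy(2)])
      have "homog_legendre k (x $ 1) (y $ 1) (inner x y)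
          = (n\<^sup>2) powr (real k / 2) * poly (legendre k) ((inner x y - x $ 1 * y $ 1) / sqrt (n\<^sup>2))"
        using pos by (subst homog_legendre_eq) (simp_all add: n2)
      also have "(n\<^sup>2) powr (real k / 2) = n ^ k"
        using pos by (simp add: powr_realpow[symmetric] powr_powr del: powr_numeral flip: powr_numeral)
      also have "(inner x y - x $ 1 * y $ 1) / sqrt (n\<^sup>2) = inner (b x) (b y)"
      proof -
        have "sqrt (n\<^sup>2) = n"
          using pos by simp
        then show ?thesis
          using nz pos by (simp add: b_def inner_a[symmetric] n_def field_simps)
      qed
      finally show ?thesis
        by (simp add: n_def power_mult_distrib)
    qed
  qed auto
  moreover have "pd_on ?S (\<lambda>x y. norm (a x) ^ k * norm (a y) ^ k * poly (legendre k) (inner (b x) (b y)))"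
    by (intro pd_on_conj pd_on_compose[OF pd_on_legendre[OF assms] b])
  ultimately show ?thesis
    by (rule iffD2[OF pd_on_cong])
qed

lemma pd_on_homog_legendre:
  assumes "k \<le> 8" "norm e = 1"
  shows "pd_on (sphere (0 :: real^4) 1) (\<lambda>x y. homog_legendre k (inner e x) (inner e y) (inner x y))"
proof -
  obtain f :: "real^4 \<Rightarrow> real^4" where f: "orthogonal_transformation f" "f e = axis 1 1"
    using orthogonal_transformation_exists[of e "axis 1 1 :: real^4"] assms(2) by auto
  have inner_f: "inner (f x) (f y) = inner x y" for x y
    using f(1) by (simp add: orthogonal_transformation_def)
  have "f ` sphere 0 1 \<subseteq> sphere 0 1"
    using f(1) by (auto simp: orthogonal_transformation_norm)
  from pd_on_compose[OF pd_on_homog_legendre_axis[OF assms(1)] this]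
  have "pd_on (sphere 0 1) (\<lambda>x y. homog_legendre k (f x $ 1) (f y $ 1) (inner (f x) (f y)))" .
  moreover have "f x $ 1 = inner e x" for x
    using inner_f[of e x] by (simp add: f(2) inner_axis')
  ultimately show ?thesis
    by (simp add: inner_f)
qed

lemma pd_on_chebyshev_U:
  assumes "k \<le> 8"
  shows "pd_on (sphere (0 :: real^4) 1) (\<lambda>x y. poly (chebyshev_U k) (inner x y))"
proof -
  let ?S = "sphere (0 :: real^4) 1" and ?e = "axis 1 1 :: real^4"
  have check: "addition_check leg_poly (chebU1 k) (chebU_weights ! k)"
    using chebU_check assms by (auto simp: list_all_iff)
  have "length chebU_weights = 9 \<and> list_all (\<lambda>ws. length ws \<le> 10) chebU_weights"
    by (simp add: chebU_weights_def)
  then have len: "length (chebU_weights ! k) \<le> 10"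
    using assms by (simp add: list_all_length)
  have inner: "\<bar>inner x y\<bar> \<le> 1" if "norm x = 1" "norm y = 1" for x y :: "real^4"
    using Cauchy_Schwarz_ineq2[of x y] that by simp
  have "pd_on ?S (\<lambda>x y. ev1 (chebU1 k) (inner x y))"
  proof (rule pd_on_addition[OF check, where g = "inner ?e"])
    fix m assume "Suc m < length (chebU_weights ! k)"
    then have "m \<le> 8"
      using len by simp
    then show "pd_on ?S (\<lambda>x y. ev3 (leg_poly m) (inner ?e x) (inner ?e y) (inner x y))"
      unfolding ev3_leg_poly by (intro pd_on_scale pd_on_homog_legendre) auto
  qed (auto intro!: inner)
  then show ?thesis
    by (simp add: ev1_chebU1)
qed

lemma pd_on_kernel_sum:
  assumes "pd_on S K"
  shows "pd_on S (\<lambda>x y. kernel_sum rs (g x) (g y) * K x y)"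
proof (induction rs)
  case Nil
  show ?case
    by (simp add: kernel_sum_def pd_on_def)
next
  case (Cons r rs)
  have "pd_on S (\<lambda>x y. cheb_sum r (g x) * cheb_sum r (g y) * K x y + kernel_sum rs (g x) (g y) * K x y)"
    by (intro pd_on_add pd_on_conj assms Cons)
  then show ?case
    by (simp add: kernel_sum_def algebra_simps)
qed

lemma pd_on_kernel_fun:
  assumes "norm e = 1"
  shows "pd_on (sphere (0 :: real^4) 1) (\<lambda>x y. kernel_fun (inner e x) (inner e y) (inner x y))"
  unfolding kernel_fun_def mult.assoc
  using assms by (intro pd_on_sum pd_on_scale pd_on_kernel_sum pd_on_homog_legendre) auto

lemma sum_kernel_fun_nonneg:
  fixes w :: "nat \<Rightarrow> real^4"
  assumes "finite I" "\<And>i. i \<in> I \<Longrightarrow> norm (w i) = 1" "p \<in> I"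
  shows "0 \<le> (\<Sum>j\<in>I. \<Sum>l\<in>I. kernel_fun (inner (w p) (w j)) (inner (w p) (w l)) (inner (w j) (w l)))"
proof -
  have "w ` I \<subseteq> sphere 0 1"
    using assms(2) by auto
  from pd_onD[OF pd_on_kernel_fun assms(1) this, of "w p" "\<lambda>_. 1"] show ?thesis
    using assms(2,3) by simp
qed

text \<open>A permutation of the three inner products amounts to a permutation of the indices, that
  is, another choice of the pole among the three points. Each of the six terms therefore has the
  same sum over all triples, and for a fixed pole that sum is nonnegative by positive
  definiteness.\<close>

lemma sum_three_point_nonneg:
  fixes w :: "nat \<Rightarrow> real^4"
  assumes I: "finite I" "\<And>i. i \<in> I \<Longrightarrow> norm (w i) = 1"
  shows "0 \<le> (\<Sum>i\<in>I. \<Sum>j\<in>I. \<Sum>l\<in>I.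
    three_point 8 kernel_mat (inner (w i) (w j)) (inner (w i) (w l)) (inner (w j) (w l)))"
proof -
  define x where "x i j = inner (w i) (w j)" for i j
  have x: "x i j = x j i" for i j
    by (simp add: x_def inner_commute)
  let ?K = "\<lambda>p j l. kernel_fun (x p j) (x p l) (x j l)"
  have nn: "0 \<le> (\<Sum>j\<in>I. \<Sum>l\<in>I. ?K p j l)" if "p \<in> I" for p
    unfolding x_def by (rule sum_kernel_fun_nonneg) (use I that in auto)
  have nn': "0 \<le> (\<Sum>p\<in>I. \<Sum>j\<in>I. \<Sum>l\<in>I. ?K p j l)"
    by (rule sum_nonneg[OF nn])
  have eq: "sym_sum kernel_fun (x i j) (x i l) (x j l)
      = ?K i j l + ?K j i l + ?K i l j + ?K l i j + ?K j l i + ?K l j i" for i j l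
    unfolding sym_sum_def using x[of i j] x[of i l] x[of j l] by simp
  have swap: "(\<Sum>i\<in>I. \<Sum>j\<in>I. \<Sum>l\<in>I. g i j l) = (\<Sum>i\<in>I. \<Sum>j\<in>I. \<Sum>l\<in>I. g j i l)"
    "(\<Sum>i\<in>I. \<Sum>j\<in>I. \<Sum>l\<in>I. g i j l) = (\<Sum>i\<in>I. \<Sum>j\<in>I. \<Sum>l\<in>I. g i l j)" for g :: "nat \<Rightarrow> nat \<Rightarrow> nat \<Rightarrow> real"
    by (rule sum.swap) (intro sum.cong refl sum.swap)
  have a: "(\<Sum>i\<in>I. \<Sum>j\<in>I. \<Sum>l\<in>I. ?K j i l) = (\<Sum>i\<in>I. \<Sum>j\<in>I. \<Sum>l\<in>I. ?K i j l)"
    by (rule swap(1))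
  have b: "(\<Sum>i\<in>I. \<Sum>j\<in>I. \<Sum>l\<in>I. ?K i l j) = (\<Sum>i\<in>I. \<Sum>j\<in>I. \<Sum>l\<in>I. ?K i j l)"
    by (rule swap(2)[symmetric])
  have c: "(\<Sum>i\<in>I. \<Sum>j\<in>I. \<Sum>l\<in>I. ?K l i j) = (\<Sum>i\<in>I. \<Sum>j\<in>I. \<Sum>l\<in>I. ?K i j l)"
    by (rule trans[OF swap(2) swap(1)])
  have d: "(\<Sum>i\<in>I. \<Sum>j\<in>I. \<Sum>l\<in>I. ?K j l i) = (\<Sum>i\<in>I. \<Sum>j\<in>I. \<Sum>l\<in>I. ?K i j l)"
    by (rule trans[OF swap(1) swap(2)])
  have e: "(\<Sum>i\<in>I. \<Sum>j\<in>I. \<Sum>l\<in>I. ?K l j i) = (\<Sum>i\<in>I. \<Sum>j\<in>I. \<Sum>l\<in>I. ?K i j l)"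
    by (rule trans[OF swap(1) trans[OF swap(2) swap(1)]])
  have "(\<Sum>i\<in>I. \<Sum>j\<in>I. \<Sum>l\<in>I. sym_sum kernel_fun (x i j) (x i l) (x j l))
      = 6 * (\<Sum>p\<in>I. \<Sum>j\<in>I. \<Sum>l\<in>I. ?K p j l)"
    unfolding eq sum.distrib a b c d e by simp
  then have "0 \<le> (\<Sum>i\<in>I. \<Sum>j\<in>I. \<Sum>l\<in>I. sym_sum kernel_fun (x i j) (x i l) (x j l))"
    using nn' by simp
  then show ?thesis
    unfolding three_point_kernel x_def[symmetric] by (simp flip: sum_divide_distrib)
qed

lemma sum_chebyshev_U_nonneg:
  fixes w :: "nat \<Rightarrow> real^4"
  assumes "finite I" "\<And>i. i \<in> I \<Longrightarrow> norm (w i) = 1" "k \<le> 8"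
  shows "0 \<le> (\<Sum>i\<in>I. \<Sum>j\<in>I. poly (chebyshev_U k) (inner (w i) (w j)))"
proof -
  have "w ` I \<subseteq> sphere 0 1"
    using assms(2) by auto
  from pd_onD[OF pd_on_chebyshev_U[OF assms(3)] assms(1) this, of "\<lambda>_. 1"] show ?thesis
    by simp
qed

lemma sum_two_point_ge:
  fixes w :: "nat \<Rightarrow> real^4" and f :: "nat \<Rightarrow> real"
  assumes "finite I" "\<And>i. i \<in> I \<Longrightarrow> norm (w i) = 1" "d \<le> 8" "\<And>k. k \<in> {1..d} \<Longrightarrow> f k \<ge> 0"
  shows "(card I)\<^sup>2 * f 0 \<le> (\<Sum>i\<in>I. \<Sum>j\<in>I. two_point d f (inner (w i) (w j)))"
proof -
  let ?g = "\<lambda>k. \<Sum>i\<in>I. \<Sum>j\<in>I. poly (chebyshev_U k) (inner (w i) (w j))"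
  have "two_point d f u = (\<Sum>k\<le>d. f k / real (k + 1) * poly (chebyshev_U k) u)" for u
    by (simp add: two_point_def G_poly_def poly_sum)
  then have "(\<Sum>i\<in>I. \<Sum>j\<in>I. two_point d f (inner (w i) (w j)))
      = (\<Sum>i\<in>I. \<Sum>j\<in>I. \<Sum>k\<le>d. f k / real (k + 1) * poly (chebyshev_U k) (inner (w i) (w j)))"
    by simp
  also have "\<dots> = (\<Sum>k\<le>d. f k / real (k + 1) * ?g k)"
    by (simp add: sum.swap[of _ "{..d}"] sum_distrib_left)
  also have "\<dots> = f 0 * ?g 0 + (\<Sum>k\<in>{1..d}. f k / real (k + 1) * ?g k)"
    by (subst sum.atMost_shift) (simp add: sum.atLeast1_atMost_eq)
  also have "\<dots> \<ge> f 0 * ?g 0"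
    using assms by (intro add_increasing2 sum_nonneg mult_nonneg_nonneg sum_chebyshev_U_nonneg) auto
  finally show ?thesis
    by (simp add: power2_eq_square mult_ac)
qed

section \<open>Summation over triples\<close>

lemma sum_triples:
  fixes \<phi> :: "nat \<Rightarrow> nat \<Rightarrow> nat \<Rightarrow> real"
  assumes "finite I"
  shows "(\<Sum>i\<in>I. \<Sum>j\<in>I. \<Sum>l\<in>I. \<phi> i j l) =
    (\<Sum>i\<in>I. \<phi> i i i) + (\<Sum>i\<in>I. \<Sum>j\<in>I - {i}. \<phi> i i j) + (\<Sum>i\<in>I. \<Sum>j\<in>I - {i}. \<phi> i j i)
    + (\<Sum>i\<in>I. \<Sum>j\<in>I - {i}. \<phi> i j j) + (\<Sum>i\<in>I. \<Sum>j\<in>I - {i}. \<Sum>l\<in>I - {i, j}. \<phi> i j l)"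
proof -
  have "(\<Sum>j\<in>I. \<Sum>l\<in>I. \<phi> i j l) = \<phi> i i i + (\<Sum>j\<in>I - {i}. \<phi> i i j) + (\<Sum>j\<in>I - {i}. \<phi> i j i)
    + (\<Sum>j\<in>I - {i}. \<phi> i j j) + (\<Sum>j\<in>I - {i}. \<Sum>l\<in>I - {i, j}. \<phi> i j l)" if i: "i \<in> I" for i
  proof -
    have "(\<Sum>l\<in>I. \<phi> i j l) = \<phi> i j i + \<phi> i j j + (\<Sum>l\<in>I - {i, j}. \<phi> i j l)" if j: "j \<in> I - {i}" for j
    proof -
      have "(\<Sum>l\<in>I - {i}. \<phi> i j l) = \<phi> i j j + (\<Sum>l\<in>I - {i} - {j}. \<phi> i j l)"
        using assms j by (intro sum.remove) auto
      moreover have "I - {i} - {j} = I - {i, j}" by auto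
      ultimately show ?thesis
        using sum.remove[OF assms i, of "\<phi> i j"] by simp
    qed
    then have "(\<Sum>j\<in>I - {i}. \<Sum>l\<in>I. \<phi> i j l)
        = (\<Sum>j\<in>I - {i}. \<phi> i j i + \<phi> i j j + (\<Sum>l\<in>I - {i, j}. \<phi> i j l))"
      by (intro sum.cong) auto
    then show ?thesis
      using sum.remove[OF assms i, of "\<lambda>j. \<Sum>l\<in>I. \<phi> i j l"] sum.remove[OF assms i, of "\<phi> i i"]
      by (simp add: sum.distrib)
  qed
  then have "(\<Sum>i\<in>I. \<Sum>j\<in>I. \<Sum>l\<in>I. \<phi> i j l) = (\<Sum>i\<in>I. \<phi> i i i + (\<Sum>j\<in>I - {i}. \<phi> i i j) + (\<Sum>j\<in>I - {i}. \<phi> i j i)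
    + (\<Sum>j\<in>I - {i}. \<phi> i j j) + (\<Sum>j\<in>I - {i}. \<Sum>l\<in>I - {i, j}. \<phi> i j l))"
    by (intro sum.cong) auto
  then show ?thesis
    by (simp add: sum.distrib)
qed

text \<open>Every ordered pair of distinct indices occurs in each of three positions, with
  \<open>card I - 2\<close> choices for the remaining index. The count is read off from the sum over
  all triples, where the diagonal value \<open>a1\<close> cancels.\<close>

lemma sum_distinct_pairs:
  fixes a :: "nat \<Rightarrow> nat \<Rightarrow> real"
  assumes "finite I" and sym: "\<And>i j. a i j = a j i" and diag: "\<And>i. i \<in> I \<Longrightarrow> a i i = a1"
  shows "(\<Sum>i\<in>I. \<Sum>j\<in>I - {i}. \<Sum>l\<in>I - {i, j}. a i j + a i l + a j l)
    = 3 * (real (card I) - 2) * (\<Sum>i\<in>I. \<Sum>j\<in>I - {i}. a i j)"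
proof -
  define P where "P = (\<Sum>i\<in>I. \<Sum>j\<in>I - {i}. a i j)"
  define n where "n = real (card I)"
  define D where "D = (\<lambda>\<phi>. \<Sum>i\<in>I. \<Sum>j\<in>I - {i}. \<Sum>l\<in>I - {i, j}. \<phi> i j l :: real)"
  have total: "(\<Sum>i\<in>I. \<Sum>j\<in>I. a i j) = n * a1 + P"
  proof -
    have "(\<Sum>j\<in>I. a i j) = a1 + (\<Sum>j\<in>I - {i}. a i j)" if "i \<in> I" for i
      using sum.remove[OF assms(1) that, of "a i"] diag[OF that] by simp
    then have "(\<Sum>i\<in>I. \<Sum>j\<in>I. a i j) = (\<Sum>i\<in>I. a1 + (\<Sum>j\<in>I - {i}. a i j))"
      by (intro sum.cong) auto
    then show ?thesis
      by (simp add: sum.distrib P_def n_def)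
  qed
  have const: "(\<Sum>i\<in>I. \<Sum>j\<in>I - {i}. a i i) = n * (n - 1) * a1"
  proof -
    have "(\<Sum>j\<in>I - {i}. a i i) = (n - 1) * a1" if "i \<in> I" for i
      using assms(1) that diag[OF that] card_gt_0_iff[of I]
      by (auto simp: card_Diff_singleton n_def of_nat_diff Suc_le_eq)
    then have "(\<Sum>i\<in>I. \<Sum>j\<in>I - {i}. a i i) = (\<Sum>i\<in>I. (n - 1) * a1)"
      by (intro sum.cong) auto
    then show ?thesis
      by (simp add: n_def)
  qed
  have const': "(\<Sum>i\<in>I. \<Sum>j\<in>I - {i}. a j j) = n * (n - 1) * a1"
  proof -
    have "(\<Sum>i\<in>I. \<Sum>j\<in>I - {i}. a j j) = (\<Sum>i\<in>I. \<Sum>j\<in>I - {i}. a i i)"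
      by (intro sum.cong) (auto simp: diag)
    then show ?thesis
      using const by simp
  qed
  have diag_sum: "(\<Sum>i\<in>I. a i i) = n * a1"
    by (simp add: diag n_def)
  have symP: "(\<Sum>i\<in>I. \<Sum>j\<in>I - {i}. a j i) = P"
    unfolding P_def using sym by (intro sum.cong refl) metis
  have "n * (n * a1 + P) = n * a1 + n * (n - 1) * a1 + P + P + D (\<lambda>i j l. a i j)"
    using sum_triples[OF assms(1), of "\<lambda>i j l. a i j"] total const diag_sum
    by (simp add: D_def P_def[symmetric] n_def sum_distrib_left[symmetric])
  moreover have "n * (n * a1 + P) = n * a1 + P + n * (n - 1) * a1 + P + D (\<lambda>i j l. a i l)"
    using sum_triples[OF assms(1), of "\<lambda>i j l. a i l"] total const diag_sum
    by (simp add: D_def P_def[symmetric] n_def sum_distrib_left[symmetric])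
  moreover have "n * (n * a1 + P) = n * a1 + P + P + n * (n - 1) * a1 + D (\<lambda>i j l. a j l)"
    using sum_triples[OF assms(1), of "\<lambda>i j l. a j l"] total const' diag_sum symP
    by (simp add: D_def P_def[symmetric] n_def sum_distrib_left[symmetric])
  moreover have "D (\<lambda>i j l. a i j + a i l + a j l) = D (\<lambda>i j l. a i j) + D (\<lambda>i j l. a i l) + D (\<lambda>i j l. a j l)"
    by (simp add: D_def sum.distrib)
  ultimately have "D (\<lambda>i j l. a i j + a i l + a j l) = 3 * (n - 2) * P"
    by (simp add: algebra_simps)
  then show ?thesis
    by (simp add: D_def P_def n_def)
qed

text \<open>The hypothesis on \<open>F\<close> sums over all triples, the pointwise inequality holds
  only for distinct indices. Triples with exactly two equal indices contribute three times the pair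
  sum of \<open>F 1 u u\<close>, which is just what the quotient by \<open>N - 2\<close> accounts
  for after \<open>sum_distinct_pairs\<close>; those with all indices equal leave the term
  \<open>F 1 1 1\<close>.\<close>

lemma three_point_bound:
  fixes x :: "nat \<Rightarrow> nat \<Rightarrow> real" and F :: "real \<Rightarrow> real \<Rightarrow> real \<Rightarrow> real"
  assumes I: "finite I" "card I = N" "N > 2"
    and x: "\<And>i j. x i j = x j i" "\<And>i. i \<in> I \<Longrightarrow> x i i = 1"
    and F: "\<And>u v. F u 1 v = F 1 u v" "\<And>u v. F u v 1 = F 1 u v"
    and F_nonneg: "0 \<le> (\<Sum>i\<in>I. \<Sum>j\<in>I. \<Sum>l\<in>I. F (x i j) (x i l) (x j l))"
    and f: "(real N)\<^sup>2 * f0 \<le> (\<Sum>i\<in>I. \<Sum>j\<in>I. f (x i j))"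
    and ineq: "\<And>i j l. i \<in> I \<Longrightarrow> j \<in> I - {i} \<Longrightarrow> l \<in> I - {i, j} \<Longrightarrow>
      0 \<le> W (x i j) + W (x i l) + W (x j l) - f (x i j) - f (x i l) - f (x j l) - F (x i j) (x i l) (x j l)
        - (F 1 (x i j) (x i j) + F 1 (x i l) (x i l) + F 1 (x j l) (x j l)) / (real N - 2)"
  shows "real N * (real N * f0 - f 1) - real N * F 1 1 1 / (3 * (real N - 2))
    \<le> (\<Sum>i\<in>I. \<Sum>j\<in>I - {i}. W (x i j))"
proof -
  define c where "c = real N - 2"
  have c: "c > 0"
    using I(3) by (simp add: c_def)
  define P where "P g = (\<Sum>i\<in>I. \<Sum>j\<in>I - {i}. g (x i j))" for g :: "real \<Rightarrow> real"
  define D where "D = (\<lambda>\<phi>. \<Sum>i\<in>I. \<Sum>j\<in>I - {i}. \<Sum>l\<in>I - {i, j}. \<phi> i j l :: real)"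
  define g where "g u = W u - f u - F 1 u u / c" for u
  have "0 \<le> D (\<lambda>i j l. g (x i j) + g (x i l) + g (x j l) - F (x i j) (x i l) (x j l))"
    unfolding D_def
  proof (intro sum_nonneg)
    fix i j l assume "i \<in> I" "j \<in> I - {i}" "l \<in> I - {i, j}"
    from ineq[OF this] show "0 \<le> g (x i j) + g (x i l) + g (x j l) - F (x i j) (x i l) (x j l)"
      by (simp add: g_def c_def[symmetric] add_divide_distrib)
  qed
  also have "\<dots> = D (\<lambda>i j l. g (x i j) + g (x i l) + g (x j l)) - D (\<lambda>i j l. F (x i j) (x i l) (x j l))"
    by (simp add: D_def sum_subtractf)
  also have "D (\<lambda>i j l. g (x i j) + g (x i l) + g (x j l)) = 3 * c * P g"
    using sum_distinct_pairs[OF I(1), of "\<lambda>i j. g (x i j)" "g 1"] x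
    by (simp add: D_def P_def c_def I(2))
  finally have 1: "D (\<lambda>i j l. F (x i j) (x i l) (x j l)) \<le> 3 * c * P g"
    by simp
  have "(\<Sum>i\<in>I. F (x i i) (x i i) (x i i)) = real N * F 1 1 1"
    using x I by simp
  moreover have "(\<Sum>i\<in>I. \<Sum>j\<in>I - {i}. F (x i i) (x i j) (x i j)) = P (\<lambda>u. F 1 u u)"
    "(\<Sum>i\<in>I. \<Sum>j\<in>I - {i}. F (x i j) (x i i) (x j i)) = P (\<lambda>u. F 1 u u)"
    "(\<Sum>i\<in>I. \<Sum>j\<in>I - {i}. F (x i j) (x i j) (x j j)) = P (\<lambda>u. F 1 u u)"
    unfolding P_def by (intro sum.cong refl; use x F in fastforce)+
  ultimately have 2: "- real N * F 1 1 1 \<le> 3 * P (\<lambda>u. F 1 u u) + D (\<lambda>i j l. F (x i j) (x i l) (x j l))"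
    using F_nonneg sum_triples[OF I(1), of "\<lambda>i j l. F (x i j) (x i l) (x j l)"]
    by (simp add: D_def)
  have 3: "(real N)\<^sup>2 * f0 - real N * f 1 \<le> P f"
  proof -
    have "(\<Sum>j\<in>I. f (x i j)) = f 1 + (\<Sum>j\<in>I - {i}. f (x i j))" if "i \<in> I" for i
      using sum.remove[OF I(1) that, of "\<lambda>j. f (x i j)"] x(2)[OF that] by simp
    then have "(\<Sum>i\<in>I. \<Sum>j\<in>I. f (x i j)) = (\<Sum>i\<in>I. f 1 + (\<Sum>j\<in>I - {i}. f (x i j)))"
      by (intro sum.cong) auto
    then show ?thesis
      using f by (simp add: P_def sum.distrib I(2))
  qed
  have "P g = P W - P f - P (\<lambda>u. F 1 u u) / c"
    by (simp add: P_def g_def sum_subtractf sum_divide_distrib)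
  then have "3 * c * P g = 3 * c * P W - 3 * c * P f - 3 * P (\<lambda>u. F 1 u u)"
    using c by (simp add: right_diff_distrib)
  with 1 2 have "- real N * F 1 1 1 \<le> 3 * c * (P W - P f)"
    by (simp add: algebra_simps)
  then have "- real N * F 1 1 1 / (3 * c) \<le> P W - P f"
    using c by (simp add: field_simps)
  with 3 show ?thesis
    by (simp add: P_def c_def power2_eq_square algebra_simps)
qed

section \<open>Polar coordinates\<close>

lemma nn_integral_lborel_scale:
  fixes f :: "'a::euclidean_space \<Rightarrow> ennreal"
  assumes [measurable]: "f \<in> borel_measurable borel" and "c > 0"
  shows "(\<integral>\<^sup>+x. f (c *\<^sub>R x) \<partial>lborel) * ennreal (c ^ DIM('a)) = (\<integral>\<^sup>+x. f x \<partial>lborel)"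
proof -
  have "(\<integral>\<^sup>+x. f x \<partial>lborel)
      = (\<integral>\<^sup>+x. f x \<partial>density (distr lborel borel (\<lambda>x. 0 + c *\<^sub>R x)) (\<lambda>_. ennreal (\<bar>c\<bar> ^ DIM('a))))"
    using assms(2) by (subst lborel_affine[of c 0]) auto
  also have "\<dots> = (\<integral>\<^sup>+x. ennreal (c ^ DIM('a)) * f (c *\<^sub>R x) \<partial>lborel)"
    using assms(2) by (simp add: nn_integral_density nn_integral_distr)
  finally show ?thesis
    by (simp add: nn_integral_cmult mult.commute[of _ "ennreal (c ^ DIM('a))"])
qed

lemma nn_integral_inverse_power5:
  assumes "b > 0"
  shows "(\<integral>\<^sup>+x. ennreal (4 / x ^ 5) * indicator {b..} x \<partial>lborel) = ennreal (1 / b ^ 4)"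
proof -
  have "(\<integral>\<^sup>+x. ennreal (4 / x ^ 5) * indicator {b..} x \<partial>lborel) = ennreal (0 - (- (1 / b ^ 4)))"
  proof (rule nn_integral_FTC_atLeast)
    show "((\<lambda>x. - (1 / x ^ 4)) has_real_derivative 4 / x ^ 5) (at x)" if "b \<le> x" for x
      using assms that by (auto intro!: derivative_eq_intros simp: field_simps power_numeral_reduce)
    show "((\<lambda>x::real. - (1 / x ^ 4)) \<longlongrightarrow> 0) at_top"
      by real_asymp
  qed (use assms in auto)
  then show ?thesis by simp
qed

text \<open>Integration in polar coordinates; substituting \<open>\<lambda> = \<mu> * norm x\<close> for the radius keeps the
  integrand jointly measurable without reference to the sphere.\<close>

lemma nn_integral_polar:
  fixes \<Phi> :: "real^4 \<Rightarrow> ennreal"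
  assumes [measurable]: "\<Phi> \<in> borel_measurable borel"
  shows "(\<integral>\<^sup>+x. indicator {x. norm x \<le> 1} x * (\<integral>\<^sup>+\<mu>. ennreal (4 * \<mu> ^ 3 * norm x ^ 4) * indicator {0<..} \<mu> * \<Phi> (\<mu> *\<^sub>R x) \<partial>lborel) \<partial>lborel)
    = (\<integral>\<^sup>+y. \<Phi> y \<partial>lborel)"
proof -
  \<comment> \<open>Under \<open>y = \<mu> x\<close> the condition \<open>norm x \<le> 1\<close>
    becomes \<open>norm y \<le> \<mu>\<close>, and \<open>4 \<mu>^3 norm x^4 dx\<close> becomes
    \<open>norm y^4 * 4 / \<mu>^5 dy\<close>. Integrated over \<open>\<mu> \<ge> norm y\<close> this
    weight gives 1.\<close>
  have inner: "(\<integral>\<^sup>+x. indicator {x. norm x \<le> 1} x * (ennreal (4 * \<mu> ^ 3 * norm x ^ 4) * indicator {0<..} \<mu> * \<Phi> (\<mu> *\<^sub>R x)) \<partial>lborel)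
      = (\<integral>\<^sup>+y. ennreal (norm y ^ 4) * \<Phi> y * (ennreal (4 / \<mu> ^ 5) * indicator {norm y..} \<mu> * indicator {0<..} \<mu>) \<partial>lborel)" for \<mu> :: real
  proof (cases "\<mu> > 0")
    case True
    define g where "g y = ennreal (norm y ^ 4) * \<Phi> y * (ennreal (4 / \<mu> ^ 5) * indicator {norm y..} \<mu> * indicator {0<..} \<mu>)" for y :: "real^4"
    have [measurable]: "g \<in> borel_measurable borel"
      unfolding g_def atLeast_def by measurable
    have eq: "indicator {x. norm x \<le> 1} x * (ennreal (4 * \<mu> ^ 3 * norm x ^ 4) * indicator {0<..} \<mu> * \<Phi> (\<mu> *\<^sub>R x))
        = g (\<mu> *\<^sub>R x) * ennreal (\<mu> ^ 4)" for x :: "real^4"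
    proof -
      have "ennreal (4 * \<mu> ^ 3 * norm x ^ 4) = ennreal (norm (\<mu> *\<^sub>R x) ^ 4) * (ennreal (4 / \<mu> ^ 5) * ennreal (\<mu> ^ 4))"
        using True by (simp flip: ennreal_mult add: power_mult_distrib field_simps power_numeral_reduce)
      moreover have "(\<mu> *\<^sub>R x \<in> {y. norm y \<le> \<mu>}) \<longleftrightarrow> norm x \<le> 1"
        using True by simp
      ultimately show ?thesis
        using True by (simp add: g_def indicator_def mult_ac)
    qed
    have "(\<integral>\<^sup>+x. g (\<mu> *\<^sub>R x) * ennreal (\<mu> ^ 4) \<partial>lborel) = (\<integral>\<^sup>+y. g y \<partial>lborel)"
      using nn_integral_lborel_scale[of g \<mu>] True by (simp add: nn_integral_multc)
    then show ?thesis
      unfolding eq by (simp add: g_def)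
  qed (simp add: indicator_def)
  have "(\<integral>\<^sup>+x. indicator {x. norm x \<le> 1} x * (\<integral>\<^sup>+\<mu>. ennreal (4 * \<mu> ^ 3 * norm x ^ 4) * indicator {0<..} \<mu> * \<Phi> (\<mu> *\<^sub>R x) \<partial>lborel) \<partial>lborel)
    = (\<integral>\<^sup>+x. (\<integral>\<^sup>+\<mu>. indicator {x. norm x \<le> 1} x * (ennreal (4 * \<mu> ^ 3 * norm x ^ 4) * indicator {0<..} \<mu> * \<Phi> (\<mu> *\<^sub>R x)) \<partial>lborel) \<partial>lborel)"
    by (simp add: nn_integral_cmult)
  also have "\<dots> = (\<integral>\<^sup>+\<mu>. (\<integral>\<^sup>+x. indicator {x. norm x \<le> 1} x * (ennreal (4 * \<mu> ^ 3 * norm x ^ 4) * indicator {0<..} \<mu> * \<Phi> (\<mu> *\<^sub>R x)) \<partial>lborel) \<partial>lborel)"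
  proof (rule lborel_pair.Fubini')
    have "(\<lambda>p. \<Phi> (fst p *\<^sub>R snd p)) \<in> borel_measurable (borel \<Otimes>\<^sub>M borel)"
      by (rule measurable_compose[OF _ assms]) measurable
    then have [measurable]: "(\<lambda>p. \<Phi> (snd p *\<^sub>R fst p)) \<in> borel_measurable (lborel \<Otimes>\<^sub>M lborel)"
        "(\<lambda>p. \<Phi> (fst p *\<^sub>R snd p)) \<in> borel_measurable (lborel \<Otimes>\<^sub>M lborel)"
      using measurable_compose[OF measurable_pair_swap'] by (auto cong: measurable_cong_sets)
    show "(\<lambda>(\<mu>, x). indicator {x. norm x \<le> 1} x * (ennreal (4 * \<mu> ^ 3 * norm x ^ 4) * indicator {0<..} \<mu> * \<Phi> (\<mu> *\<^sub>R x)))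
        \<in> borel_measurable (lborel \<Otimes>\<^sub>M lborel)"
      unfolding case_prod_beta by measurable
  qed
  also have "\<dots> = (\<integral>\<^sup>+\<mu>. (\<integral>\<^sup>+y. ennreal (norm y ^ 4) * \<Phi> y * (ennreal (4 / \<mu> ^ 5) * indicator {norm y..} \<mu> * indicator {0<..} \<mu>) \<partial>lborel) \<partial>lborel)"
    unfolding inner ..
  also have "\<dots> = (\<integral>\<^sup>+y. (\<integral>\<^sup>+\<mu>. ennreal (norm y ^ 4) * \<Phi> y * (ennreal (4 / \<mu> ^ 5) * indicator {norm y..} \<mu> * indicator {0<..} \<mu>) \<partial>lborel) \<partial>lborel)"
    unfolding atLeast_def by (rule lborel_pair.Fubini') measurable
  also have "\<dots> = (\<integral>\<^sup>+y. \<Phi> y \<partial>lborel)"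
  proof (rule nn_integral_cong_AE)
    have "AE y in lborel. (y :: real^4) \<noteq> 0"
      by (rule AE_lborel_singleton)
    then show "AE y in lborel. (\<integral>\<^sup>+\<mu>. ennreal (norm y ^ 4) * \<Phi> y * (ennreal (4 / \<mu> ^ 5) * indicator {norm y..} \<mu> * indicator {0<..} \<mu>) \<partial>lborel) = \<Phi> y"
    proof eventually_elim
      case (elim y)
      have "0 < \<mu>" if "norm y \<le> \<mu>" for \<mu>
        using elim that by (meson less_le_trans zero_less_norm_iff)
      then have "(\<integral>\<^sup>+\<mu>. ennreal (4 / \<mu> ^ 5) * indicator {norm y..} \<mu> * indicator {0<..} \<mu> \<partial>lborel)
          = (\<integral>\<^sup>+\<mu>. ennreal (4 / \<mu> ^ 5) * indicator {norm y..} \<mu> \<partial>lborel)"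
        by (intro nn_integral_cong) (auto simp: indicator_def)
      also have "\<dots> = ennreal (1 / norm y ^ 4)"
        using elim by (intro nn_integral_inverse_power5) auto
      finally have *: "(\<integral>\<^sup>+\<mu>. ennreal (4 / \<mu> ^ 5) * indicator {norm y..} \<mu> * indicator {0<..} \<mu> \<partial>lborel) = ennreal (1 / norm y ^ 4)" .
      have "(\<integral>\<^sup>+\<mu>. ennreal (norm y ^ 4) * \<Phi> y * (ennreal (4 / \<mu> ^ 5) * indicator {norm y..} \<mu> * indicator {0<..} \<mu>) \<partial>lborel)
          = ennreal (norm y ^ 4) * \<Phi> y * ennreal (1 / norm y ^ 4)"
        by (subst nn_integral_cmult) (simp_all add: *)
      also have "\<dots> = ennreal (norm y ^ 4 * (1 / norm y ^ 4)) * \<Phi> y"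
        by (subst ennreal_mult) (auto simp: mult_ac)
      finally show ?case
        using elim by simp
    qed
  qed
  finally show ?thesis .
qed

section \<open>The weight as the volume of a lens\<close>

definition lens :: "real^4 \<Rightarrow> real^4 \<Rightarrow> (real^4) set" where
  "lens p q = {x. norm x \<le> sqrt (3/2) \<and> 1 < inner x p \<and> 1 < inner x q}"

text \<open>Geometrically \<open>r_star\<close> is the angular radius of the cap that the hyperplane
  \<open>inner x p = 1\<close> cuts from the ball of radius \<open>sqrt (3/2)\<close>: its secant is
  that radius.\<close>

lemma r_star: "0 < r_star" "r_star < pi / 2" "cos r_star = sqrt (2/3)" "sin r_star = 1 / sqrt 3"
proof -
  have s: "0 < 1 / sqrt 3" "1 / sqrt 3 < 1"
    by (auto simp: real_less_lsqrt)
  have "arcsin 0 < arcsin (1 / sqrt 3)" "arcsin (1 / sqrt 3) < arcsin 1"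
    by (rule arcsin_less_arcsin; use s in linarith)+
  then show "0 < r_star" "r_star < pi / 2"
    by (auto simp: r_star_def)
  show "sin r_star = 1 / sqrt 3"
    unfolding r_star_def by (rule sin_arcsin; use s in linarith)
  have "cos r_star = sqrt (1 - (1 / sqrt 3)\<^sup>2)"
    unfolding r_star_def by (rule cos_arcsin; use s in linarith)
  then show "cos r_star = sqrt (2/3)"
    by (simp add: power_divide)
qed

lemma DERIV_sec4:
  assumes "cos r \<noteq> 0"
  shows "((\<lambda>s. (1 / cos s) ^ 4) has_real_derivative 4 * sin r / cos r ^ 5) (at r)"
  using assms by (auto intro!: derivative_eq_intros simp: field_simps power_numeral_reduce)

lemma cos_pos_r_star: "0 \<le> r \<Longrightarrow> r \<le> r_star \<Longrightarrow> 0 < cos r"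
  using r_star by (intro cos_gt_zero_pi) auto

lemma deriv_sec4: "0 \<le> r \<Longrightarrow> r \<le> r_star \<Longrightarrow> deriv (\<lambda>s. (1 / cos s) ^ 4) r = 4 * sin r / cos r ^ 5"
  using cos_pos_r_star[of r] by (intro DERIV_imp_deriv DERIV_sec4) auto

lemma nn_integral_dsec4:
  assumes "0 \<le> s" "s \<le> r_star"
  shows "(\<integral>\<^sup>+r. ennreal (4 * sin r / cos r ^ 5) * indicator {s..r_star} r \<partial>lborel) = ennreal (9/4 - (1 / cos s) ^ 4)"
proof -
  have "(\<integral>\<^sup>+r. ennreal (4 * sin r / cos r ^ 5) * indicator {s..r_star} r \<partial>lborel)
      = ennreal ((1 / cos r_star) ^ 4 - (1 / cos s) ^ 4)"
  proof (rule nn_integral_FTC_Icc)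
    fix r assume r: "r \<in> {s..r_star}"
    then have c: "cos r > 0"
      using assms by (intro cos_pos_r_star) auto
    then show "((\<lambda>s. (1 / cos s) ^ 4) has_real_derivative 4 * sin r / cos r ^ 5) (at r)"
      by (intro DERIV_sec4) simp
    have "0 \<le> sin r"
      using r assms r_star(2) pi_gt_zero by (intro sin_ge_zero) auto
    with c show "0 \<le> 4 * sin r / cos r ^ 5"
      by simp
  qed (use assms in simp_all)
  also have "(1 / cos r_star) ^ 4 = 9 / 4"
  proof -
    have "(1 / cos r_star) ^ 4 = ((1 / cos r_star)\<^sup>2)\<^sup>2" by simp
    also have "(1 / cos r_star)\<^sup>2 = 3 / 2" by (simp add: r_star power_divide)
    finally show ?thesis by (simp add: power2_eq_square)
  qed
  finally show ?thesis .
qed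

lemma nn_integral_cube:
  assumes "0 \<le> a" "a \<le> b"
  shows "(\<integral>\<^sup>+\<mu>. ennreal (4 * \<mu> ^ 3) * indicator {a<..b} \<mu> \<partial>lborel) = ennreal (b ^ 4 - a ^ 4)"
proof -
  have "(\<integral>\<^sup>+\<mu>. ennreal (4 * \<mu> ^ 3) * indicator {a<..b} \<mu> \<partial>lborel)
      = (\<integral>\<^sup>+\<mu>. ennreal (4 * \<mu> ^ 3) * indicator {a..b} \<mu> \<partial>lborel)"
  proof (rule nn_integral_cong_AE)
    show "AE \<mu> in lborel. ennreal (4 * \<mu> ^ 3) * indicator {a<..b} \<mu> = ennreal (4 * \<mu> ^ 3) * indicator {a..b} \<mu>"
      using AE_lborel_singleton[of a] by eventually_elim (auto simp: indicator_def)
  qed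
  also have "\<dots> = ennreal (b ^ 4 - a ^ 4)"
  proof (rule nn_integral_FTC_Icc)
    show "((\<lambda>\<mu>. \<mu> ^ 4) has_real_derivative 4 * x ^ 3) (at x)" for x
      by (auto intro!: derivative_eq_intros)
    show "0 \<le> 4 * x ^ 3" if "x \<in> {a..b}" for x
      using assms that by simp
  qed (use assms in auto)
  finally show ?thesis .
qed

text \<open>Let \<open>s\<close> be the angle between \<open>x\<close> and the farther centre, so
  that \<open>cos s = m / norm x\<close>. The ray through \<open>x\<close> lies in the lens for
  distances between \<open>1 / cos s\<close> and \<open>sqrt (3/2)\<close>, which contributes
  \<open>9/4 - (1 / cos s) ^ 4\<close>. This is also the total of the measure d(sec^4) over those
  radii \<open>r\<close> for which both caps contain the direction of \<open>x\<close>.\<close>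

lemma radial_integral_lens:
  fixes x p q :: "real^4"
  assumes x: "x \<noteq> 0" and p: "norm p = 1"
  defines "m \<equiv> min (inner x p) (inner x q)"
  shows "(\<integral>\<^sup>+\<mu>. ennreal (4 * \<mu> ^ 3 * norm x ^ 4) * indicator {0<..} \<mu> * indicator (lens p q) (\<mu> *\<^sub>R x) \<partial>lborel)
    = (\<integral>\<^sup>+r. ennreal (4 * sin r / cos r ^ 5) * indicator {0..r_star} r * (if cos r * norm x \<le> m then 1 else 0) \<partial>lborel)"
proof -
  define \<rho> where "\<rho> = sqrt (3/2)"
  have \<rho>: "\<rho> > 0" "cos r_star = 1 / \<rho>" "\<rho> ^ 4 = 9 / 4"
  proof -
    show "\<rho> > 0" by (simp add: \<rho>_def)
    show "cos r_star = 1 / \<rho>" by (simp add: \<rho>_def r_star real_sqrt_divide)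
    have "\<rho> ^ 4 = (\<rho>\<^sup>2)\<^sup>2" by simp
    then show "\<rho> ^ 4 = 9 / 4" by (simp add: \<rho>_def power2_eq_square)
  qed
  have nx: "norm x > 0" using x by simp
  have m_le: "m \<le> norm x"
    using norm_cauchy_schwarz[of x p] p by (simp add: m_def)
  have mem: "\<mu> *\<^sub>R x \<in> lens p q \<longleftrightarrow> \<mu> \<le> \<rho> / norm x \<and> 1 < \<mu> * m" if "\<mu> > 0" for \<mu>
    using that nx
    by (simp add: lens_def \<rho>_def[symmetric] m_def pos_le_divide_eq min_mult_distrib_left)
  show ?thesis
  proof (cases "norm x / \<rho> \<le> m")
    case True
    have m: "m > 0" using less_le_trans[OF divide_pos_pos[OF nx \<rho>(1)] True] .
    have ab: "1 / m \<le> \<rho> / norm x"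
      using True m nx \<rho>(1) by (simp add: field_simps)
    define s where "s = arccos (m / norm x)"
    have q: "0 < m / norm x" "m / norm x \<le> 1"
      using m nx m_le by (auto simp: field_simps)
    then have cs: "cos s = m / norm x" and s0: "0 \<le> s" "s \<le> pi"
      by (auto simp: s_def intro!: arccos_lbound arccos_ubound)
    have ord: "cos r \<le> m / norm x \<longleftrightarrow> s \<le> r" if "0 \<le> r" "r \<le> r_star" for r
      unfolding cs[symmetric] using that s0 r_star pi_gt_zero by (subst cos_mono_le_eq) auto
    have "s \<le> r_star"
      using ord[of r_star] r_star True nx by (simp add: \<rho> field_simps)
    have "(\<integral>\<^sup>+r. ennreal (4 * sin r / cos r ^ 5) * indicator {0..r_star} r * (if cos r * norm x \<le> m then 1 else 0) \<partial>lborel)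
        = (\<integral>\<^sup>+r. ennreal (4 * sin r / cos r ^ 5) * indicator {s..r_star} r \<partial>lborel)"
    proof (rule nn_integral_cong)
      fix r
      have "cos r * norm x \<le> m \<longleftrightarrow> cos r \<le> m / norm x"
        using nx by (simp add: pos_le_divide_eq)
      then show "ennreal (4 * sin r / cos r ^ 5) * indicator {0..r_star} r * (if cos r * norm x \<le> m then 1 else 0)
          = ennreal (4 * sin r / cos r ^ 5) * indicator {s..r_star} r"
        using ord[of r] s0(1) by (cases "0 \<le> r \<and> r \<le> r_star") auto
    qed
    also have "\<dots> = ennreal (9/4 - (1 / cos s) ^ 4)"
      by (rule nn_integral_dsec4) fact+
    finally have R: "(\<integral>\<^sup>+r. ennreal (4 * sin r / cos r ^ 5) * indicator {0..r_star} r * (if cos r * norm x \<le> m then 1 else 0) \<partial>lborel)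
        = ennreal (9/4 - (norm x / m) ^ 4)" by (simp add: cs)
    have "(\<integral>\<^sup>+\<mu>. ennreal (4 * \<mu> ^ 3 * norm x ^ 4) * indicator {0<..} \<mu> * indicator (lens p q) (\<mu> *\<^sub>R x) \<partial>lborel)
        = (\<integral>\<^sup>+\<mu>. ennreal (norm x ^ 4) * (ennreal (4 * \<mu> ^ 3) * indicator {1/m<..\<rho> / norm x} \<mu>) \<partial>lborel)"
    proof (rule nn_integral_cong)
      fix \<mu> :: real
      show "ennreal (4 * \<mu> ^ 3 * norm x ^ 4) * indicator {0<..} \<mu> * indicator (lens p q) (\<mu> *\<^sub>R x)
          = ennreal (norm x ^ 4) * (ennreal (4 * \<mu> ^ 3) * indicator {1/m<..\<rho> / norm x} \<mu>)"
      proof (cases "\<mu> > 0")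
        case True
        have "ennreal (4 * \<mu> ^ 3 * norm x ^ 4) = ennreal (norm x ^ 4) * ennreal (4 * \<mu> ^ 3)"
          using True by (subst ennreal_mult[symmetric]) (auto simp: mult.commute)
        moreover have "1 / m < \<mu> \<longleftrightarrow> 1 < \<mu> * m"
          using m by (simp add: pos_divide_less_eq)
        then have "indicator (lens p q) (\<mu> *\<^sub>R x) = (indicator {1/m<..\<rho> / norm x} \<mu> :: ennreal)"
          using mem[OF True] by (simp add: indicator_def conj_commute)
        ultimately show ?thesis
          using True by (simp add: mult.assoc)
      next
        case False
        then have "\<not> 1 / m < \<mu>"
          using m by (meson less_trans zero_less_divide_1_iff)
        with False show ?thesis by simp
      qed
    qed
    also have "\<dots> = ennreal (norm x ^ 4) * ennreal ((\<rho> / norm x) ^ 4 - (1 / m) ^ 4)"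
      using m ab by (subst nn_integral_cmult) (simp_all add: nn_integral_cube)
    also have "\<dots> = ennreal (norm x ^ 4 * ((\<rho> / norm x) ^ 4 - (1 / m) ^ 4))"
      using ab m by (subst ennreal_mult) (auto intro!: power_mono)
    also have "norm x ^ 4 * ((\<rho> / norm x) ^ 4 - (1 / m) ^ 4) = 9/4 - (norm x / m) ^ 4"
      using nx by (simp add: power_divide \<rho> right_diff_distrib)
    finally show ?thesis
      unfolding R .
  next
    case False
    have "\<not> cos r * norm x \<le> m" if "0 \<le> r" "r \<le> r_star" for r
    proof -
      have "cos r_star \<le> cos r"
        using that r_star by (intro cos_monotone_0_pi_le) auto
      then have "norm x / \<rho> \<le> cos r * norm x"
        using nx \<rho> by (simp add: mult_right_mono[of "1 / \<rho>" "cos r" "norm x"] field_simps)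
      then show ?thesis using False by simp
    qed
    then have "(\<integral>\<^sup>+r. ennreal (4 * sin r / cos r ^ 5) * indicator {0..r_star} r * (if cos r * norm x \<le> m then 1 else 0) \<partial>lborel)
        = (\<integral>\<^sup>+r. 0 \<partial>(lborel :: real measure))"
      by (intro nn_integral_cong) (auto simp: indicator_def)
    moreover have "\<not> (\<mu> \<le> \<rho> / norm x \<and> 1 < \<mu> * m)" if "\<mu> > 0" for \<mu>
    proof (rule notI, elim conjE)
      assume *: "\<mu> \<le> \<rho> / norm x" "1 < \<mu> * m"
      have "m > 0" using *(2) that zero_less_mult_pos[of \<mu> m] by simp
      then have "\<mu> * m \<le> \<rho> / norm x * m" using * by (intro mult_right_mono) auto
      also have "\<dots> \<le> \<rho> / norm x * (norm x / \<rho>)"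
        using False nx \<rho>(1) by (intro mult_left_mono) auto
      also have "\<dots> = 1" using nx \<rho>(1) by simp
      finally show False using * by simp
    qed
    then have "(\<integral>\<^sup>+\<mu>. ennreal (4 * \<mu> ^ 3 * norm x ^ 4) * indicator {0<..} \<mu> * indicator (lens p q) (\<mu> *\<^sub>R x) \<partial>lborel)
        = (\<integral>\<^sup>+\<mu>. 0 \<partial>(lborel :: real measure))"
      using mem by (intro nn_integral_cong) (auto simp: indicator_def)
    ultimately show ?thesis by simp
  qed
qed

lemma cap_eq:
  assumes "norm p = 1" "0 \<le> r" "r \<le> pi"
  shows "cap r p = sphere 0 1 \<inter> {x. cos r \<le> inner x p}"
proof -
  have "arccos (inner x p) \<le> r \<longleftrightarrow> cos r \<le> inner x p" if "norm x = 1" for x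
  proof -
    have "\<bar>inner x p\<bar> \<le> 1"
      using Cauchy_Schwarz_ineq2[of x p] that assms(1) by simp
    then have x: "- 1 \<le> inner x p" "inner x p \<le> 1" by auto
    then have "arccos (inner x p) \<le> r \<longleftrightarrow> cos r \<le> cos (arccos (inner x p))"
      using assms by (subst cos_mono_le_eq) (auto intro: arccos_lbound arccos_ubound)
    then show ?thesis using x by simp
  qed
  then show ?thesis
    by (auto simp: cap_def)
qed

section \<open>Cones over intersections of caps\<close>

definition sector :: "real^4 \<Rightarrow> real^4 \<Rightarrow> real \<Rightarrow> (real^4) set" where
  "sector p q r = {x. norm x \<le> 1 \<and> x \<noteq> 0 \<and> cos r * norm x \<le> min (inner x p) (inner x q)}"

lemma sector_measurable [measurable]: "sector p q r \<in> sets borel"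
proof -
  have "sector p q r = {x \<in> space borel. norm x \<le> 1 \<and> x \<noteq> 0 \<and> cos r * norm x \<le> min (inner x p) (inner x q)}"
    by (auto simp: sector_def)
  also have "\<dots> \<in> sets borel" by measurable
  finally show ?thesis .
qed

lemma lens_measurable [measurable]: "lens p q \<in> sets borel"
proof -
  have "lens p q = {x \<in> space borel. norm x \<le> sqrt (3/2) \<and> 1 < inner x p \<and> 1 < inner x q}"
    by (auto simp: lens_def)
  also have "\<dots> \<in> sets borel" by measurable
  finally show ?thesis .
qed

lemma measure_cap_inter:
  assumes p: "norm p = 1" "norm q = 1" and r: "0 \<le> r" "r \<le> pi"
  shows "measure sphere_measure (cap r p \<inter> cap r q) = 4 * measure lborel (sector p q r)"
proof -
  have cl: "closed {x. cos r \<le> inner x p'}" for p' :: "real^4"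
    by (intro closed_Collect_le continuous_intros)
  have "cap r p \<inter> cap r q \<in> sets borel"
    unfolding cap_eq[OF p(1) r] cap_eq[OF p(2) r] by (intro borel_closed closed_Int cl) auto
  then have "emeasure sphere_measure (cap r p \<inter> cap r q)
      = 4 * emeasure lborel {x \<in> cball 0 1. sgn x \<in> cap r p \<inter> cap r q}"
    by (rule emeasure_sphere_measure)
  also have "{x \<in> cball 0 1. sgn x \<in> cap r p \<inter> cap r q} = sector p q r"
  proof -
    have "sgn x \<in> cap r p' \<longleftrightarrow> x \<noteq> 0 \<and> cos r * norm x \<le> inner x p'" if "norm p' = 1" for x p' :: "real^4"
    proof (cases "x = 0")
      case False
      then have "inner (sgn x) p' = inner x p' / norm x"
        by (simp add: sgn_div_norm divide_inverse mult.commute)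
      with False show ?thesis
        unfolding cap_eq[OF that r] by (simp add: norm_sgn pos_le_divide_eq)
    qed (simp add: cap_eq[OF that r])
    then show ?thesis
      using p by (auto simp: sector_def)
  qed
  finally have "emeasure sphere_measure (cap r p \<inter> cap r q) = 4 * emeasure lborel (sector p q r)" .
  then show ?thesis
    by (simp add: measure_def enn2real_mult)
qed

lemma emeasure_sector_finite: "emeasure lborel (sector p q r) < \<infinity>"
proof -
  have "emeasure lborel (sector p q r) \<le> emeasure lborel (cball (0 :: real^4) 1)"
    by (intro emeasure_mono) (auto simp: sector_def)
  then show ?thesis
    using emeasure_lborel_cball_finite[of "0 :: real^4" 1] by (rule le_less_trans)
qed

lemma emeasure_lens_finite: "emeasure lborel (lens p q) < \<infinity>"
proof -
  have "emeasure lborel (lens p q) \<le> emeasure lborel (cball (0 :: real^4) (sqrt (3/2)))"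
    by (intro emeasure_mono) (auto simp: lens_def)
  then show ?thesis
    using emeasure_lborel_cball_finite[of "0 :: real^4" "sqrt (3/2)"] by (rule le_less_trans)
qed

lemma emeasure_sector:
  "emeasure lborel (sector p q r) =
    (\<integral>\<^sup>+x. indicator {x. norm x \<le> 1} x * (if cos r * norm x \<le> min (inner x p) (inner x q) then 1 else 0) \<partial>lborel)"
proof -
  have "emeasure lborel (sector p q r) = (\<integral>\<^sup>+x. indicator (sector p q r) x \<partial>lborel)"
    by simp
  also have "\<dots> = (\<integral>\<^sup>+x. indicator {x. norm x \<le> 1} x * (if cos r * norm x \<le> min (inner x p) (inner x q) then 1 else 0) \<partial>lborel)"
    by (rule nn_integral_cong_AE, use AE_lborel_singleton[of 0] in eventually_elim)
      (auto simp: indicator_def sector_def)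
  finally show ?thesis .
qed

text \<open>Polar coordinates for the lens, with each radial integral replaced by an integral over
  \<open>r\<close>; exchanging the order of integration then collects the directions that lie in
  both caps of radius \<open>r\<close>.\<close>

lemma nn_integral_sector:
  assumes p: "norm p = 1"
  shows "(\<integral>\<^sup>+r. ennreal (4 * sin r / cos r ^ 5) * indicator {0..r_star} r * emeasure lborel (sector p q r) \<partial>lborel)
    = emeasure lborel (lens p q)"
proof -
  let ?T = "\<lambda>r. ennreal (4 * sin r / cos r ^ 5) * indicator {0..r_star} r"
  let ?c = "\<lambda>r x. if cos r * norm x \<le> min (inner x p) (inner x q) then 1 else (0 :: ennreal)"
  have "emeasure lborel (lens p q) = (\<integral>\<^sup>+x. indicator (lens p q) x \<partial>lborel)"
    by simp
  also have "\<dots> = (\<integral>\<^sup>+x. indicator {x. norm x \<le> 1} x *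
      (\<integral>\<^sup>+\<mu>. ennreal (4 * \<mu> ^ 3 * norm x ^ 4) * indicator {0<..} \<mu> * indicator (lens p q) (\<mu> *\<^sub>R x) \<partial>lborel) \<partial>lborel)"
    by (rule nn_integral_polar[symmetric]) measurable
  also have "\<dots> = (\<integral>\<^sup>+x. indicator {x. norm x \<le> 1} x * (\<integral>\<^sup>+r. ?T r * ?c r x \<partial>lborel) \<partial>lborel)"
    by (rule nn_integral_cong_AE, use AE_lborel_singleton[of 0] in eventually_elim)
      (subst radial_integral_lens[OF _ p], assumption, rule refl)
  also have "\<dots> = (\<integral>\<^sup>+x. (\<integral>\<^sup>+r. indicator {x. norm x \<le> 1} x * (?T r * ?c r x) \<partial>lborel) \<partial>lborel)"
    by (intro nn_integral_cong nn_integral_cmult[symmetric]) measurable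
  also have "\<dots> = (\<integral>\<^sup>+r. (\<integral>\<^sup>+x. indicator {x. norm x \<le> 1} x * (?T r * ?c r x) \<partial>lborel) \<partial>lborel)"
    by (rule lborel_pair.Fubini') measurable
  also have "\<dots> = (\<integral>\<^sup>+r. ?T r * emeasure lborel (sector p q r) \<partial>lborel)"
  proof (rule nn_integral_cong)
    fix r
    have "(\<integral>\<^sup>+x. indicator {x. norm x \<le> 1} x * (?T r * ?c r x) \<partial>lborel)
        = (\<integral>\<^sup>+x. ?T r * (indicator {x. norm x \<le> 1} x * ?c r x) \<partial>lborel)"
      by (intro nn_integral_cong) (simp only: mult_ac)
    also have "\<dots> = ?T r * (\<integral>\<^sup>+x. indicator {x. norm x \<le> 1} x * ?c r x \<partial>lborel)"
      by (rule nn_integral_cmult) measurable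
    finally show "(\<integral>\<^sup>+x. indicator {x. norm x \<le> 1} x * (?T r * ?c r x) \<partial>lborel) = ?T r * emeasure lborel (sector p q r)"
      unfolding emeasure_sector .
  qed
  finally show ?thesis ..
qed

lemma integral_cap_inter:
  assumes p: "norm p = 1" "norm q = 1"
  shows "integral_dsec4 (\<lambda>r. measure sphere_measure (cap r p \<inter> cap r q)) = 4 * measure lborel (lens p q)"
proof -
  define T where "T r = 4 * sin r / cos r ^ 5" for r :: real
  define g where "g r = indicator {0..r_star} r * (T r * (4 * measure lborel (sector p q r)))" for r
  have T: "0 \<le> T r" if "r \<in> {0..r_star}" for r
  proof -
    have "cos r > 0" using that by (intro cos_pos_r_star) auto
    moreover have "0 \<le> sin r" using that r_star(2) pi_gt_zero by (intro sin_ge_zero) auto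
    ultimately show ?thesis by (simp add: T_def)
  qed
  \<comment> \<open>Measurability in \<open>r\<close> is obtained from the volume written as an
    integral with parameter \<open>r\<close>.\<close>
  have sector: "measure lborel (sector p q r) = enn2real (\<integral>\<^sup>+x. indicator {x. norm x \<le> 1} x *
      (if cos r * norm x \<le> min (inner x p) (inner x q) then 1 else 0) \<partial>lborel)" for r
    unfolding measure_def emeasure_sector ..
  have "(\<lambda>r. \<integral>\<^sup>+x. indicator {x. norm x \<le> 1} x *
      (if cos r * norm x \<le> min (inner x p) (inner x q) then 1 else 0) \<partial>lborel) \<in> borel_measurable borel"
    by measurable
  then have meas: "g \<in> borel_measurable borel"
    unfolding g_def sector T_def by measurable
  have nonneg: "0 \<le> g r" for r
    using T[of r] by (auto simp: g_def indicator_def)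
  have nn: "(\<integral>\<^sup>+r. ennreal (g r) \<partial>lborel) = ennreal (4 * measure lborel (lens p q))"
  proof -
    have "ennreal (g r) = 4 * (ennreal (T r) * indicator {0..r_star} r * emeasure lborel (sector p q r))" for r
    proof (cases "r \<in> {0..r_star}")
      case True
      have "emeasure lborel (sector p q r) = ennreal (measure lborel (sector p q r))"
        using emeasure_sector_finite[of p q r] by (simp add: emeasure_eq_ennreal_measure less_top)
      then show ?thesis
        using True T[OF True] by (simp add: g_def ennreal_mult mult_ac)
    qed (simp add: g_def)
    then have "(\<integral>\<^sup>+r. ennreal (g r) \<partial>lborel)
        = (\<integral>\<^sup>+r. 4 * (ennreal (T r) * indicator {0..r_star} r * emeasure lborel (sector p q r)) \<partial>lborel)"
      by simp
    also have "\<dots> = 4 * (\<integral>\<^sup>+r. ennreal (T r) * indicator {0..r_star} r * emeasure lborel (sector p q r) \<partial>lborel)"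
      by (rule nn_integral_cmult) (simp add: emeasure_sector T_def)
    also have "\<dots> = 4 * emeasure lborel (lens p q)"
      unfolding T_def nn_integral_sector[OF p(1)] ..
    also have "\<dots> = ennreal (4 * measure lborel (lens p q))"
      using emeasure_lens_finite[of p q] by (simp add: emeasure_eq_ennreal_measure less_top ennreal_mult)
    finally show ?thesis .
  qed
  have "(g has_integral 4 * measure lborel (lens p q)) UNIV"
    by (rule nn_integral_has_integral[OF meas nonneg nn]) simp
  moreover have "g = (\<lambda>r. if r \<in> {0..r_star} then T r * (4 * measure lborel (sector p q r)) else 0)"
    by (auto simp: g_def)
  ultimately have A: "((\<lambda>r. T r * (4 * measure lborel (sector p q r))) has_integral 4 * measure lborel (lens p q)) {0..r_star}"
    by (simp only: has_integral_restrict_UNIV)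
  have B: "measure sphere_measure (cap r p \<inter> cap r q) * deriv (\<lambda>s. (1 / cos s) ^ 4) r
      = T r * (4 * measure lborel (sector p q r))" if "r \<in> {0..r_star}" for r
    using that r_star(2) pi_gt_zero by (subst measure_cap_inter[OF p]) (auto simp: deriv_sec4 T_def)
  show ?thesis
    unfolding integral_dsec4_def by (rule integral_unique, rule has_integral_eq[OF B[symmetric] A])
qed

section \<open>Invariance of lens volumes under orthogonal maps\<close>

definition rot :: "real \<Rightarrow> real^4" where
  "rot \<gamma> = cos \<gamma> *\<^sub>R axis 1 1 + sin \<gamma> *\<^sub>R axis 2 1"

lemma inner_rot: "inner x (rot \<gamma>) = cos \<gamma> * x $ 1 + sin \<gamma> * x $ 2"
  by (simp add: rot_def inner_add_right inner_axis)

lemma norm_rot: "norm (rot \<gamma>) = 1"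
  by (simp add: norm_eq_1 inner_rot) (simp add: rot_def axis_def power2_eq_square[symmetric])

lemma omega_eq_lens: "\<omega> u = measure lborel (lens (axis 1 1) (rot (arccos u)))"
proof -
  have "\<omega> u = 1/4 * integral_dsec4 (\<lambda>r. measure sphere_measure (cap r (axis 1 1) \<inter> cap r (rot (arccos u))))"
    unfolding \<omega>_def lens_area_def rot_def ..
  then show ?thesis
    by (subst (asm) integral_cap_inter) (auto simp: norm_rot)
qed

text \<open>The reflection in the hyperplane orthogonal to \<open>a - b\<close>. Its fixed points
  are the vectors with equal inner products with \<open>a\<close> and \<open>b\<close>; hence, once
  one centre of a lens has been moved to its place, a second reflection can move the other without
  disturbing it.\<close>

lemma reflection_exchange:
  fixes a b :: "'a::euclidean_space"
  assumes "norm a = norm b"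
  shows "\<exists>f. orthogonal_transformation f \<and> f a = b \<and> f b = a \<and> (\<forall>x. inner x a = inner x b \<longrightarrow> f x = x)"
proof (cases "a = b")
  case True
  then show ?thesis
    by (intro exI[of _ "\<lambda>x. x"]) (simp add: orthogonal_transformation_id)
next
  case False
  define d where "d = a - b"
  define f where "f x = x - (2 * inner x d / inner d d) *\<^sub>R d" for x
  have d: "inner d d \<noteq> 0" using False by (simp add: d_def)
  have "linear f"
    by (rule linearI) (simp_all add: f_def inner_add_left algebra_simps add_divide_distrib)
  moreover have "inner (f v) (f w) = inner v w" for v w
    using d by (simp add: f_def inner_diff_left inner_diff_right inner_commute field_simps)
  ultimately have "orthogonal_transformation f"
    by (simp add: orthogonal_transformation_def)
  moreover have ab: "inner a a = inner b b"
    using assms by (metis power2_norm_eq_inner)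
  have "2 * inner a d = inner d d"
    by (simp add: d_def inner_diff_left inner_diff_right ab inner_commute)
  then have "f a = b"
    using d by (simp add: f_def) (simp add: d_def)
  moreover have "2 * inner b d = - inner d d"
    by (simp add: d_def inner_diff_left inner_diff_right ab inner_commute)
  then have "f b = a"
    using d by (simp add: f_def) (simp add: d_def)
  moreover have "f x = x" if "inner x a = inner x b" for x
    using that by (simp add: f_def d_def inner_diff_right)
  ultimately show ?thesis
    by blast
qed

lemma measure_orthogonal_transformation:
  fixes f :: "real^'n::{finite,wellorder} \<Rightarrow> real^'n::{finite,wellorder}"
  assumes "orthogonal_transformation f" "S \<in> sets borel" "emeasure lborel S < \<infinity>"
    "T \<in> sets borel" "\<And>x. f x \<in> T \<longleftrightarrow> x \<in> S"
  shows "measure lborel T = measure lborel S"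
proof -
  have "f ` S = T"
  proof (rule equalityI; rule subsetI)
    fix y assume "y \<in> T"
    moreover obtain x where "y = f x"
      using orthogonal_transformation_surj[OF assms(1)] by (meson surjD)
    ultimately show "y \<in> f ` S"
      using assms(5)[of x] by blast
  qed (use assms(5) in blast)
  moreover have "S \<in> lmeasurable"
    using assms(2,3) by (simp add: fmeasurable_def)
  ultimately have "measure lebesgue T = measure lebesgue S"
    using measure_orthogonal_image[OF assms(1)] by metis
  then show ?thesis
    using assms(2,4) by (simp add: measure_completion)
qed

lemma lens_rotate:
  assumes "orthogonal_transformation f"
  shows "measure lborel (lens (f p) (f q)) = measure lborel (lens p q)"
proof (rule measure_orthogonal_transformation[OF assms])
  have "inner (f x) (f y) = inner x y" for x y
    using assms by (simp add: orthogonal_transformation_def)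
  then show "f x \<in> lens (f p) (f q) \<longleftrightarrow> x \<in> lens p q" for x
    by (simp add: lens_def orthogonal_transformation_norm[OF assms])
qed (simp_all add: emeasure_lens_finite[unfolded infinity_ennreal_def])

lemma lens_eq_omega:
  assumes p: "norm p = 1" "norm q = 1"
  shows "measure lborel (lens p q) = \<omega> (inner p q)"
proof -
  let ?e = "axis 1 1 :: real^4"
  define u where "u = inner p q"
  have "\<bar>u\<bar> \<le> 1"
    using Cauchy_Schwarz_ineq2[of p q] p by (simp add: u_def)
  then have u: "cos (arccos u) = u" by (simp add: abs_le_iff)
  obtain f where f: "orthogonal_transformation f" "f p = ?e"
    using reflection_exchange[of p ?e] p by auto
  have "norm (f q) = 1"
    using f(1) p by (simp add: orthogonal_transformation_norm)
  then obtain g where g: "orthogonal_transformation g" "g (f q) = rot (arccos u)"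
      "\<And>x. inner x (f q) = inner x (rot (arccos u)) \<Longrightarrow> g x = x"
    using reflection_exchange[of "f q" "rot (arccos u)"] norm_rot by auto
  have "inner ?e (f q) = u"
    using f by (metis orthogonal_transformation_def u_def)
  then have "g ?e = ?e"
    by (intro g(3)) (simp add: inner_rot u axis_def)
  then have "measure lborel (lens ?e (rot (arccos u))) = measure lborel (lens (g (f p)) (g (f q)))"
    unfolding f(2) g(2) by simp
  also have "\<dots> = measure lborel (lens p q)"
    by (simp only: lens_rotate[OF g(1)] lens_rotate[OF f(1)])
  finally show ?thesis
    by (simp add: omega_eq_lens u_def)
qed

section \<open>Volumes of slope regions\<close>

definition slab :: "real set \<Rightarrow> (real^4) set" where
  "slab S = {x. norm x \<le> sqrt (3/2) \<and> 1 < x $ 1 \<and> x $ 2 / x $ 1 \<in> S}"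

text \<open>The last two coordinates form a complex number because the fibre of a slab over the
  first two coordinates is a disc.\<close>

definition vec4 :: "real \<times> real \<times> complex \<Rightarrow> real^4" where
  "vec4 p = fst p *\<^sub>R axis 1 1 + fst (snd p) *\<^sub>R axis 2 1
     + Re (snd (snd p)) *\<^sub>R axis 3 1 + Im (snd (snd p)) *\<^sub>R axis 4 1"

lemma vec4_nth [simp]:
  "vec4 (a, b, z) $ 1 = a" "vec4 (a, b, z) $ 2 = b" "vec4 (a, b, z) $ 3 = Re z" "vec4 (a, b, z) $ 4 = Im z"
  by (simp_all add: vec4_def axis_def)

lemma vec4_measurable [measurable]: "vec4 \<in> borel_measurable borel"
  unfolding vec4_def by (intro borel_measurable_continuous_onI continuous_intros)

lemma prod_Basis_real_vec4: "(\<Prod>b\<in>(Basis :: (real^4) set). inner x b) = x $ 1 * x $ 2 * x $ 3 * x $ 4"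
proof -
  have B: "(Basis :: (real^4) set) = (\<lambda>i. axis i 1) ` UNIV"
    by (auto simp: Basis_vec_def)
  have "inj (\<lambda>i::4. axis i (1::real))"
    by (auto simp: inj_on_def axis_eq_axis)
  then have "(\<Prod>b\<in>(Basis :: (real^4) set). inner x b) = (\<Prod>i\<in>(UNIV :: 4 set). x $ i)"
    unfolding B by (subst prod.reindex) (auto simp: inner_axis)
  also have "\<dots> = x $ 1 * x $ 2 * x $ 3 * x $ 4"
    unfolding UNIV_4 by simp
  finally show ?thesis .
qed

lemma emeasure_box_complex:
  assumes "a \<le> b" "c \<le> d"
  shows "emeasure lborel (box (Complex a c) (Complex b d)) = ennreal ((b - a) * (d - c))"
proof -
  have "emeasure lborel (box (Complex a c) (Complex b d)) = ennreal (\<Prod>e\<in>Basis. inner (Complex b d - Complex a c) e)"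
    using assms by (intro emeasure_lborel_box) (auto simp: Basis_complex_def)
  then show ?thesis
    by (simp add: Basis_complex_def)
qed

lemma distr_vec4: "distr lborel borel vec4 = lborel"
proof (rule lborel_eqI[symmetric])
  fix l u :: "real^4" assume lu: "\<And>b. b \<in> Basis \<Longrightarrow> inner l b \<le> inner u b"
  have le: "l $ i \<le> u $ i" for i
    using lu[of "axis i 1"] by (simp add: inner_axis axis_in_Basis_iff)
  have "vec4 -` box l u = box (l $ 1) (u $ 1) \<times> box (l $ 2) (u $ 2) \<times> box (Complex (l $ 3) (l $ 4)) (Complex (u $ 3) (u $ 4))"
  proof -
    have "vec4 (a, b, z) \<in> box l u \<longleftrightarrow> a \<in> box (l $ 1) (u $ 1) \<and> b \<in> box (l $ 2) (u $ 2) \<and>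
        z \<in> box (Complex (l $ 3) (l $ 4)) (Complex (u $ 3) (u $ 4))" for a b z
      unfolding mem_box_cart forall_4 by (auto simp: box_def Basis_complex_def)
    then show ?thesis by auto
  qed
  then have "emeasure (distr lborel borel vec4) (box l u)
      = emeasure (lborel \<Otimes>\<^sub>M lborel) (box (l $ 1) (u $ 1) \<times> box (l $ 2) (u $ 2) \<times> box (Complex (l $ 3) (l $ 4)) (Complex (u $ 3) (u $ 4)))"
    by (subst emeasure_distr) (auto simp: lborel_prod)
  also have "\<dots> = emeasure lborel (box (l $ 1) (u $ 1)) * (emeasure lborel (box (l $ 2) (u $ 2)) *
      emeasure lborel (box (Complex (l $ 3) (l $ 4)) (Complex (u $ 3) (u $ 4))))"
    by (subst lborel.emeasure_pair_measure_Times, simp, simp add: borel_prod[symmetric],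
        subst lborel_prod[symmetric], subst lborel.emeasure_pair_measure_Times) auto
  also have "\<dots> = ennreal (u $ 1 - l $ 1) * (ennreal (u $ 2 - l $ 2) * ennreal ((u $ 3 - l $ 3) * (u $ 4 - l $ 4)))"
    using le by (simp add: emeasure_box_complex)
  also have "\<dots> = ennreal (\<Prod>b\<in>Basis. inner (u - l) b)"
    unfolding prod_Basis_real_vec4 using le by (simp flip: ennreal_mult add: mult.assoc)
  finally show "emeasure (distr lborel borel vec4) (box l u) = ennreal (\<Prod>b\<in>Basis. inner (u - l) b)" .
qed simp

lemma nn_integral_vec4:
  assumes [measurable]: "f \<in> borel_measurable borel"
  shows "(\<integral>\<^sup>+x. f x \<partial>lborel) = (\<integral>\<^sup>+a. \<integral>\<^sup>+b. \<integral>\<^sup>+z. f (vec4 (a, b, z)) \<partial>lborel \<partial>lborel \<partial>lborel)"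
proof -
  have [measurable]: "(\<lambda>p. f (vec4 p)) \<in> borel_measurable borel"
    by (rule measurable_compose[OF vec4_measurable assms])
  then have [measurable]: "(\<lambda>p. f (vec4 p)) \<in> borel_measurable (lborel \<Otimes>\<^sub>M lborel)"
    by (simp add: lborel_prod)
  have "(\<integral>\<^sup>+x. f x \<partial>lborel) = (\<integral>\<^sup>+p. f (vec4 p) \<partial>(lborel \<Otimes>\<^sub>M lborel))"
    unfolding lborel_prod by (subst distr_vec4[symmetric]) (simp add: nn_integral_distr)
  also have "\<dots> = (\<integral>\<^sup>+a. \<integral>\<^sup>+q. f (vec4 (a, q)) \<partial>lborel \<partial>lborel)"
    by (subst lborel.nn_integral_fst[symmetric]) auto
  also have "\<dots> = (\<integral>\<^sup>+a. \<integral>\<^sup>+q. f (vec4 (a, q)) \<partial>(lborel \<Otimes>\<^sub>M lborel) \<partial>lborel)"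
    by (simp only: lborel_prod)
  also have "\<dots> = (\<integral>\<^sup>+a. \<integral>\<^sup>+b. \<integral>\<^sup>+z. f (vec4 (a, b, z)) \<partial>lborel \<partial>lborel \<partial>lborel)"
  proof (rule nn_integral_cong)
    fix a :: real
    have "(\<lambda>q. f (vec4 (a, q))) \<in> borel_measurable borel"
      by (rule measurable_compose[OF _ \<open>(\<lambda>p. f (vec4 p)) \<in> borel_measurable borel\<close>]) (simp add: borel_prod[symmetric])
    then have "(\<lambda>q. f (vec4 (a, q))) \<in> borel_measurable (lborel \<Otimes>\<^sub>M lborel)"
      by (simp add: lborel_prod)
    then show "(\<integral>\<^sup>+q. f (vec4 (a, q)) \<partial>(lborel \<Otimes>\<^sub>M lborel)) = (\<integral>\<^sup>+b. \<integral>\<^sup>+z. f (vec4 (a, b, z)) \<partial>lborel \<partial>lborel)"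
      by (subst lborel.nn_integral_fst[symmetric]) auto
  qed
  finally show ?thesis .
qed

lemma emeasure_disc:
  assumes "0 \<le> r"
  shows "emeasure lborel {z :: complex. (cmod z)\<^sup>2 \<le> r} = ennreal (pi * r)"
proof -
  have "{z :: complex. (cmod z)\<^sup>2 \<le> r} = cball 0 (sqrt r)"
    using assms by (auto simp: real_le_rsqrt) (metis abs_norm_cancel real_sqrt_abs real_sqrt_le_iff real_sqrt_pow2 sqrt_le_D)
  then show ?thesis
    using assms by (simp add: emeasure_cball unit_ball_vol_2 mult.commute flip: ennreal_mult)
qed

text \<open>Here \<open>c\<close> is \<open>1 + m^2\<close> for the slope \<open>m\<close>, and the
  factor \<open>a\<close> is the Jacobian of the substitution of \<open>a * m\<close> for the second
  coordinate. Since \<open>ennreal\<close> sends negative numbers to 0, the integrand vanishes by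
  itself beyond \<open>a = sqrt (3 / (2 * c))\<close>.\<close>

lemma nn_integral_radial:
  assumes c: "1 \<le> c"
  shows "(\<integral>\<^sup>+a. indicator {1<..} a * (ennreal a * ennreal (pi * (3/2 - a\<^sup>2 * c))) \<partial>lborel)
    = (if c \<le> 3/2 then ennreal (pi / 4 * (3/2 - c)\<^sup>2 / c) else 0)"
proof (cases "c \<le> 3/2")
  case True
  define b where "b = sqrt (3 / (2 * c))"
  have b: "1 \<le> b" "b\<^sup>2 * c = 3/2"
    using True c by (simp_all add: b_def field_simps)
  have ab: "a\<^sup>2 * c \<le> 3/2 \<longleftrightarrow> a \<le> b" if "1 \<le> a" for a
  proof -
    have "a\<^sup>2 * c \<le> b\<^sup>2 * c \<longleftrightarrow> a \<le> b"
      using c b(1) that by (simp add: power2_le_iff_abs_le)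
    then show ?thesis using b(2) by simp
  qed
  have "(\<integral>\<^sup>+a. indicator {1<..} a * (ennreal a * ennreal (pi * (3/2 - a\<^sup>2 * c))) \<partial>lborel)
      = (\<integral>\<^sup>+a. ennreal (a * (pi * (3/2 - a\<^sup>2 * c))) * indicator {1..b} a \<partial>lborel)"
  proof (rule nn_integral_cong_AE, use AE_lborel_singleton[of 1] in eventually_elim)
    fix a :: real assume "a \<noteq> 1"
    show "indicator {1<..} a * (ennreal a * ennreal (pi * (3/2 - a\<^sup>2 * c))) = ennreal (a * (pi * (3/2 - a\<^sup>2 * c))) * indicator {1..b} a"
    proof (cases "1 < a")
      case True
      show ?thesis
      proof (cases "a \<le> b")
        case True
        with \<open>1 < a\<close> show ?thesis
          using ab[of a] by (simp add: ennreal_mult)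
      next
        case False
        then have "pi * (3/2 - a\<^sup>2 * c) \<le> 0"
          using ab[of a] \<open>1 < a\<close> by (simp add: mult_le_0_iff)
        with False show ?thesis
          by (simp add: ennreal_neg)
      qed
    next
      case False
      with \<open>a \<noteq> 1\<close> show ?thesis by simp
    qed
  qed
  also have "\<dots> = ennreal (- (pi / (4 * c)) * (3/2 - b\<^sup>2 * c)\<^sup>2 - - (pi / (4 * c)) * (3/2 - 1\<^sup>2 * c)\<^sup>2)"
  proof (rule nn_integral_FTC_Icc)
    show "((\<lambda>a. - (pi / (4 * c)) * (3/2 - a\<^sup>2 * c)\<^sup>2) has_real_derivative a * (pi * (3/2 - a\<^sup>2 * c))) (at a)" for a
      using c by (auto intro!: derivative_eq_intros simp: field_simps)
    show "0 \<le> a * (pi * (3/2 - a\<^sup>2 * c))" if "a \<in> {1..b}" for a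
      using ab[of a] that by simp
  qed (use b in simp_all)
  finally show ?thesis
    using True b(2) by simp
next
  case False
  have "indicator {1<..} a * (ennreal a * ennreal (pi * (3/2 - a\<^sup>2 * c))) = 0" for a :: real
  proof (cases "1 < a")
    case True
    have "1 * (3/2) \<le> a\<^sup>2 * c"
      using True False by (intro mult_mono) auto
    then have "pi * (3/2 - a\<^sup>2 * c) \<le> 0"
      by (simp add: mult_le_0_iff)
    then show ?thesis by (simp add: ennreal_neg)
  qed simp
  then have "(\<integral>\<^sup>+a. indicator {1<..} a * (ennreal a * ennreal (pi * (3/2 - a\<^sup>2 * c))) \<partial>lborel) = 0"
    by (simp only: nn_integral_const mult_zero_left)
  then show ?thesis
    by (simp only: False if_False)
qed

lemma emeasure_slab:
  assumes [measurable]: "S \<in> sets borel"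
  shows "emeasure lborel (slab S) = (\<integral>\<^sup>+m. indicator S m * (if m\<^sup>2 \<le> 1/2 then ennreal (pi / 4 * (1/2 - m\<^sup>2)\<^sup>2 / (1 + m\<^sup>2)) else 0) \<partial>lborel)"
proof -
  have meas [measurable]: "slab S \<in> sets borel"
  proof -
    have "slab S = {x \<in> space borel. norm x \<le> sqrt (3/2) \<and> 1 < inner x (axis 1 1) \<and> inner x (axis 2 1) / inner x (axis 1 1) \<in> S}"
      by (auto simp: slab_def inner_axis)
    also have "\<dots> \<in> sets borel" by measurable
    finally show ?thesis .
  qed
  have mem: "vec4 (a, b, z) \<in> slab S \<longleftrightarrow> 1 < a \<and> b / a \<in> S \<and> (cmod z)\<^sup>2 \<le> 3/2 - a\<^sup>2 - b\<^sup>2" for a b z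
  proof -
    have "norm (vec4 (a, b, z)) = sqrt (a\<^sup>2 + b\<^sup>2 + (cmod z)\<^sup>2)"
      by (simp add: norm_vec_def L2_set_def sum_4 cmod_power2)
    then show ?thesis
      by (auto simp: slab_def)
  qed
  have disc: "(\<integral>\<^sup>+z. indicator (slab S) (vec4 (a, b, z)) \<partial>lborel)
      = indicator {1<..} a * (indicator S (b / a) * ennreal (pi * (3/2 - a\<^sup>2 - b\<^sup>2)))" for a b
  proof (cases "1 < a \<and> b / a \<in> S \<and> a\<^sup>2 + b\<^sup>2 \<le> 3/2")
    case True
    have "(\<integral>\<^sup>+z. indicator (slab S) (vec4 (a, b, z)) \<partial>lborel) = (\<integral>\<^sup>+z. indicator {z. (cmod z)\<^sup>2 \<le> 3/2 - a\<^sup>2 - b\<^sup>2} z \<partial>lborel)"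
      using True mem by (intro nn_integral_cong) (auto simp: indicator_def)
    also have "\<dots> = emeasure lborel {z :: complex. (cmod z)\<^sup>2 \<le> 3/2 - a\<^sup>2 - b\<^sup>2}"
      by (rule nn_integral_indicator) measurable
    finally show ?thesis
      using True by (simp add: emeasure_disc)
  next
    case False
    have "vec4 (a, b, z) \<notin> slab S" for z
    proof
      assume "vec4 (a, b, z) \<in> slab S"
      then have "1 < a \<and> b / a \<in> S \<and> (cmod z)\<^sup>2 \<le> 3/2 - a\<^sup>2 - b\<^sup>2"
        by (simp only: mem)
      moreover have "0 \<le> (cmod z)\<^sup>2" by simp
      ultimately show False
        using False by linarith
    qed
    then have "indicator (slab S) (vec4 (a, b, z)) = (0 :: ennreal)" for z
      by simp
    moreover have "1 < a \<Longrightarrow> b / a \<in> S \<Longrightarrow> pi * (3/2 - a\<^sup>2 - b\<^sup>2) \<le> 0"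
      using False by (simp add: mult_le_0_iff)
    ultimately show ?thesis
      by (auto simp: indicator_def ennreal_neg)
  qed
  have slope: "(\<integral>\<^sup>+b. indicator {1<..} a * (indicator S (b / a) * ennreal (pi * (3/2 - a\<^sup>2 - b\<^sup>2))) \<partial>lborel)
      = (\<integral>\<^sup>+m. indicator S m * (indicator {1<..} a * (ennreal a * ennreal (pi * (3/2 - a\<^sup>2 * (1 + m\<^sup>2))))) \<partial>lborel)" for a
  proof (cases "1 < a")
    case True
    have "(\<integral>\<^sup>+b. indicator S (b / a) * ennreal (pi * (3/2 - a\<^sup>2 - b\<^sup>2)) \<partial>lborel)
        = ennreal \<bar>a\<bar> * (\<integral>\<^sup>+m. indicator S ((0 + a * m) / a) * ennreal (pi * (3/2 - a\<^sup>2 - (0 + a * m)\<^sup>2)) \<partial>lborel)"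
      using True by (intro nn_integral_real_affine) auto
    also have "\<dots> = (\<integral>\<^sup>+m. ennreal \<bar>a\<bar> * (indicator S ((0 + a * m) / a) * ennreal (pi * (3/2 - a\<^sup>2 - (0 + a * m)\<^sup>2))) \<partial>lborel)"
      by (rule nn_integral_cmult[symmetric]) measurable
    also have "\<dots> = (\<integral>\<^sup>+m. indicator S m * (ennreal a * ennreal (pi * (3/2 - a\<^sup>2 * (1 + m\<^sup>2)))) \<partial>lborel)"
      using True by (intro nn_integral_cong) (simp add: power_mult_distrib distrib_left mult_ac diff_diff_eq)
    finally show ?thesis
      using True by simp
  qed simp
  have "emeasure lborel (slab S) = (\<integral>\<^sup>+x. indicator (slab S) x \<partial>lborel)"
    by simp
  also have "\<dots> = (\<integral>\<^sup>+a. \<integral>\<^sup>+b. \<integral>\<^sup>+z. indicator (slab S) (vec4 (a, b, z)) \<partial>lborel \<partial>lborel \<partial>lborel)"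
    by (rule nn_integral_vec4) measurable
  also have "\<dots> = (\<integral>\<^sup>+a. \<integral>\<^sup>+m. indicator S m * (indicator {1<..} a * (ennreal a * ennreal (pi * (3/2 - a\<^sup>2 * (1 + m\<^sup>2))))) \<partial>lborel \<partial>lborel)"
    unfolding disc slope ..
  also have "\<dots> = (\<integral>\<^sup>+m. \<integral>\<^sup>+a. indicator S m * (indicator {1<..} a * (ennreal a * ennreal (pi * (3/2 - a\<^sup>2 * (1 + m\<^sup>2))))) \<partial>lborel \<partial>lborel)"
    by (rule lborel_pair.Fubini') measurable
  also have "\<dots> = (\<integral>\<^sup>+m. indicator S m * (\<integral>\<^sup>+a. indicator {1<..} a * (ennreal a * ennreal (pi * (3/2 - a\<^sup>2 * (1 + m\<^sup>2)))) \<partial>lborel) \<partial>lborel)"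
    by (intro nn_integral_cong nn_integral_cmult) measurable
  also have "\<dots> = (\<integral>\<^sup>+m. indicator S m * (if m\<^sup>2 \<le> 1/2 then ennreal (pi / 4 * (1/2 - m\<^sup>2)\<^sup>2 / (1 + m\<^sup>2)) else 0) \<partial>lborel)"
  proof (rule nn_integral_cong)
    fix m :: real
    have "3/2 - (1 + m\<^sup>2) = 1/2 - m\<^sup>2" "(1 + m\<^sup>2 \<le> 3/2) = (m\<^sup>2 \<le> 1/2)"
      by auto
    then show "indicator S m * (\<integral>\<^sup>+a. indicator {1<..} a * (ennreal a * ennreal (pi * (3/2 - a\<^sup>2 * (1 + m\<^sup>2)))) \<partial>lborel)
      = indicator S m * (if m\<^sup>2 \<le> 1/2 then ennreal (pi / 4 * (1/2 - m\<^sup>2)\<^sup>2 / (1 + m\<^sup>2)) else 0)"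
      by (subst nn_integral_radial) auto
  qed
  finally show ?thesis .
qed

text \<open>Antiderivative of \<open>(1/2 - m^2)^2 / (1 + m^2)\<close>, which polynomial division
  turns into \<open>m^2 - 2 + 9/4 / (1 + m^2)\<close>.\<close>

definition slope_primitive :: "real \<Rightarrow> real" where
  "slope_primitive m = m ^ 3 / 3 - 2 * m + 9/4 * arctan m"

lemma nn_integral_slope:
  assumes "a \<le> b"
  shows "(\<integral>\<^sup>+m. ennreal (pi / 4 * (1/2 - m\<^sup>2)\<^sup>2 / (1 + m\<^sup>2)) * indicator {a..b} m \<partial>lborel)
    = ennreal (pi / 4 * slope_primitive b - pi / 4 * slope_primitive a)"
proof (rule nn_integral_FTC_Icc)
  fix m :: real
  have nz: "1 + m\<^sup>2 \<noteq> 0"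
    by (metis add_nonneg_eq_0_iff zero_le_one zero_le_power2 zero_neq_one)
  have E: "pi / 4 * (3 * m\<^sup>2 / 3 - 2 + 9/4 * inverse (1 + m\<^sup>2)) = pi / 4 * (1/2 - m\<^sup>2)\<^sup>2 / (1 + m\<^sup>2)"
    using nz by (simp add: field_simps power2_eq_square)
  have D: "((\<lambda>m. pi / 4 * slope_primitive m) has_real_derivative pi / 4 * (3 * m\<^sup>2 / 3 - 2 + 9/4 * inverse (1 + m\<^sup>2))) (at m)"
    unfolding slope_primitive_def by (auto intro!: derivative_eq_intros)
  show "((\<lambda>m. pi / 4 * slope_primitive m) has_real_derivative pi / 4 * (1/2 - m\<^sup>2)\<^sup>2 / (1 + m\<^sup>2)) (at m)"
    by (rule D[unfolded E])
qed (use assms in auto)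

text \<open>For \<open>0 \<le> m \<le> sqrt (1/2)\<close> the volume of the part of a cap with slope
  at least \<open>m\<close>. The upper limit comes from \<open>x $ 1 > 1\<close> and
  \<open>norm x \<le> sqrt (3/2)\<close>, which force the square of the slope below 1/2.\<close>

definition J :: "real \<Rightarrow> real" where
  "J m = pi / 4 * (slope_primitive (sqrt (1/2)) - slope_primitive m)"

lemma slope_sq_le: "m\<^sup>2 \<le> 1/2 \<longleftrightarrow> - sqrt (1/2) \<le> m \<and> m \<le> sqrt (1/2)" for m :: real
  using real_sqrt_le_iff[of "m\<^sup>2" "1/2"] by (auto simp: abs_le_iff)

lemma emeasure_slab_ge:
  assumes "0 \<le> m0" "m0 \<le> sqrt (1/2)"
  shows "emeasure lborel (slab {m0..}) = ennreal (J m0)" "emeasure lborel (slab {m0<..}) = ennreal (J m0)"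
proof -
  have I: "(\<integral>\<^sup>+m. ennreal (pi / 4 * (1/2 - m\<^sup>2)\<^sup>2 / (1 + m\<^sup>2)) * indicator {m0..sqrt (1/2)} m \<partial>lborel) = ennreal (J m0)"
    using nn_integral_slope[OF assms(2)] by (simp add: J_def right_diff_distrib)
  have "m0 \<le> m \<Longrightarrow> - sqrt (1/2) \<le> m" for m
    using assms(1) real_sqrt_ge_zero[of "1/2"] by linarith
  then have eq: "indicator {m0..} m * (if m\<^sup>2 \<le> 1/2 then ennreal (pi / 4 * (1/2 - m\<^sup>2)\<^sup>2 / (1 + m\<^sup>2)) else 0)
      = ennreal (pi / 4 * (1/2 - m\<^sup>2)\<^sup>2 / (1 + m\<^sup>2)) * indicator {m0..sqrt (1/2)} m" for m
    unfolding slope_sq_le by (auto simp: indicator_def)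
  show 1: "emeasure lborel (slab {m0..}) = ennreal (J m0)"
    by (subst emeasure_slab) (simp_all only: eq I borel_closed closed_atLeast)
  have "emeasure lborel (slab {m0<..}) = emeasure lborel (slab {m0..})"
    by (subst (1 2) emeasure_slab, simp, simp, rule nn_integral_cong_AE, use AE_lborel_singleton[of m0] in eventually_elim)
      (auto simp: indicator_def)
  with 1 show "emeasure lborel (slab {m0<..}) = ennreal (J m0)" by simp
qed

lemma slope_primitive_odd: "slope_primitive (- m) = - slope_primitive m"
  by (simp add: slope_primitive_def arctan_minus)

lemma J_nonneg: "0 \<le> m \<Longrightarrow> m \<le> sqrt (1/2) \<Longrightarrow> 0 \<le> J m"
proof -
  assume m: "0 \<le> m" "m \<le> sqrt (1/2)"
  have "pi / 4 * slope_primitive m \<le> pi / 4 * slope_primitive (sqrt (1/2))"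
  proof (rule DERIV_nonneg_imp_nondecreasing[OF m(2)])
    fix x :: real
    have "1 + x\<^sup>2 > 0" by (rule add_pos_nonneg) simp_all
    then have E: "pi / 4 * (3 * x\<^sup>2 / 3 - 2 + 9/4 * inverse (1 + x\<^sup>2)) = pi / 4 * (1/2 - x\<^sup>2)\<^sup>2 / (1 + x\<^sup>2)"
      by (simp add: field_simps power2_eq_square)
    have "((\<lambda>m. pi / 4 * slope_primitive m) has_real_derivative pi / 4 * (3 * x\<^sup>2 / 3 - 2 + 9/4 * inverse (1 + x\<^sup>2))) (at x)"
      unfolding slope_primitive_def by (auto intro!: derivative_eq_intros)
    then show "\<exists>y. ((\<lambda>m. pi / 4 * slope_primitive m) has_real_derivative y) (at x) \<and> 0 \<le> y"
      using \<open>1 + x\<^sup>2 > 0\<close> unfolding E by (intro exI conjI) auto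
  qed
  then show "0 \<le> J m"
    by (simp add: J_def right_diff_distrib)
qed

lemma measure_lens_same:
  assumes "norm p = 1"
  shows "measure lborel (lens p p) = 2 * J 0"
proof -
  let ?e = "axis 1 1 :: real^4"
  obtain f where f: "orthogonal_transformation f" "f p = ?e"
    using reflection_exchange[of p ?e] assms by auto
  have "lens ?e ?e = slab UNIV"
    by (auto simp: lens_def slab_def inner_axis)
  moreover have "emeasure lborel (slab UNIV) = ennreal (2 * J 0)"
  proof -
    have "emeasure lborel (slab UNIV) = (\<integral>\<^sup>+m. ennreal (pi / 4 * (1/2 - m\<^sup>2)\<^sup>2 / (1 + m\<^sup>2)) * indicator {- sqrt (1/2)..sqrt (1/2)} m \<partial>lborel)"
      by (subst emeasure_slab, simp, rule nn_integral_cong, unfold slope_sq_le) (auto simp: indicator_def)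
    also have "\<dots> = ennreal (pi / 4 * slope_primitive (sqrt (1/2)) - pi / 4 * slope_primitive (- sqrt (1/2)))"
      by (rule nn_integral_slope) (simp add: real_sqrt_ge_zero)
    finally show ?thesis
      by (simp only: slope_primitive_odd) (simp add: J_def slope_primitive_def[of 0])
  qed
  ultimately have "measure lborel (lens ?e ?e) = 2 * J 0"
    using J_nonneg[of 0] by (simp add: measure_def)
  then show ?thesis
    using lens_rotate[OF f(1), of p p] f(2) by simp
qed

text \<open>The reflection exchanging the two centres halves the lens; on the half nearer to the second
  centre the second cap condition follows from the first, which leaves a bound on the slope.\<close>

lemma omega_eq_J:
  assumes u: "1/3 \<le> u" "u < 1"
  shows "\<omega> u = 2 * J ((1 - u) / sqrt (1 - u\<^sup>2))"
proof -
  define s where "s = sqrt (1 - u\<^sup>2)"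
  \<comment> \<open>The tangent of half the angle between the centres, hence the slope of the
    bisecting hyperplane. The hypothesis \<open>1/3 \<le> u\<close> means
    \<open>\<tau>^2 \<le> 1/2\<close>, the range in which \<open>J\<close> is a volume.\<close>
  define \<tau> where "\<tau> = (1 - u) / s"
  define p where "p = rot (arccos u)"
  let ?e = "axis 1 1 :: real^4"
  have "u\<^sup>2 < 1" using u by (simp add: power2_less_1_iff)
  then have s: "s > 0" "s\<^sup>2 = 1 - u\<^sup>2" by (simp_all add: s_def)
  have \<tau>: "s * \<tau> = 1 - u" using s by (simp add: \<tau>_def)
  have "\<tau>\<^sup>2 * (1 + u) = 1 - u"
  proof -
    have "\<tau>\<^sup>2 * (1 + u) = (1 - u)\<^sup>2 * (1 + u) / (1 - u\<^sup>2)" by (simp add: \<tau>_def power_divide s(2))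
    also have "(1 - u)\<^sup>2 * (1 + u) = (1 - u) * (1 - u\<^sup>2)" by (simp add: power2_eq_square algebra_simps)
    also have "\<dots> / (1 - u\<^sup>2) = 1 - u" using \<open>u\<^sup>2 < 1\<close> by simp
    finally show ?thesis .
  qed
  then have "\<tau>\<^sup>2 \<le> 1/2"
  proof -
    have "\<tau>\<^sup>2 * (1 + u) \<le> 1/2 * (1 + u)" using \<open>\<tau>\<^sup>2 * (1 + u) = 1 - u\<close> u by simp
    then show ?thesis using u by (simp only: mult_le_cancel_right)
  qed
  then have "\<tau> \<le> sqrt (1/2)"
    by (rule real_le_rsqrt)
  moreover have "0 \<le> \<tau>"
    using u s by (simp add: \<tau>_def)
  ultimately have \<tau>_bounds: "0 \<le> \<tau>" "\<tau> \<le> sqrt (1/2)"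
    by auto
  have p: "inner x p = u * x $ 1 + s * x $ 2" for x :: "real^4"
    using u by (simp add: p_def inner_rot s_def sin_arccos_abs)
  have e: "inner x ?e = x $ 1" for x :: "real^4"
    by (simp add: inner_axis)
  have le: "inner x ?e \<le> inner x p \<longleftrightarrow> \<tau> \<le> x $ 2 / x $ 1" if "1 < x $ 1" for x :: "real^4"
  proof -
    have "inner x ?e \<le> inner x p \<longleftrightarrow> s * \<tau> * x $ 1 \<le> s * x $ 2"
      unfolding p e \<tau> by (simp add: algebra_simps)
    also have "\<dots> \<longleftrightarrow> \<tau> * x $ 1 \<le> x $ 2"
      using s(1) by (simp add: mult.assoc)
    also have "\<dots> \<longleftrightarrow> \<tau> \<le> x $ 2 / x $ 1"
      using that by (simp add: pos_le_divide_eq)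
    finally show ?thesis .
  qed
  have less: "inner x ?e < inner x p \<longleftrightarrow> \<tau> < x $ 2 / x $ 1" if "1 < x $ 1" for x :: "real^4"
  proof -
    have "inner x ?e < inner x p \<longleftrightarrow> s * \<tau> * x $ 1 < s * x $ 2"
      unfolding p e \<tau> by (simp add: algebra_simps)
    also have "\<dots> \<longleftrightarrow> \<tau> * x $ 1 < x $ 2"
      using s(1) by (simp add: mult.assoc)
    also have "\<dots> \<longleftrightarrow> \<tau> < x $ 2 / x $ 1"
      using that by (simp add: pos_less_divide_eq)
    finally show ?thesis .
  qed
  have H1: "{x \<in> lens ?e p. inner x ?e \<le> inner x p} = slab {\<tau>..}"
  proof -
    have "x \<in> lens ?e p \<and> inner x ?e \<le> inner x p \<longleftrightarrow> x \<in> slab {\<tau>..}" for x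
    proof (cases "1 < x $ 1")
      case True
      show ?thesis
        using True by (auto simp: lens_def slab_def e le[OF True, unfolded e, symmetric])
    qed (simp add: lens_def slab_def e)
    then show ?thesis by blast
  qed
  have H1': "{x \<in> lens ?e p. inner x ?e < inner x p} = slab {\<tau><..}"
  proof -
    have "x \<in> lens ?e p \<and> inner x ?e < inner x p \<longleftrightarrow> x \<in> slab {\<tau><..}" for x
    proof (cases "1 < x $ 1")
      case True
      show ?thesis
        using True by (auto simp: lens_def slab_def e less[OF True, unfolded e, symmetric])
    qed (simp add: lens_def slab_def e)
    then show ?thesis by blast
  qed
  let ?H2 = "{x \<in> lens ?e p. inner x p < inner x ?e}"
  have norm_p: "norm p = 1" by (simp add: p_def norm_rot)
  obtain f where f: "orthogonal_transformation f" "f ?e = p" "f p = ?e"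
    using reflection_exchange[of ?e p] norm_p by auto
  have inner_f: "inner (f x) (f y) = inner x y" for x y
    using f(1) by (simp add: orthogonal_transformation_def)
  have fe: "inner (f x) p = inner x ?e" "inner (f x) ?e = inner x p" for x
    using inner_f[of x ?e] inner_f[of x p] f by simp_all
  have sets_slab: "slab S \<in> sets borel" if "S \<in> sets borel" for S
  proof -
    have [measurable]: "S \<in> sets borel" by fact
    have "slab S = {x \<in> space borel. norm x \<le> sqrt (3/2) \<and> 1 < inner x (axis 1 1) \<and> inner x (axis 2 1) / inner x (axis 1 1) \<in> S}"
      by (auto simp: slab_def inner_axis)
    also have "\<dots> \<in> sets borel" by measurable
    finally show ?thesis .
  qed
  have H2: "?H2 \<in> sets borel"
  proof -
    have "?H2 = lens ?e p \<inter> {x \<in> space borel. inner x p < inner x ?e}" by auto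
    also have "\<dots> \<in> sets borel" by measurable
    finally show ?thesis .
  qed
  have "measure lborel ?H2 = measure lborel (slab {\<tau><..})"
  proof (rule measure_orthogonal_transformation[OF f(1)])
    show "f x \<in> ?H2 \<longleftrightarrow> x \<in> slab {\<tau><..}" for x
      unfolding H1'[symmetric] by (auto simp: lens_def fe orthogonal_transformation_norm[OF f(1)])
    show "emeasure lborel (slab {\<tau><..}) < \<infinity>"
      using emeasure_slab_ge(2)[OF \<tau>_bounds] by simp
  qed (use H2 sets_slab in auto)
  then have "measure lborel ?H2 = J \<tau>"
    using emeasure_slab_ge(2)[OF \<tau>_bounds] J_nonneg[OF \<tau>_bounds] by (simp add: measure_def)
  moreover have "measure lborel (slab {\<tau>..}) = J \<tau>"
    using emeasure_slab_ge(1)[OF \<tau>_bounds] J_nonneg[OF \<tau>_bounds] by (simp add: measure_def)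
  moreover have "measure lborel (lens ?e p) = measure lborel (slab {\<tau>..}) + measure lborel ?H2"
  proof -
    have "lens ?e p = slab {\<tau>..} \<union> ?H2"
      unfolding H1[symmetric] by auto
    moreover have "emeasure lborel (slab {\<tau>..}) < \<infinity>" "emeasure lborel ?H2 < \<infinity>"
      using emeasure_slab_ge(1)[OF \<tau>_bounds] emeasure_lens_finite[of ?e p]
        emeasure_mono[of ?H2 "lens ?e p" lborel] by (auto intro: le_less_trans)
    moreover have "slab {\<tau>..} \<inter> ?H2 = {}"
      unfolding H1[symmetric] by auto
    ultimately show ?thesis
      using H2 sets_slab by (subst \<open>lens ?e p = _\<close>, intro measure_Union) (auto simp: less_top)
  qed
  ultimately show ?thesis
    by (simp add: omega_eq_lens p_def[symmetric] \<tau>_def s_def)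
qed

lemma omega_nonneg: "0 \<le> \<omega> u"
  by (simp add: omega_eq_lens)

section \<open>The truncated cell\<close>

lemma sum_pairs_square:
  fixes a :: "nat \<Rightarrow> real"
  assumes "\<And>i. a i * a i = a i"
  shows "2 * (\<Sum>j\<in>{1..N}. \<Sum>i\<in>{1..<j}. a i * a j) = (\<Sum>i\<in>{1..N}. a i)\<^sup>2 - (\<Sum>i\<in>{1..N}. a i)"
proof (induction N)
  case (Suc N)
  define A where "A = (\<Sum>i\<in>{1..N}. a i)"
  define P where "P = (\<Sum>j\<in>{1..N}. \<Sum>i\<in>{1..<j}. a i * a j)"
  have ins: "sum g {1..Suc N} = g (Suc N) + sum g {1..N}" for g :: "nat \<Rightarrow> real"
  proof -
    have "{1..Suc N} = insert (Suc N) {1..N}" by auto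
    then show ?thesis by (simp only:) (rule sum.insert, auto)
  qed
  have "(\<Sum>i\<in>{1..<Suc N}. a i * a (Suc N)) = A * a (Suc N)"
    unfolding A_def sum_distrib_right by (intro sum.cong) auto
  moreover have "2 * P = A\<^sup>2 - A"
    using Suc by (simp only: A_def P_def)
  moreover have "a (Suc N) = 0 \<or> a (Suc N) = 1"
    using assms[of "Suc N"] by simp
  ultimately show ?case
    unfolding ins A_def[symmetric] P_def[symmetric]
    by (elim disjE) (simp_all add: power2_eq_square algebra_simps)
qed simp

text \<open>Three unit vectors with pairwise inner products at most \<open>1/2\<close> have a sum of norm at most
  \<open>sqrt 6\<close>, and \<open>sqrt 6 * sqrt (3/2) = 3\<close>.\<close>

lemma card_caps_le_2:
  fixes w :: "nat \<Rightarrow> real^4"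
  assumes contact: "inj_on w I" "contact_configuration (w ` I)" and I: "finite I" and x: "norm x \<le> sqrt (3/2)"
  shows "card {i \<in> I. 1 < inner x (w i)} \<le> 2"
proof (rule ccontr)
  assume "\<not> ?thesis"
  then have "3 \<le> card {i \<in> I. 1 < inner x (w i)}" by simp
  then obtain T where T: "T \<subseteq> {i \<in> I. 1 < inner x (w i)}" "card T = 3"
    by (rule obtain_subset_with_card_n)
  then obtain i j k where ijk: "T = {i, j, k}" "i \<noteq> j" "i \<noteq> k" "j \<noteq> k"
    by (auto simp: card_3_iff)
  have norm: "inner (w l) (w l) = 1" if "l \<in> I" for l
  proof -
    have "norm (w l) = 1" using contact(2) that by (auto simp: contact_configuration_def image_subset_iff)
    then show ?thesis by (simp add: norm_eq_1)
  qed
  have ip: "inner (w l) (w m) \<le> 1/2" if "l \<in> I" "m \<in> I" "l \<noteq> m" for l m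
  proof -
    have "w l \<noteq> w m"
      using contact(1) that by (meson inj_onD)
    then show ?thesis
      using contact(2) that by (simp add: contact_configuration_def)
  qed
  define y where "y = w i + w j + w k"
  have mem: "i \<in> I" "j \<in> I" "k \<in> I" and gt: "1 < inner x (w i)" "1 < inner x (w j)" "1 < inner x (w k)"
    using T(1) by (auto simp: ijk(1))
  have "inner y y = 3 + 2 * inner (w i) (w j) + 2 * inner (w i) (w k) + 2 * inner (w j) (w k)"
    by (simp add: y_def inner_add_left inner_add_right norm mem inner_commute)
  also have "\<dots> \<le> 6"
    using ip[OF mem(1,2) ijk(2)] ip[OF mem(1,3) ijk(3)] ip[OF mem(2,3) ijk(4)] by simp
  finally have "(norm y)\<^sup>2 \<le> 6"
    by (simp add: power2_norm_eq_inner)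
  moreover have "(norm x)\<^sup>2 \<le> 3/2"
    using power_mono[OF x norm_ge_zero, of 2] by simp
  ultimately have "(norm x)\<^sup>2 * (norm y)\<^sup>2 \<le> 3/2 * 6"
    by (intro mult_mono) auto
  then have "(norm x * norm y)\<^sup>2 \<le> 3\<^sup>2"
    by (simp add: power_mult_distrib)
  then have "norm x * norm y \<le> 3"
    by (rule power2_le_imp_le) simp
  moreover have "3 < inner x y"
    using gt by (simp add: y_def inner_add_right)
  ultimately show False
    using norm_cauchy_schwarz[of x y] by simp
qed

lemma measure_truncated_cell:
  fixes w :: "nat \<Rightarrow> real^4"
  assumes contact: "inj_on w {1..N}" "contact_configuration (w ` {1..N})"
  shows "measure lborel (cell (w ` {1..N}) \<inter> cball 0 (sqrt (3/2))) =
    9/8 * pi\<^sup>2 - real N * (2 * J 0) + weight_sum N w"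
proof -
  define I where "I = {1..N}"
  define C where "C = cball (0 :: real^4) (sqrt (3/2))"
  define V where "V = cell (w ` I) \<inter> C"
  have norm: "norm (w i) = 1" if "i \<in> I" for i
    using contact(2) that by (auto simp: contact_configuration_def I_def image_subset_iff)
  have ind: "indicator V x = indicator C x - (\<Sum>i\<in>I. indicator (lens (w i) (w i)) x)
      + (\<Sum>j\<in>I. \<Sum>i\<in>{1..<j}. indicator (lens (w i) (w j)) x :: real)" for x
  proof (cases "x \<in> C")
    case True
    define a where "a i = (if 1 < inner x (w i) then 1 else 0 :: real)" for i
    have x: "norm x \<le> sqrt (3/2)" using True by (simp add: C_def)
    have lens: "indicator (lens (w i) (w j)) x = a i * a j" for i j
      using x by (simp add: lens_def a_def indicator_def)
    define T where "T = {i \<in> I. 1 < inner x (w i)}"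
    define n where "n = card T"
    have sum_a: "(\<Sum>i\<in>I. a i) = real n"
      by (simp add: a_def n_def T_def I_def sum.If_cases Int_def)
    have pairs: "2 * (\<Sum>j\<in>I. \<Sum>i\<in>{1..<j}. a i * a j) = (real n)\<^sup>2 - real n"
      using sum_pairs_square[of a N] sum_a by (simp add: I_def a_def)
    have "n \<le> 2"
      unfolding n_def T_def I_def by (rule card_caps_le_2[OF contact _ x]) simp
    then consider "n = 0" | "n = 1" | "n = 2" by linarith
    moreover have "x \<in> V \<longleftrightarrow> n = 0"
      using True by (auto simp: V_def cell_def n_def T_def I_def not_less)
    \<comment> \<open>For \<open>n\<close> equal to 0, 1, 2 the expression
      \<open>1 - n + n (n - 1) / 2\<close> is 1, 0, 0; from \<open>n = 3\<close> on it would
      fail.\<close>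
    ultimately have "indicator V x = 1 - real n + ((real n)\<^sup>2 - real n) / 2"
      by cases auto
    moreover have "(\<Sum>i\<in>I. indicator (lens (w i) (w i)) x) = real n"
      unfolding lens sum_a[symmetric] by (intro sum.cong) (auto simp: a_def)
    ultimately show ?thesis
      using True pairs by (simp add: lens)
  next
    case False
    then have "indicator (lens p q) x = (0 :: real)" for p q
      by (auto simp: lens_def C_def indicator_def)
    with False show ?thesis
      by (simp add: V_def)
  qed
  have fin: "emeasure lborel C < \<infinity>"
    unfolding C_def by (rule emeasure_lborel_cball_finite)
  have V: "V \<in> sets borel"
  proof -
    have "V = C \<inter> (\<Inter>i\<in>I. {x. inner x (w i) \<le> 1})" by (auto simp: V_def cell_def)
    moreover have "closed (C \<inter> (\<Inter>i\<in>I. {x. inner x (w i) \<le> 1}))"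
      unfolding C_def by (intro closed_Int closed_INT ballI closed_Collect_le continuous_intros closed_cball)
    ultimately show ?thesis by simp
  qed
  have int: "integrable lborel (indicator (lens p q) :: _ \<Rightarrow> real)" for p q
    using emeasure_lens_finite[of p q] by (simp add: integrable_indicator_iff)
  have intC: "integrable lborel (indicator C :: _ \<Rightarrow> real)"
    using fin by (simp add: integrable_indicator_iff C_def)
  have "measure lborel V = (\<integral>x. indicator V x \<partial>lborel)"
    using V by simp
  also have "\<dots> = measure lborel C - (\<Sum>i\<in>I. measure lborel (lens (w i) (w i)))
      + (\<Sum>j\<in>I. \<Sum>i\<in>{1..<j}. measure lborel (lens (w i) (w j)))"
    unfolding ind by (simp add: int intC Bochner_Integration.integral_sum)
  also have "measure lborel C = 9/8 * pi\<^sup>2"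
  proof -
    have vol: "unit_ball_vol 4 = pi\<^sup>2 / 2"
      using unit_ball_vol_even[of 2] by (simp add: fact_numeral)
    have "sqrt (3/2) ^ 4 = (sqrt (3/2) ^ 2) ^ 2" by (simp only: power_mult[symmetric]) simp
    also have "\<dots> = 9/4" by (simp add: power2_eq_square)
    finally have "sqrt (3/2) ^ 4 = 9/4" .
    then show ?thesis
      by (simp add: C_def content_cball vol)
  qed
  also have "(\<Sum>i\<in>I. measure lborel (lens (w i) (w i))) = real N * (2 * J 0)"
    using norm by (simp add: measure_lens_same I_def)
  also have "(\<Sum>j\<in>I. \<Sum>i\<in>{1..<j}. measure lborel (lens (w i) (w j))) = weight_sum N w"
    unfolding weight_sum_def I_def using norm by (intro sum.cong refl lens_eq_omega) (auto simp: I_def)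
  finally show ?thesis
    by (simp add: V_def C_def I_def)
qed

section \<open>Closed form of \<open>A_star\<close>\<close>

text \<open>Identifies \<open>A_star\<close> as the volume of the ball less 23 single caps, the form
  in which \<open>measure_truncated_cell\<close> produces it.\<close>

lemma A_star_eq: "A_star = 9/8 * pi\<^sup>2 - 23 * (2 * J 0)"
proof -
  \<comment> \<open>Antiderivative by parts: the derivative of \<open>cap_area\<close> is
    \<open>4 pi sin^2\<close>, and \<open>4 pi sin^2 sec^4 = 4 pi tan^2 sec^2\<close> is the
    derivative of \<open>4 pi / 3 * tan^3\<close>.\<close>
  define \<Phi> where "\<Phi> r = 2 * pi\<^sup>2 * (1 / cos r) ^ 4 - 23 * (cap_area r * (1 / cos r) ^ 4 - 4 * pi / 3 * tan r ^ 3)" for r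
  have "((\<lambda>r. (2 * pi\<^sup>2 - 23 * cap_area r) * deriv (\<lambda>s. (1 / cos s) ^ 4) r) has_integral \<Phi> r_star - \<Phi> 0) {0..r_star}"
  proof (rule fundamental_theorem_of_calculus)
    show "0 \<le> r_star" using r_star by simp
    fix r assume r: "r \<in> {0..r_star}"
    then have c: "cos r > 0" by (intro cos_pos_r_star) auto
    have cap: "(cap_area has_real_derivative 4 * pi * (sin r)\<^sup>2) (at r)"
    proof -
      have "(cap_area has_real_derivative pi * (2 - 2 * cos (2 * r))) (at r)"
        unfolding cap_area_def[abs_def] by (auto intro!: derivative_eq_intros)
      also have "pi * (2 - 2 * cos (2 * r)) = 4 * pi * (sin r)\<^sup>2"
        by (simp only: cos_double_sin) (simp add: algebra_simps)
      finally show ?thesis .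
    qed
    have tan: "(tan has_real_derivative 1 / (cos r)\<^sup>2) (at r)"
      using c by (auto intro!: derivative_eq_intros simp: inverse_eq_divide)
    have sec: "((\<lambda>s. (1 / cos s) ^ 4) has_real_derivative 4 * sin r / cos r ^ 5) (at r)"
      using c by (intro DERIV_sec4) simp
    have tan3: "((\<lambda>r. tan r ^ 3) has_real_derivative 3 * (tan r)\<^sup>2 * (1 / (cos r)\<^sup>2)) (at r)"
      using DERIV_power[OF tan, of 3] by (simp add: mult_ac)
    have "(\<Phi> has_real_derivative
        2 * pi\<^sup>2 * (4 * sin r / cos r ^ 5) - 23 * ((4 * pi * (sin r)\<^sup>2) * (1 / cos r) ^ 4 + 4 * sin r / cos r ^ 5 * cap_area r
          - 4 * pi / 3 * (3 * (tan r)\<^sup>2 * (1 / (cos r)\<^sup>2)))) (at r)"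
      unfolding \<Phi>_def[abs_def]
      by (intro DERIV_diff DERIV_cmult DERIV_mult cap sec tan3)
    also have "(4 * pi * (sin r)\<^sup>2) * (1 / cos r) ^ 4 + 4 * sin r / cos r ^ 5 * cap_area r
          - 4 * pi / 3 * (3 * (tan r)\<^sup>2 * (1 / (cos r)\<^sup>2)) = 4 * sin r / cos r ^ 5 * cap_area r"
      using c by (simp add: tan_def power_divide field_simps power_numeral_reduce)
    also have "2 * pi\<^sup>2 * (4 * sin r / cos r ^ 5) - 23 * (4 * sin r / cos r ^ 5 * cap_area r)
        = (2 * pi\<^sup>2 - 23 * cap_area r) * deriv (\<lambda>s. (1 / cos s) ^ 4) r"
      using r by (simp add: deriv_sec4 algebra_simps)
    finally show "(\<Phi> has_vector_derivative (2 * pi\<^sup>2 - 23 * cap_area r) * deriv (\<lambda>s. (1 / cos s) ^ 4) r) (at r within {0..r_star})"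
      unfolding has_real_derivative_iff_has_vector_derivative by (rule has_vector_derivative_at_within)
  qed
  then have "integral_dsec4 (\<lambda>r. 2 * pi\<^sup>2 - 23 * cap_area r) = \<Phi> r_star - \<Phi> 0"
    unfolding integral_dsec4_def by (rule integral_unique)
  moreover have "\<Phi> 0 = 2 * pi\<^sup>2"
    by (simp add: \<Phi>_def cap_area_def)
  ultimately have A: "A_star = \<Phi> r_star / 4"
    by (simp add: A_star_def)
  have sec: "(1 / cos r_star) ^ 4 = 9/4"
  proof -
    have "(1 / cos r_star) ^ 4 = ((1 / cos r_star)\<^sup>2)\<^sup>2" by simp
    also have "(1 / cos r_star)\<^sup>2 = 3/2" by (simp add: r_star power_divide)
    finally show ?thesis by (simp add: power2_eq_square)
  qed
  have tan: "tan r_star = sqrt (1/2)"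
    by (simp add: tan_def r_star real_sqrt_divide)
  have at: "arctan (sqrt (1/2)) = r_star"
    unfolding tan[symmetric] using r_star by (intro arctan_tan) auto
  have cube: "sqrt (1/2) ^ 3 = sqrt (1/2) / 2"
    by (simp add: power3_eq_cube)
  have "sin (2 * r_star) = 4/3 * sqrt (1/2)"
  proof -
    have "sin (2 * r_star) = 2 * (tan r_star * cos r_star * cos r_star)"
      using r_star by (simp add: sin_double tan_def)
    also have "\<dots> = 4/3 * sqrt (1/2)"
      by (simp only: mult.assoc tan) (simp add: r_star)
    finally show ?thesis .
  qed
  then show ?thesis
    unfolding A \<Phi>_def sec tan cube J_def slope_primitive_def at cap_area_def
    by (simp add: field_simps power2_eq_square)
qed

section \<open>Rational bounds for \<open>arctan\<close> and \<open>pi\<close>\<close>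

definition arctan_sum :: "nat \<Rightarrow> real \<Rightarrow> real" where
  "arctan_sum m x = (\<Sum>k<m. (-1) ^ k * x ^ (2 * k + 1) / real (2 * k + 1))"

text \<open>The derivative of the partial sum is a finite geometric series, so the signed error has
  an explicit nonnegative derivative. This bounds \<open>arctan\<close> on both sides without any
  argument on alternating series.\<close>

lemma arctan_minus_sum_deriv:
  "((\<lambda>x. (-1) ^ m * (arctan x - arctan_sum m x)) has_real_derivative (x\<^sup>2) ^ m / (1 + x\<^sup>2)) (at x)"
proof -
  have nz: "1 + x\<^sup>2 \<noteq> 0"
    by (metis add_nonneg_eq_0_iff zero_le_one zero_le_power2 zero_neq_one)
  have summand: "((\<lambda>x. (-1) ^ k * x ^ (2 * k + 1) / real (2 * k + 1)) has_real_derivative (- x\<^sup>2) ^ k) (at x)" for k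
  proof -
    have "((\<lambda>x. x ^ (2 * k + 1)) has_real_derivative real (2 * k + 1) * x ^ (2 * k)) (at x)"
      using DERIV_pow[of "2 * k + 1" x] by simp
    then have "((\<lambda>x. (-1) ^ k * x ^ (2 * k + 1) / real (2 * k + 1)) has_real_derivative
        (-1) ^ k * (real (2 * k + 1) * x ^ (2 * k)) / real (2 * k + 1)) (at x)"
      by (intro DERIV_cdivide DERIV_cmult)
    also have "(-1) ^ k * (real (2 * k + 1) * x ^ (2 * k)) / real (2 * k + 1) = (- x\<^sup>2) ^ k"
      unfolding power_minus[of "x\<^sup>2"] power_mult by (simp del: of_nat_add of_nat_mult of_nat_Suc)
    finally show ?thesis .
  qed
  have "(arctan_sum m has_real_derivative (\<Sum>k<m. (- x\<^sup>2) ^ k)) (at x)"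
    unfolding arctan_sum_def[abs_def] by (rule DERIV_sum) (rule summand)
  also have "(\<Sum>k<m. (- x\<^sup>2) ^ k) = (1 - (- x\<^sup>2) ^ m) / (1 + x\<^sup>2)"
    using nz by (subst sum_gp_strict) auto
  finally have "(arctan_sum m has_real_derivative (1 - (- x\<^sup>2) ^ m) / (1 + x\<^sup>2)) (at x)" .
  then have "((\<lambda>x. (-1) ^ m * (arctan x - arctan_sum m x)) has_real_derivative
      (-1) ^ m * (inverse (1 + x\<^sup>2) - (1 - (- x\<^sup>2) ^ m) / (1 + x\<^sup>2))) (at x)"
    by (intro DERIV_cmult DERIV_diff DERIV_arctan)
  also have "(-1) ^ m * (inverse (1 + x\<^sup>2) - (1 - (- x\<^sup>2) ^ m) / (1 + x\<^sup>2)) = (-1) ^ m * (- x\<^sup>2) ^ m / (1 + x\<^sup>2)"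
    by (simp add: divide_inverse algebra_simps)
  also have "\<dots> = (x\<^sup>2) ^ m / (1 + x\<^sup>2)"
    by (simp add: power_mult_distrib[symmetric])
  finally show ?thesis .
qed

lemma arctan_sum_bound:
  assumes "0 \<le> x"
  shows "0 \<le> (-1) ^ m * (arctan x - arctan_sum m x)"
proof -
  have "(-1) ^ m * (arctan 0 - arctan_sum m 0) \<le> (-1) ^ m * (arctan x - arctan_sum m x)"
  proof (rule DERIV_nonneg_imp_nondecreasing[OF assms])
    fix y :: real
    have "0 \<le> (y\<^sup>2) ^ m / (1 + y\<^sup>2)" by simp
    then show "\<exists>d. ((\<lambda>x. (-1) ^ m * (arctan x - arctan_sum m x)) has_real_derivative d) (at y) \<and> 0 \<le> d"
      using arctan_minus_sum_deriv by blast
  qed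
  then show ?thesis
    by (simp add: arctan_sum_def)
qed

lemma arctan_ge_sum: "0 \<le> x \<Longrightarrow> even m \<Longrightarrow> arctan_sum m x \<le> arctan x"
  using arctan_sum_bound[of x m] by simp

lemma arctan_le_sum: "0 \<le> x \<Longrightarrow> odd m \<Longrightarrow> arctan x \<le> arctan_sum m x"
  using arctan_sum_bound[of x m] by simp

lemma pi_lower: "3.141592653589793238 \<le> pi"
proof -
  \<comment> \<open>In Machin's formula the second arctangent is subtracted, hence a lower bound
    (even number of terms) for the first and an upper bound (odd number) for the second.\<close>
  have "arctan_sum 14 (1/5) \<le> arctan (1/5)" "arctan (1/239) \<le> arctan_sum 5 (1/239)"
    by (intro arctan_ge_sum arctan_le_sum; simp)+
  moreover have "3.141592653589793238 \<le> 4 * (4 * arctan_sum 14 (1/5) - arctan_sum 5 (1/239))"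
    unfolding arctan_sum_def by (simp add: lessThan_nat_numeral power_divide)
  ultimately show ?thesis
    using machin by simp
qed

lemma pi_upper: "pi \<le> 3.141592653589793239"
proof -
  have "arctan (1/5) \<le> arctan_sum 15 (1/5)" "arctan_sum 4 (1/239) \<le> arctan (1/239)"
    by (intro arctan_ge_sum arctan_le_sum; simp)+
  moreover have "4 * (4 * arctan_sum 15 (1/5) - arctan_sum 4 (1/239)) \<le> 3.141592653589793239"
    unfolding arctan_sum_def by (simp add: lessThan_nat_numeral power_divide)
  ultimately show ?thesis
    using machin by simp
qed

text \<open>With one factor \<open>sqrt (1/2)\<close> split off, the partial sums at
  \<open>sqrt (1/2)\<close> are rational. The powers only halve from term to term, which is why more
  than fifty terms are needed for 18 digits.\<close>

definition arctan_half_sum :: "nat \<Rightarrow> real" where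
  "arctan_half_sum m = (\<Sum>k<m. (-1) ^ k / (2 ^ k * real (2 * k + 1)))"

lemma arctan_sum_half: "arctan_sum m (sqrt (1/2)) = sqrt (1/2) * arctan_half_sum m"
proof -
  have "(-1) ^ k * sqrt (1/2) ^ (2 * k + 1) / real (2 * k + 1)
      = sqrt (1/2) * ((-1) ^ k / (2 ^ k * real (2 * k + 1)))" for k
    by (simp add: power_mult power_divide real_sqrt_divide)
  then show ?thesis
    unfolding arctan_sum_def arctan_half_sum_def sum_distrib_left by simp
qed

lemma half_sum_lower: "0.870419751367103197 \<le> arctan_half_sum 56"
  unfolding arctan_half_sum_def by (simp add: lessThan_nat_numeral)

lemma half_sum_upper: "arctan_half_sum 57 \<le> 0.870419751367103198"
  unfolding arctan_half_sum_def by (simp add: lessThan_nat_numeral)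

section \<open>A polynomial lower bound for the weight\<close>

text \<open>Horner's scheme with a fractional argument. The second component is the power of
  \<open>d (1 + x)\<close> needed to clear denominators; the first falls short of
  \<open>p(y)\<close> times that power by one factor \<open>d (1 + x)\<close>.\<close>

fun bern :: "int list \<Rightarrow> int \<Rightarrow> int \<Rightarrow> int \<Rightarrow> int list \<times> int list" where
  "bern [] a b d = ([], [1])"
| "bern (c # p) a b d =
    (case bern p a b d of (q, e) \<Rightarrow> (add1 (mul1 [a, b] q) (scl1 c e), mul1 [d, d] e))"

definition bern_nonneg :: "int list \<Rightarrow> int \<Rightarrow> int \<Rightarrow> int \<Rightarrow> bool" where
  "bern_nonneg p a b d \<longleftrightarrow> list_all (\<lambda>c. 0 \<le> c) (fst (bern p a b d))"

text \<open>The substitution \<open>y = (a + b x) / (d (1 + x))\<close> maps \<open>x \<ge> 0\<close> onto \<open>[a/d, b/d)\<close> and turns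
  \<open>p\<close> into a polynomial in \<open>x\<close> whose coefficients are, up to positive factors, the Bernstein
  coefficients of \<open>p\<close> on that interval.\<close>

lemma bern_eq:
  fixes x :: real and p :: "int list" and a b d :: int
  assumes "d > 0" "x \<ge> 0"
  defines "y \<equiv> (a + b * x) / (d * (1 + x))"
  shows "ev1 (fst (bern p a b d)) x * (d * (1 + x)) = ev1 (snd (bern p a b d)) x * ev1 p y"
    and "ev1 (snd (bern p a b d)) x > 0"
proof (induction p)
  case (Cons c p)
  have D: "real_of_int d * (1 + x) > 0"
    using assms by simp
  then have y: "a + b * x = y * (d * (1 + x))"
    using assms(1,2) nonzero_divide_eq_eq[of "d * (1 + x)" "a + b * x" y] by (simp only: y_def[symmetric]) auto
  obtain q e where qe: "bern p a b d = (q, e)"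
    by (cases "bern p a b d")
  {
    case 1
    have "ev1 (fst (bern (c # p) a b d)) x * (d * (1 + x))
        = (a + b * x) * (ev1 q x * (d * (1 + x))) + c * ev1 e x * (d * (1 + x))"
      by (simp add: qe algebra_simps)
    also have "\<dots> = (d * (1 + x)) * ev1 e x * (c + y * ev1 p y)"
      using Cons(1) unfolding y by (simp add: qe algebra_simps)
    finally show ?case
      by (simp add: qe algebra_simps)
  next
    case 2
    have "ev1 (snd (bern (c # p) a b d)) x = (d * (1 + x)) * ev1 e x"
      by (simp add: qe algebra_simps)
    then show ?case
      using Cons(2) D by (simp add: qe)
  }
qed auto

lemma ev1_nonneg: "list_all (\<lambda>c. 0 \<le> c) p \<Longrightarrow> 0 \<le> x \<Longrightarrow> 0 \<le> ev1 p x"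
  by (induction p) auto

lemma bern_nonneg_left:
  fixes u :: real
  assumes "bern_nonneg p a b d" "d > 0" "a / d \<le> u" "u < b / d"
  shows "0 \<le> ev1 p u"
proof -
  define x where "x = (u * d - a) / (b - u * d)"
  have le: "a \<le> u * d" "u * d < b"
    using assms(2-4) by (auto simp: field_simps)
  then have x: "x \<ge> 0"
    by (simp add: x_def)
  have "1 + x = (b - a) / (b - u * d)"
    using le by (simp add: x_def field_simps)
  moreover have "a + b * x = u * d * ((b - a) / (b - u * d))"
    using le by (simp add: x_def field_simps)
  ultimately have "(a + b * x) / (d * (1 + x)) = u"
    using le assms(2) by simp
  then have "ev1 (snd (bern p a b d)) x * ev1 p u = ev1 (fst (bern p a b d)) x * (d * (1 + x))"
    using bern_eq(1)[OF assms(2) x, of p a b] by simp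
  also have "\<dots> \<ge> 0"
    using assms(1,2) x by (intro mult_nonneg_nonneg ev1_nonneg) (auto simp: bern_nonneg_def)
  finally show ?thesis
    using bern_eq(2)[OF assms(2) x, of p a b] by (simp add: zero_le_mult_iff)
qed

lemma bern_nonneg_right:
  fixes u :: real
  assumes "bern_nonneg p b a d" "d > 0" "a / d < u" "u \<le> b / d"
  shows "0 \<le> ev1 p u"
proof -
  define x where "x = (b - u * d) / (u * d - a)"
  have le: "a < u * d" "u * d \<le> b"
    using assms(2-4) by (auto simp: field_simps)
  then have x: "x \<ge> 0"
    by (simp add: x_def)
  have "1 + x = (b - a) / (u * d - a)"
    using le by (simp add: x_def field_simps)
  moreover have "b + a * x = u * d * ((b - a) / (u * d - a))"
    using le by (simp add: x_def field_simps)
  ultimately have "(b + a * x) / (d * (1 + x)) = u"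
    using le assms(2) by simp
  then have "ev1 (snd (bern p b a d)) x * ev1 p u = ev1 (fst (bern p b a d)) x * (d * (1 + x))"
    using bern_eq(1)[OF assms(2) x, of p b a] by simp
  also have "\<dots> \<ge> 0"
    using assms(1,2) x by (intro mult_nonneg_nonneg ev1_nonneg) (auto simp: bern_nonneg_def)
  finally show ?thesis
    using bern_eq(2)[OF assms(2) x, of p b a] by (simp add: zero_le_mult_iff)
qed

text \<open>The rational substitution misses one endpoint of the interval; the reversed order of
  \<open>a\<close> and \<open>b\<close> covers it.\<close>

definition nonneg_on :: "int list \<Rightarrow> int \<Rightarrow> int \<Rightarrow> int \<Rightarrow> bool" where
  "nonneg_on p a b d \<longleftrightarrow> d > 0 \<and> a < b \<and> bern_nonneg p a b d \<and> bern_nonneg p b a d"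

lemma ev1_nonneg_on:
  assumes "nonneg_on p a b d" "a / d \<le> u" "u \<le> b / d"
  shows "0 \<le> ev1 p u"
proof (cases "u < b / d")
  case True
  then show ?thesis
    using assms bern_nonneg_left by (auto simp: nonneg_on_def)
next
  case False
  then have "a / d < u"
    using assms divide_strict_right_mono[of a b "real_of_int d"] by (auto simp: nonneg_on_def)
  then show ?thesis
    using assms bern_nonneg_right by (auto simp: nonneg_on_def)
qed

text \<open>\<open>30000 / ((1 + u)\<^sup>2 * sqrt (1 - u\<^sup>2))\<close> is bounded below by this quadratic polynomial, nearly
  its Taylor polynomial at \<open>0.47\<close>.\<close>

definition slope_quad :: "int list" where
  "slope_quad = [27389, -37713, 27450]"

text \<open>Squaring removes the root, since \<open>(1 + u)^4 (1 - u^2) = (1 - u) (1 + u)^5\<close>.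
  The interval is given as [2/6, 3/6].\<close>

lemma slope_quad_check:
  "nonneg_on (add1 [30000\<^sup>2] (scl1 (-1) (mul1 (mul1 slope_quad slope_quad)
     (mul1 [1, -1] (mul1 [1, 1] (mul1 [1, 1] (mul1 [1, 1] (mul1 [1, 1] [1, 1])))))))) 2 3 6"
  by code_simp

text \<open>\<open>576000000000\<close> times the antiderivative of \<open>3.14159 / 16 * (3 * x - 1)\<^sup>2 * slope_quad / 30000\<close>
  that vanishes at \<open>1/3\<close>.\<close>

definition omega_poly :: "int list" where
  "omega_poly = [-10283994865, 103254010212, -380849300838, 628605769644, -475118677809, 186271154280]"

lemma slope_quad_le:
  assumes "1/3 \<le> u" "u \<le> 1/2"
  shows "ev1 slope_quad u / 30000 \<le> 1 / ((1 + u)\<^sup>2 * sqrt (1 - u\<^sup>2))"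
proof -
  define s where "s = ev1 slope_quad u"
  have "0 \<le> 30000\<^sup>2 - s * s * ((1 - u) * (1 + u) ^ 5)"
    using ev1_nonneg_on[OF slope_quad_check, of u] assms by (simp add: s_def algebra_simps power_numeral_reduce)
  also have "s * s * ((1 - u) * (1 + u) ^ 5) = (s * ((1 + u)\<^sup>2 * sqrt (1 - u\<^sup>2)))\<^sup>2"
  proof -
    have "u\<^sup>2 \<le> 1" using assms by (simp add: power_le_one)
    then have "(sqrt (1 - u\<^sup>2))\<^sup>2 = (1 - u) * (1 + u)"
      by (simp add: power2_eq_square algebra_simps)
    then show ?thesis
      unfolding power_mult_distrib by (simp add: power_numeral_reduce mult_ac)
  qed
  finally have "(s * ((1 + u)\<^sup>2 * sqrt (1 - u\<^sup>2)))\<^sup>2 \<le> 30000\<^sup>2"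
    by simp
  then have "s * ((1 + u)\<^sup>2 * sqrt (1 - u\<^sup>2)) \<le> 30000"
    by (rule power2_le_imp_le) simp
  moreover have "0 < (1 + u)\<^sup>2 * sqrt (1 - u\<^sup>2)"
    using assms by (simp add: power2_less_1_iff)
  ultimately show ?thesis
    by (simp add: s_def field_simps)
qed

text \<open>Both sides vanish at 1/3, where the lens degenerates, so it suffices to compare
  derivatives. That of the weight is
  \<open>pi / 16 * (3 x - 1)^2 / ((1 + x)^2 sqrt (1 - x^2))\<close>; the polynomial results from
  replacing \<open>pi\<close> and the last factor by lower bounds.\<close>

lemma omega_ge_poly:
  assumes "1/3 \<le> u" "u \<le> 1/2"
  shows "ev1 omega_poly u / 576000000000 \<le> \<omega> u"
proof -
  define g where "g u = 2 * J ((1 - u) / sqrt (1 - u\<^sup>2)) - ev1 omega_poly u / 576000000000" for u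
  have "g (1/3) \<le> g u"
  proof (rule DERIV_nonneg_imp_nondecreasing[OF assms(1)])
    fix x :: real assume "1/3 \<le> x" "x \<le> u"
    then have x: "1/3 \<le> x" "x \<le> 1/2" using assms by auto
    then have x2: "x\<^sup>2 < 1" by (simp add: power2_less_1_iff)
    define s where "s = sqrt (1 - x\<^sup>2)"
    have s: "s > 0" "s\<^sup>2 = 1 - x\<^sup>2" using x2 by (simp_all add: s_def)
    define m where "m = (1 - x) / s"
    have m2: "m\<^sup>2 = (1 - x) / (1 + x)"
    proof -
      have "1 - x\<^sup>2 = (1 - x) * (1 + x)" by (simp add: power2_eq_square algebra_simps)
      then have "m\<^sup>2 = (1 - x)\<^sup>2 / ((1 - x) * (1 + x))"
        unfolding m_def power_divide s(2) by simp
      then show ?thesis using x by (simp add: power2_eq_square)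
    qed
    have dJ: "(J has_real_derivative - (pi / 4 * ((1/2 - m\<^sup>2)\<^sup>2 / (1 + m\<^sup>2)))) (at m)"
    proof -
      have nz: "1 + m\<^sup>2 \<noteq> 0"
        by (metis add_nonneg_eq_0_iff zero_le_one zero_le_power2 zero_neq_one)
      have "(J has_real_derivative pi / 4 * (0 - (3 * m\<^sup>2 / 3 - 2 + 9/4 * inverse (1 + m\<^sup>2)))) (at m)"
        unfolding J_def[abs_def] slope_primitive_def by (auto intro!: derivative_eq_intros)
      also have "0 - (3 * m\<^sup>2 / 3 - 2 + 9/4 * inverse (1 + m\<^sup>2)) = - ((1/2 - m\<^sup>2)\<^sup>2 / (1 + m\<^sup>2))"
        using nz by (simp add: field_simps power2_eq_square)
      finally show ?thesis by simp
    qed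
    have dsqrt: "((\<lambda>x. sqrt (1 - x\<^sup>2)) has_real_derivative - x / s) (at x)"
      using x2 by (auto intro!: derivative_eq_intros simp: s_def field_simps)
    have dm: "((\<lambda>x. (1 - x) / sqrt (1 - x\<^sup>2)) has_real_derivative - 1 / ((1 + x) * s)) (at x)"
    proof -
      have "((\<lambda>x. (1 - x) / sqrt (1 - x\<^sup>2)) has_real_derivative ((0 - 1) * s - (1 - x) * (- x / s)) / (s * s)) (at x)"
        using s(1) unfolding s_def by (intro DERIV_divide DERIV_diff DERIV_const DERIV_ident dsqrt[unfolded s_def]) simp
      also have "((0 - 1) * s - (1 - x) * (- x / s)) / (s * s) = ((1 - x) * x - s\<^sup>2) / (s * s\<^sup>2)"
        using s(1) by (simp add: field_simps power2_eq_square)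
      also have "\<dots> = - 1 / ((1 + x) * s)"
      proof -
        have "s\<^sup>2 = (1 - x) * (1 + x)" "(1 - x) * x - s\<^sup>2 = (1 - x) * (- 1)"
          unfolding s(2) by (simp_all add: power2_eq_square algebra_simps)
        then have "((1 - x) * x - s\<^sup>2) / (s * s\<^sup>2) = ((1 - x) * (- 1)) / ((1 - x) * ((1 + x) * s))"
          by (simp only: mult_ac)
        also have "\<dots> = - 1 / ((1 + x) * s)"
          by (rule mult_divide_mult_cancel_left) (use x in simp)
        finally show ?thesis .
      qed
      finally show ?thesis .
    qed
    have "(g has_real_derivative 2 * (- (pi / 4 * ((1/2 - m\<^sup>2)\<^sup>2 / (1 + m\<^sup>2))) * (- 1 / ((1 + x) * s)))
        - 3.14159 / 16 * (3 * x - 1)\<^sup>2 * (ev1 slope_quad x / 30000)) (at x)"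
      unfolding g_def[abs_def]
    proof (rule DERIV_diff)
      show "((\<lambda>u. 2 * J ((1 - u) / sqrt (1 - u\<^sup>2))) has_real_derivative
          2 * (- (pi / 4 * ((1/2 - m\<^sup>2)\<^sup>2 / (1 + m\<^sup>2))) * (- 1 / ((1 + x) * s)))) (at x)"
        by (intro DERIV_cmult DERIV_chain2[OF _ dm]) (use dJ in \<open>simp add: m_def s_def\<close>)
      show "((\<lambda>u. ev1 omega_poly u / 576000000000) has_real_derivative
          3.14159 / 16 * (3 * x - 1)\<^sup>2 * (ev1 slope_quad x / 30000)) (at x)"
        unfolding omega_poly_def slope_quad_def
        by (auto intro!: derivative_eq_intros simp: field_simps power2_eq_square)
    qed
    moreover have "2 * (- (pi / 4 * ((1/2 - m\<^sup>2)\<^sup>2 / (1 + m\<^sup>2))) * (- 1 / ((1 + x) * s)))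
        = pi / 16 * (3 * x - 1)\<^sup>2 * (1 / ((1 + x)\<^sup>2 * s))"
    proof -
      have "(1/2 - m\<^sup>2)\<^sup>2 / (1 + m\<^sup>2) = (3 * x - 1)\<^sup>2 / (8 * (1 + x))"
      proof -
        have "(p / (2 * q))\<^sup>2 / (2 / q) = p\<^sup>2 / (8 * q)" for p q :: real
          by (simp add: power2_eq_square)
        moreover have "1/2 - m\<^sup>2 = (3 * x - 1) / (2 * (1 + x))" "1 + m\<^sup>2 = 2 / (1 + x)"
          using x unfolding m2 by (simp_all add: field_simps)
        ultimately show ?thesis
          by (simp only:)
      qed
      moreover have "2 * (- (pi / 4 * (p / (8 * q))) * (- 1 / (q * s))) = pi / 16 * p * (1 / (q\<^sup>2 * s))" for p q :: real
        by (simp add: power2_eq_square)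
      ultimately show ?thesis
        by (simp only:)
    qed
    moreover have "3.14159 / 16 * (3 * x - 1)\<^sup>2 * (ev1 slope_quad x / 30000)
        \<le> pi / 16 * (3 * x - 1)\<^sup>2 * (1 / ((1 + x)\<^sup>2 * s))"
    proof -
      have "3.14159 / 16 * (3 * x - 1)\<^sup>2 * (ev1 slope_quad x / 30000)
          \<le> 3.14159 / 16 * (3 * x - 1)\<^sup>2 * (1 / ((1 + x)\<^sup>2 * s))"
        unfolding s_def by (intro mult_left_mono slope_quad_le x) auto
      also have "\<dots> \<le> pi / 16 * (3 * x - 1)\<^sup>2 * (1 / ((1 + x)\<^sup>2 * s))"
        using pi_lower s x by (intro mult_right_mono) auto
      finally show ?thesis .
    qed
    ultimately show "\<exists>d. (g has_real_derivative d) (at x) \<and> 0 \<le> d"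
      by (intro exI conjI) auto
  qed
  moreover have "g (1/3) = 0"
  proof -
    have "(1 - 1/3) / sqrt (1 - (1/3)\<^sup>2) = sqrt (1/2)"
    proof -
      have "((1 - 1/3) / sqrt (1 - (1/3)\<^sup>2))\<^sup>2 = (1/2 :: real)"
        by (simp add: power_divide)
      then show ?thesis
        by (intro real_sqrt_unique[symmetric]) (auto simp: power_divide)
    qed
    then have "J ((1 - 1/3) / sqrt (1 - (1/3)\<^sup>2)) = 0"
      by (simp only: J_def) simp
    moreover have "ev1 omega_poly (1/3) = 0"
      by (simp add: omega_poly_def)
    ultimately show ?thesis
      by (simp only: g_def)
  qed
  ultimately show ?thesis
    using omega_eq_J[of u] assms by (simp add: g_def)
qed

section \<open>The certificate for pairs\<close>

fun square_sum :: "int list list \<Rightarrow> int list" where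
  "square_sum [] = []"
| "square_sum (r # rs) = add1 (mul1 (cheb_comb r [1] [0, 1]) (cheb_comb r [1] [0, 1])) (square_sum rs)"

text \<open>The first argument of the kernel is set to 1, where every Chebyshev polynomial is 1; a
  row then takes the sum of its entries.\<close>

fun pole_poly :: "int list list \<Rightarrow> int list" where
  "pole_poly [] = []"
| "pole_poly (r # rs) = add1 (scl1 (sum_list r) (cheb_comb r [1] [0, 1])) (pole_poly rs)"

text \<open>The parameters \<open>f\<close> and \<open>p\<close> accumulate \<open>k!\<close> and
  \<open>(1 - u^2)^k\<close>, the value of \<open>leg_poly k\<close> at
  \<open>(u, u, 1)\<close>.\<close>

fun diag_poly :: "int \<Rightarrow> int \<Rightarrow> int list \<Rightarrow> int list list list \<Rightarrow> int list" where
  "diag_poly k f p [] = []"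
| "diag_poly k f p (rs # rss) =
     add1 (scl1 f (mul1 p (square_sum rs))) (diag_poly (k + 1) (f * (k + 1)) (mul1 p [1, 0, -1]) rss)"

fun chebU_sum :: "nat \<Rightarrow> int list" where
  "chebU_sum 0 = []"
| "chebU_sum (Suc k) = add1 (chebU1 (Suc k)) (chebU_sum k)"

definition pair_poly :: "int list" where
  "pair_poly =
     add1 [63 * 210329492829] (add1 (scl1 (63 * 2 ^ 16) (chebU_sum 8)) (add1 (scl1 (63 * 2 ^ 24) h_coeffs)
       (scl1 256 (add1 (scl1 2 (pole_poly (hd kernel_coeffs))) (diag_poly 0 1 [1] kernel_coeffs)))))"

text \<open>Subdivision brings the Bernstein coefficients to one sign. Up to 1/3 the polynomial is
  nonpositive and the weight nonnegative. Beyond, it is compared with \<open>omega_poly\<close>; the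
  multipliers reconcile the denominators, as
  \<open>117440512 / 15625 = 63000 * 2 ^ 36 / 576000000000\<close>.\<close>

definition pair_check :: "int list \<Rightarrow> bool" where
  "pair_check p \<longleftrightarrow>
     nonneg_on (scl1 (-1) p) (-2) (-1) 2 \<and> nonneg_on (scl1 (-1) p) (-1) 0 2 \<and> nonneg_on (scl1 (-1) p) 0 1 3 \<and>
     nonneg_on (add1 (scl1 117440512 omega_poly) (scl1 (-15625) p)) 4 5 12 \<and>
     nonneg_on (add1 (scl1 117440512 omega_poly) (scl1 (-15625) p)) 5 6 12"

lemma pair_check_pair_poly: "pair_check pair_poly"
  by code_simp

text \<open>The value of \<open>kernel_fun\<close> at (1, 1, 1), where only the summand
  \<open>k = 0\<close> survives; it enters \<open>bound_B\<close>.\<close>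

lemma pole_sum_check: "sum_list (map (\<lambda>r. sum_list r * sum_list r) (hd kernel_coeffs)) = 1002121336437"
  by code_simp

text \<open>For \<open>k > 0\<close> the factor \<open>k + 1\<close> cancels the denominator of
  \<open>G_poly k\<close>, so \<open>f\<close> is a constant plus a tiny multiple of the sum of the
  polynomials \<open>U_1\<close>, ..., \<open>U_8\<close>.\<close>

definition f_coeff :: "nat \<Rightarrow> real" where
  "f_coeff k = (if k = 0 then 210329492829 / (1000 * 2 ^ 36) else real (k + 1) / (1000 * 2 ^ 20))"

lemma poly_chebyshev_T_1: "poly (chebyshev_T n) 1 = 1"
  using poly_chebyshev_T_cos[of n 0] by simp

lemma poly_chebyshev_U_1: "poly (chebyshev_U n) 1 = real (n + 1)"
  by (induction n rule: chebyshev_U.induct) auto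

lemma cheb_sum_1: "cheb_sum r 1 = sum_list r"
  unfolding cheb_sum_def sum_list_sum_nth of_int_sum atLeast0LessThan by (simp add: poly_chebyshev_T_1)

lemma ev1_square_sum: "ev1 (square_sum rs) u = kernel_sum rs u u"
  by (induction rs) (auto simp: kernel_sum_def ev1_cheb_comb_eq)

lemma ev1_pole_poly: "ev1 (pole_poly rs) u = kernel_sum rs 1 u"
  by (induction rs) (auto simp: kernel_sum_def ev1_cheb_comb_eq cheb_sum_1)

lemma ev1_diag_poly:
  assumes "\<And>u. ev1 p u = (1 - u\<^sup>2) ^ k"
  shows "ev1 (diag_poly (int k) (fact k) p rss) u
    = (\<Sum>i<length rss. fact (k + i) * kernel_sum (rss ! i) u u * (1 - u\<^sup>2) ^ (k + i))"
  using assms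
proof (induction rss arbitrary: k p)
  case (Cons rs rss)
  have fact: "int k + 1 = int (Suc k)" "(fact k :: int) * int (Suc k) = fact (Suc k)"
    by simp_all
  have "ev1 (diag_poly (int (Suc k)) (fact (Suc k)) (mul1 p [1, 0, -1]) rss) u
      = (\<Sum>i<length rss. fact (Suc k + i) * kernel_sum (rss ! i) u u * (1 - u\<^sup>2) ^ (Suc k + i))"
    by (rule Cons.IH) (simp add: Cons.prems power2_eq_square algebra_simps)
  then show ?case
    unfolding diag_poly.simps fact
    by (simp add: ev1_square_sum Cons.prems lessThan_Suc_eq_insert_0 sum.reindex mult_ac
        del: sum.lessThan_Suc fact_Suc of_nat_Suc)
qed auto

lemma ev1_chebU_sum: "ev1 (chebU_sum n) u = (\<Sum>k\<in>{1..n}. poly (chebyshev_U k) u)"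
  by (induction n) (auto simp: ev1_chebU1)

lemma kernel_sum_swap: "kernel_sum rs u v = kernel_sum rs v u"
  by (simp add: kernel_sum_def mult.commute)

text \<open>When one of the two points coincides with the pole, its projection vanishes and with it
  every summand with \<open>k > 0\<close>.\<close>

lemma kernel_fun_pole:
  "kernel_fun 1 u u = kernel_sum (kernel_coeffs ! 0) 1 u"
  "kernel_fun u 1 u = kernel_sum (kernel_coeffs ! 0) 1 u"
proof -
  have "kernel_fun 1 u u = (\<Sum>k\<in>{0}. fact k * kernel_sum (kernel_coeffs ! k) 1 u * homog_legendre k 1 u u)"
    unfolding kernel_fun_def by (rule sum.mono_neutral_right) (auto simp: homog_legendre_one)
  then show 1: "kernel_fun 1 u u = kernel_sum (kernel_coeffs ! 0) 1 u"
    by simp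
  have "kernel_fun u 1 u = kernel_fun 1 u u"
    unfolding kernel_fun_def by (simp add: kernel_sum_swap[of _ u] homog_legendre_swap[of _ u])
  with 1 show "kernel_fun u 1 u = kernel_sum (kernel_coeffs ! 0) 1 u"
    by simp
qed

lemma kernel_fun_diag: "kernel_fun u u 1 = ev1 (diag_poly 0 1 [1] kernel_coeffs) u"
proof -
  have "ev1 (diag_poly 0 1 [1] kernel_coeffs) u
      = (\<Sum>i<9. fact i * kernel_sum (kernel_coeffs ! i) u u * (1 - u\<^sup>2) ^ i)"
    using ev1_diag_poly[of "[1]" 0 kernel_coeffs u] by (simp add: kernel_coeffs_shape(1))
  then show ?thesis
    by (simp add: kernel_fun_def homog_legendre_diag)
qed

lemma three_point_swap:
  "three_point 8 kernel_mat u 1 v = three_point 8 kernel_mat 1 u v"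
  "three_point 8 kernel_mat u v 1 = three_point 8 kernel_mat 1 u v"
  by (simp_all add: three_point_kernel sym_sum_def)

lemma two_point_f: "two_point 8 f_coeff u = (210329492829 / 2 ^ 36 + ev1 (chebU_sum 8) u / 2 ^ 20) / 1000"
proof -
  have "two_point 8 f_coeff u = (\<Sum>k\<le>8. f_coeff k / real (k + 1) * poly (chebyshev_U k) u)"
    by (simp add: two_point_def G_poly_def poly_sum)
  also have "\<dots> = f_coeff 0 + (\<Sum>k\<in>{1..8}. f_coeff k / real (k + 1) * poly (chebyshev_U k) u)"
    by (subst sum.atMost_shift) (simp add: sum.atLeast1_atMost_eq)
  also have "(\<Sum>k\<in>{1..8}. f_coeff k / real (k + 1) * poly (chebyshev_U k) u)
      = (\<Sum>k\<in>{1..8}. poly (chebyshev_U k) u / (1000 * 2 ^ 20))"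
    by (intro sum.cong) (auto simp: f_coeff_def simp del: of_nat_Suc of_nat_add)
  also have "f_coeff 0 = 210329492829 / (1000 * 2 ^ 36)"
    by (simp add: f_coeff_def)
  finally show ?thesis
    unfolding ev1_chebU_sum sum_divide_distrib[symmetric] by (simp only: add_divide_distrib) simp
qed

lemma pair_poly_eq:
  "two_point 8 f_coeff u + three_point 8 kernel_mat 1 u u / 21 + h_fun u = ev1 pair_poly u / (63000 * 2 ^ 36)"
proof -
  have "hd kernel_coeffs = kernel_coeffs ! 0"
    using kernel_coeffs_shape(1) by (intro hd_conv_nth) auto
  \<comment> \<open>Of the six arrangements of \<open>(1, u, u)\<close>, four have the 1 in one of
    the first two places, where a point meets the pole, and two have it last.\<close>
  then have "three_point 8 kernel_mat 1 u u
      = (4 * ev1 (pole_poly (hd kernel_coeffs)) u + 2 * ev1 (diag_poly 0 1 [1] kernel_coeffs) u) / (6000 * 2 ^ 28)"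
    by (simp add: three_point_kernel sym_sum_def kernel_fun_pole kernel_fun_diag ev1_pole_poly)
  then show ?thesis
    unfolding two_point_f h_fun_def pair_poly_def by (simp add: field_simps)
qed

lemma pair_le_omega:
  assumes "-1 \<le> u" "u \<le> 1/2"
  shows "two_point 8 f_coeff u + three_point 8 kernel_mat 1 u u / 21 + h_fun u \<le> \<omega> u"
proof -
  note check = pair_check_pair_poly[unfolded pair_check_def]
  have neg: ?thesis if "nonneg_on (scl1 (-1) pair_poly) a b d" "a / d \<le> u" "u \<le> b / d" for a b d :: int
    unfolding pair_poly_eq using ev1_nonneg_on[OF that] omega_nonneg[of u] by simp
  have pos: ?thesis
    if "nonneg_on (add1 (scl1 117440512 omega_poly) (scl1 (-15625) pair_poly)) a b d"
      "a / d \<le> u" "u \<le> b / d" "1/3 \<le> u" for a b d :: int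
    unfolding pair_poly_eq using ev1_nonneg_on[OF that(1-3)] omega_ge_poly[OF that(4) assms(2)] by simp
  consider "u \<le> -1/2" | "-1/2 \<le> u" "u \<le> 0" | "0 \<le> u" "u \<le> 1/3" | "1/3 \<le> u" "u \<le> 5/12" | "5/12 \<le> u"
    by linarith
  then show ?thesis
  proof cases
    case 1
    then show ?thesis
      using assms check by (intro neg[of "-2" "-1" 2]) auto
  next
    case 2
    then show ?thesis
      using check by (intro neg[of "-1" 0 2]) auto
  next
    case 3
    then show ?thesis
      using check by (intro neg[of 0 1 3]) auto
  next
    case 4
    then show ?thesis
      using check by (intro pos[of 4 5 12]) auto
  next
    case 5
    then show ?thesis
      using check assms by (intro pos[of 5 6 12]) auto
  qed
qed

lemma triple_inequality:
  assumes "u \<in> {-1..1/2}" "v \<in> {-1..1/2}" "t \<in> {-1..1/2}"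
  shows "\<omega> u + \<omega> v + \<omega> t - two_point 8 f_coeff u - two_point 8 f_coeff v - two_point 8 f_coeff t
    - three_point 8 kernel_mat u v t
    - (three_point 8 kernel_mat 1 u u + three_point 8 kernel_mat 1 v v + three_point 8 kernel_mat 1 t t) / (real 23 - 2) \<ge> 0"
proof -
  have pair: "two_point 8 f_coeff x + three_point 8 kernel_mat 1 x x / 21 + h_fun x \<le> \<omega> x"
    if "x \<in> {-1..1/2}" for x
    using that by (intro pair_le_omega) auto
  have "real 23 - 2 = 21" by simp
  then show ?thesis
    using three_point_le_h[OF assms] pair[OF assms(1)] pair[OF assms(2)] pair[OF assms(3)]
    by (simp only: add_divide_distrib)
qed

lemma bound_B_eq:
  "bound_B 23 8 f_coeff kernel_mat = (23 / 2 * (22 * (210329492829 / 2 ^ 36) - 44 / 2 ^ 20) - 23 / 126 * (1002121336437 / 2 ^ 28)) / 1000"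
proof -
  have "hd kernel_coeffs = kernel_coeffs ! 0"
    using kernel_coeffs_shape(1) by (intro hd_conv_nth) auto
  moreover have "kernel_sum rs 1 1 = real_of_int (sum_list (map (\<lambda>r. sum_list r * sum_list r) rs))" for rs
    by (induction rs) (auto simp: kernel_sum_def cheb_sum_1)
  ultimately have "kernel_fun 1 1 1 = 1002121336437"
    using pole_sum_check by (simp add: kernel_fun_pole)
  then have three: "three_point 8 kernel_mat 1 1 1 = 1002121336437 / (1000 * 2 ^ 28)"
    by (simp add: three_point_kernel sym_sum_def)
  have "ev1 (chebU_sum 8) 1 = 44"
    by (simp add: ev1_chebU_sum poly_chebyshev_U_1 sum.atLeast1_atMost_eq numeral_eq_Suc)
  then have two: "two_point 8 f_coeff 1 = (210329492829 / 2 ^ 36 + 44 / 2 ^ 20) / 1000"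
    by (simp add: two_point_f)
  show ?thesis
    unfolding bound_B_def three two by (simp add: f_coeff_def)
qed

lemma bound_B_bounds:
  "0.0929000002 \<le> bound_B 23 8 f_coeff kernel_mat" "bound_B 23 8 f_coeff kernel_mat < 0.0929000003"
  unfolding bound_B_eq by simp_all

lemma A_star_bounds: "0.0928555702 \<le> 8 - A_star" "8 - A_star < 0.0928555703"
proof -
  define s where "s = sqrt (1/2)"
  have s: "0.707106781186547524 \<le> s" "s \<le> 0.707106781186547525"
    unfolding s_def by (rule real_le_rsqrt, simp add: power2_eq_square)
      (rule real_le_lsqrt, simp_all add: power2_eq_square)
  have "s * arctan_half_sum 56 \<le> arctan s" "arctan s \<le> s * arctan_half_sum 57"
    unfolding s_def arctan_sum_half[symmetric] by (intro arctan_ge_sum arctan_le_sum; simp)+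
  moreover have "s * 0.870419751367103197 \<le> s * arctan_half_sum 56" "s * arctan_half_sum 57 \<le> s * 0.870419751367103198"
    using s half_sum_lower half_sum_upper by (intro mult_left_mono; simp)+
  ultimately have a: "s * 0.870419751367103197 \<le> arctan s" "arctan s \<le> s * 0.870419751367103198"
    by linarith+
  have "s ^ 3 = s / 2"
    by (simp add: s_def power3_eq_cube)
  \<comment> \<open>The polynomial part \<open>s^3 / 3 - 2 s\<close> is \<open>s / 6 - 2 s\<close>,
    whence the factor 11/6.\<close>
  then have J: "J 0 = pi / 4 * (9/4 * arctan s - 11/6 * s)"
    by (simp add: J_def slope_primitive_def s_def)
  define X where "X = 9/4 * arctan s - 11/6 * s"
  have A: "8 - A_star = 8 - 9/8 * pi\<^sup>2 + 23/2 * (pi * X)"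
    by (simp add: A_star_eq J X_def)
  have X: "0.707106781186547524 * (9/4 * 0.870419751367103197 - 11/6) \<le> X" "X \<le> 0.707106781186547525 * (9/4 * 0.870419751367103198 - 11/6)"
  proof -
    have "0.707106781186547524 * (9/4 * 0.870419751367103197 - 11/6) \<le> s * (9/4 * 0.870419751367103197 - 11/6)"
      using s by (intro mult_right_mono) auto
    also have "\<dots> \<le> X"
      using a by (simp add: X_def algebra_simps)
    finally show "0.707106781186547524 * (9/4 * 0.870419751367103197 - 11/6) \<le> X" .
    have "X \<le> s * (9/4 * 0.870419751367103198 - 11/6)"
      using a by (simp add: X_def algebra_simps)
    also have "\<dots> \<le> 0.707106781186547525 * (9/4 * 0.870419751367103198 - 11/6)"
      using s by (intro mult_right_mono) auto
    finally show "X \<le> 0.707106781186547525 * (9/4 * 0.870419751367103198 - 11/6)" .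
  qed
  have X0: "0 \<le> X"
    using X(1) by simp
  have pi2: "3.141592653589793238 * 3.141592653589793238 \<le> pi\<^sup>2"
    unfolding power2_eq_square by (rule mult_mono) (use pi_lower in simp_all)
  have pi2': "pi\<^sup>2 \<le> 3.141592653589793239 * 3.141592653589793239"
    unfolding power2_eq_square by (rule mult_mono) (use pi_upper in simp_all)
  have piX: "3.141592653589793238 * (0.707106781186547524 * (9/4 * 0.870419751367103197 - 11/6)) \<le> pi * X"
    by (rule mult_mono[OF pi_lower X(1)]) simp_all
  have piX': "pi * X \<le> 3.141592653589793239 * (0.707106781186547525 * (9/4 * 0.870419751367103198 - 11/6))"
    by (rule mult_mono[OF pi_upper X(2)]) (use X0 in simp_all)
  show "0.0928555702 \<le> 8 - A_star" "8 - A_star < 0.0928555703"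
    unfolding A using pi2 pi2' piX piX' by simp_all
qed

section \<open>The bound for configurations\<close>

lemma sum_ordered_pairs:
  fixes g :: "nat \<Rightarrow> nat \<Rightarrow> real"
  assumes "\<And>i j. g i j = g j i"
  shows "(\<Sum>i\<in>{1..N}. \<Sum>j\<in>{1..N} - {i}. g i j) = 2 * (\<Sum>j\<in>{1..N}. \<Sum>i\<in>{1..<j}. g i j)"
proof -
  have split: "(\<Sum>j\<in>{1..N} - {i}. g i j) = (\<Sum>j\<in>{1..<i}. g i j) + (\<Sum>j\<in>{i<..N}. g i j)" if "i \<in> {1..N}" for i
  proof -
    have eq: "{1..N} - {i} = {1..<i} \<union> {i<..N}" using that by auto
    show ?thesis unfolding eq by (rule sum.union_disjoint) auto
  qed
  have "(\<Sum>i\<in>{1..N}. \<Sum>j\<in>{i<..N}. g i j) = (\<Sum>j\<in>{1..N}. \<Sum>i\<in>{1..<j}. g i j)"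
    unfolding sum.Sigma[OF finite_atLeastAtMost ballI[OF finite_greaterThanAtMost]] sum.Sigma[OF finite_atLeastAtMost ballI[OF finite_atLeastLessThan]]
    by (rule sum.reindex_bij_witness[of _ prod.swap prod.swap]) auto
  moreover have "(\<Sum>i\<in>{1..N}. \<Sum>j\<in>{1..<i}. g i j) = (\<Sum>j\<in>{1..N}. \<Sum>i\<in>{1..<j}. g i j)"
    by (intro sum.cong refl assms)
  ultimately show ?thesis
    using split by (simp add: sum.distrib)
qed

lemma weight_sum_ge_bound_B:
  fixes w :: "nat \<Rightarrow> real^4"
  assumes "inj_on w {1..23}" "contact_configuration (w ` {1..23})"
  shows "bound_B 23 8 f_coeff kernel_mat \<le> weight_sum 23 w"
proof -
  define x where "x i j = inner (w i) (w j)" for i j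
  have norm: "norm (w i) = 1" if "i \<in> {1..23}" for i
    using assms(2) that by (auto simp: contact_configuration_def image_subset_iff)
  have x1: "x i i = 1" if "i \<in> {1..23}" for i
    using norm[OF that] by (simp add: x_def norm_eq_1)
  have x_sym: "x i j = x j i" for i j
    by (simp add: x_def inner_commute)
  have x: "x i j \<in> {-1..1/2}" if "i \<in> {1..23}" "j \<in> {1..23}" "i \<noteq> j" for i j
  proof -
    have "\<bar>x i j\<bar> \<le> 1"
      using Cauchy_Schwarz_ineq2[of "w i" "w j"] norm that by (simp add: x_def)
    moreover have "w i \<noteq> w j"
      using assms(1) that by (meson inj_onD)
    then have "x i j \<le> 1/2"
      using assms(2) that by (simp add: contact_configuration_def x_def)
    ultimately show ?thesis by auto
  qed
  have "real 23 * (real 23 * f_coeff 0 - two_point 8 f_coeff 1) - real 23 * three_point 8 kernel_mat 1 1 1 / (3 * (real 23 - 2))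
      \<le> (\<Sum>i\<in>{1..23}. \<Sum>j\<in>{1..23} - {i}. \<omega> (x i j))"
  proof (rule three_point_bound[where I = "{1..23}" and x = x and F = "three_point 8 kernel_mat"
        and f = "two_point 8 f_coeff" and W = \<omega>])
    show "0 \<le> (\<Sum>i = 1..23. \<Sum>j = 1..23. \<Sum>l = 1..23. three_point 8 kernel_mat (x i j) (x i l) (x j l))"
      unfolding x_def by (rule sum_three_point_nonneg) (use norm in auto)
    show "(real 23)\<^sup>2 * f_coeff 0 \<le> (\<Sum>i = 1..23. \<Sum>j = 1..23. two_point 8 f_coeff (x i j))"
      unfolding x_def using sum_two_point_ge[where I = "{1..23}" and w = w and d = 8 and f = f_coeff] norm by (simp add: f_coeff_def)
    show "0 \<le> \<omega> (x i j) + \<omega> (x i l) + \<omega> (x j l) - two_point 8 f_coeff (x i j) - two_point 8 f_coeff (x i l)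
        - two_point 8 f_coeff (x j l) - three_point 8 kernel_mat (x i j) (x i l) (x j l)
        - (three_point 8 kernel_mat 1 (x i j) (x i j) + three_point 8 kernel_mat 1 (x i l) (x i l)
           + three_point 8 kernel_mat 1 (x j l) (x j l)) / (real 23 - 2)"
      if "i \<in> {1..23}" "j \<in> {1..23} - {i}" "l \<in> {1..23} - {i, j}" for i j l
      by (rule triple_inequality; rule x) (use that in auto)
  qed (use x1 x_sym three_point_swap in auto)
  \<comment> \<open>Ordered pairs count each weight twice; accordingly the left side is twice
    \<open>bound_B\<close>.\<close>
  also have "\<dots> = 2 * weight_sum 23 w"
    unfolding weight_sum_def x_def by (rule sum_ordered_pairs) (simp add: inner_commute)
  finally show ?thesis
    unfolding bound_B_def by (simp add: field_simps)
qed

lemma closed_cell: "closed (cell W)"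
proof -
  have "cell W = (\<Inter>w\<in>W. {x. inner x w \<le> 1})"
    by (auto simp: cell_def)
  then show ?thesis
    by (simp only:) (intro closed_INT ballI closed_Collect_le continuous_intros)
qed

theorem theorem7p73:
  fixes N d :: nat
  assumes "N = 23" and "d = 8"
  shows "\<exists>(f :: nat \<Rightarrow> real) (F :: nat \<Rightarrow> real mat).
    (\<forall>k\<in>{1..d}. f k > 0) \<and>
    (\<forall>k\<in>{0..d}. sym_pos_def (d - k + 1) (F k)) \<and>
    (\<forall>u\<in>{-1..1/2}. \<forall>v\<in>{-1..1/2}. \<forall>t\<in>{-1..1/2}.
       1 + 2 * u * v * t - u^2 - v^2 - t^2 \<ge> 0 \<longrightarrow>
       \<omega> u + \<omega> v + \<omega> t - two_point d f u - two_point d f v - two_point d f t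
         - three_point d F u v t
         - (three_point d F 1 u u + three_point d F 1 v v + three_point d F 1 t t) / (real N - 2)
       \<ge> 0) \<and>
    0.0929000002 \<le> bound_B N d f F \<and> bound_B N d f F < 0.0929000003 \<and>
    bound_B N d f F > 8 - A_star \<and>
    0.0928555702 \<le> 8 - A_star \<and> 8 - A_star < 0.0928555703 \<and>
    (\<forall>w :: nat \<Rightarrow> real^4.
       inj_on w {1..N} \<and> contact_configuration (w ` {1..N}) \<longrightarrow>
       weight_sum N w \<ge> (8 - A_star) + 0.0000444) \<and>
    (\<forall>w :: nat \<Rightarrow> real^4.
       inj_on w {1..N} \<and> contact_configuration (w ` {1..N}) \<and> bounded (cell (w ` {1..N})) \<longrightarrow>
       measure lborel (cell (w ` {1..N}))
         \<ge> measure lborel (cell (w ` {1..N}) \<inter> cball 0 (sqrt (3/2))) \<and>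
       measure lborel (cell (w ` {1..N}) \<inter> cball 0 (sqrt (3/2))) = A_star + weight_sum N w \<and>
       A_star + weight_sum N w \<ge> A_star + bound_B N d f F \<and>
       A_star + bound_B N d f F > 8)"
  unfolding assms
proof (rule exI[of _ f_coeff], rule exI[of _ kernel_mat], intro conjI)
  note bounds = bound_B_bounds A_star_bounds
  show "0.0929000002 \<le> bound_B 23 8 f_coeff kernel_mat" "bound_B 23 8 f_coeff kernel_mat < 0.0929000003"
    "0.0928555702 \<le> 8 - A_star" "8 - A_star < 0.0928555703"
    by (fact bounds)+
  show gt: "8 - A_star < bound_B 23 8 f_coeff kernel_mat"
    using bounds by simp
  show "\<forall>k\<in>{1..8}. 0 < f_coeff k"
    by (simp add: f_coeff_def)
  show "\<forall>k\<in>{0..8}. sym_pos_def (8 - k + 1) (kernel_mat k)"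
    using sym_pos_def_kernel_mat by simp
  show "\<forall>u\<in>{-1..1/2}. \<forall>v\<in>{-1..1/2}. \<forall>t\<in>{-1..1/2}.
       1 + 2 * u * v * t - u^2 - v^2 - t^2 \<ge> 0 \<longrightarrow>
       \<omega> u + \<omega> v + \<omega> t - two_point 8 f_coeff u - two_point 8 f_coeff v - two_point 8 f_coeff t
         - three_point 8 kernel_mat u v t
         - (three_point 8 kernel_mat 1 u u + three_point 8 kernel_mat 1 v v + three_point 8 kernel_mat 1 t t) / (real 23 - 2)
       \<ge> 0"
    using triple_inequality by blast
  show "\<forall>w :: nat \<Rightarrow> real^4. inj_on w {1..23} \<and> contact_configuration (w ` {1..23}) \<longrightarrow>
       weight_sum 23 w \<ge> (8 - A_star) + 0.0000444"
  proof (intro allI impI)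
    fix w :: "nat \<Rightarrow> real^4"
    assume "inj_on w {1..23} \<and> contact_configuration (w ` {1..23})"
    then have "bound_B 23 8 f_coeff kernel_mat \<le> weight_sum 23 w"
      using weight_sum_ge_bound_B by blast
    moreover have "0.0928555703 + 0.0000444 \<le> (0.0929000002 :: real)" by simp
    ultimately show "weight_sum 23 w \<ge> (8 - A_star) + 0.0000444"
      using bounds by linarith
  qed
  show "\<forall>w :: nat \<Rightarrow> real^4.
       inj_on w {1..23} \<and> contact_configuration (w ` {1..23}) \<and> bounded (cell (w ` {1..23})) \<longrightarrow>
       measure lborel (cell (w ` {1..23}))
         \<ge> measure lborel (cell (w ` {1..23}) \<inter> cball 0 (sqrt (3/2))) \<and>
       measure lborel (cell (w ` {1..23}) \<inter> cball 0 (sqrt (3/2))) = A_star + weight_sum 23 w \<and>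
       A_star + weight_sum 23 w \<ge> A_star + bound_B 23 8 f_coeff kernel_mat \<and>
       A_star + bound_B 23 8 f_coeff kernel_mat > 8"
  proof (intro allI impI, elim conjE, intro conjI)
    fix w :: "nat \<Rightarrow> real^4"
    assume w: "inj_on w {1..23}" "contact_configuration (w ` {1..23})" and bd: "bounded (cell (w ` {1..23}))"
    show "measure lborel (cell (w ` {1..23})) \<ge> measure lborel (cell (w ` {1..23}) \<inter> cball 0 (sqrt (3/2)))"
    proof (rule measure_mono_fmeasurable)
      show "cell (w ` {1..23}) \<in> fmeasurable lborel"
        using closed_cell[of "w ` {1..23}"] emeasure_bounded_finite[OF bd] by (intro fmeasurableI) auto
    qed (use closed_cell in \<open>auto intro!: borel_closed closed_Int\<close>)
    show "measure lborel (cell (w ` {1..23}) \<inter> cball 0 (sqrt (3/2))) = A_star + weight_sum 23 w"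
      using measure_truncated_cell[OF w] by (simp add: A_star_eq)
    show "A_star + weight_sum 23 w \<ge> A_star + bound_B 23 8 f_coeff kernel_mat"
      using weight_sum_ge_bound_B[OF w] by simp
    show "A_star + bound_B 23 8 f_coeff kernel_mat > 8"
      using gt by simp
  qed
qed
end
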